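(* Let $d\ge2$ and let $f_n\in\mathcal{B}_d$ be quasi post-critically finite. After passing to a subsequence, there exist a constant $K>0$, a simplicial map $f:(\mathcal{T},p)\to(\mathcal{T},p)$ on a pointed finite ribbon tree with vertex set $\mathcal{V}$, a sequence of pointed finite ribbon trees $(\mathcal{T}_n,p_n)$ with $p_n\in\mathcal{T}_n\subseteq\mathbb{D}$, and a sequence of isomorphisms $\phi_n:(\mathcal{T},p)\to(\mathcal{T}_n,p_n)$ such that: (1) (Degenerating tree) if $v_1\ne v_2\in\mathcal{V}$, then $d_{\mathbb{D}}(\phi_n(v_1),\phi_n(v_2))\to\infty$; (2) (Geodesic edge) if $E=[v_1,v_2]\subseteq\mathcal{T}$ is an edge, then the corresponding edge $\phi_n(E)\subseteq\mathcal{T}_n$ is a hyperbolic geodesic segment connecting $\phi_n(v_1)$ and $\phi_n(v_2)$; (3) (Critically approximating) any critical point of $f_n$ (in $\mathbb{D}$) is within hyperbolic distance $K$ from the vertex set $\mathcal{V}_n:=\phi_n(\mathcal{V})$ of $\mathcal{T}_n$; (4) (Quasi-invariance on vertices) if $v\in\mathcal{V}$, then $d_{\mathbb{D}}(f_n(\phi_n(v)),\phi_n(f(v)))\le K$ for all $n$; (5) (Quasi-invariance on edges) if $E\subseteq\mathcal{T}$ is an edge and $x_n\in\phi_n(E)$, then there exists $y_n\in\phi_n(f(E))$ such that $d_{\mathbb{D}}(f_n(x_n),y_n)\le K$ for all $n$; and if $E$ is a periodic edge of period $q$, then $d_{\mathbb{D}}(f_n^q(x_n),x_n)\le K$ for all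 $n$.
   Context: $\mathbb{D}$ is the unit disk with hyperbolic metric $d_{\mathbb{D}}$. $\mathcal{B}_d$ is the space of Blaschke products $f(z)=z\prod_{i=1}^{d-1}\frac{z-a_i}{1-\overline{a_i}z}$ with $|a_i|<1$. A sequence $f_n\in\mathcal{B}_d$ is $K'$-quasi post-critically finite if the critical points in $\mathbb{D}$ can be labeled $c_{i,n}$, $i=1,\dots,d-1$, such that for each $i$ there exist $l_i$ and $q_i$ (quasi pre-period and quasi period) with $d_{\mathbb{D}}(f_n^{l_i}(c_{i,n}),f_n^{l_i+q_i}(c_{i,n}))\le K'$ for all $n$; it is quasi post-critically finite if this holds for some $K'$. A ribbon structure on a finite tree is a choice of planar embedding up to isotopy (equivalently, a cyclic ordering of the edges at each vertex); a ribbon tree is a tree with a ribbon structure. A map $f:\mathcal{T}\to\mathcal{T}$ is simplicial if it sends each edge to an edge; a map of pointed trees fixes the base point. *)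

theory Defs
  imports "HOL-Complex_Analysis.Complex_Analysis" "HOL-Combinatorics.Orbits"
begin

subsection \<open>The hyperbolic disk\<close>

abbreviation unit_disk :: "complex set" where
  "unit_disk \<equiv> ball 0 1"

text \<open>The distance of the metric \<open>2 |dz| / (1 - |z|^2)\<close>, of curvature \<open>-1\<close>;
  meaningful for points of the unit disk only.\<close>

definition hyp_dist :: "complex \<Rightarrow> complex \<Rightarrow> real" where
  "hyp_dist z w = 2 * artanh (cmod ((z - w) / (1 - cnj w * z)))"

definition hyp_geodesic_segment :: "complex set \<Rightarrow> complex \<Rightarrow> complex \<Rightarrow> bool" where
  "hyp_geodesic_segment S z w \<longleftrightarrow>
     (\<exists>\<gamma> :: real \<Rightarrow> complex.
        \<gamma> ` {0..hyp_dist z w} = S \<and> S \<subseteq> unit_disk \<and>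
        \<gamma> 0 = z \<and> \<gamma> (hyp_dist z w) = w \<and>
        (\<forall>s\<in>{0..hyp_dist z w}. \<forall>t\<in>{0..hyp_dist z w}.
            hyp_dist (\<gamma> s) (\<gamma> t) = \<bar>s - t\<bar>))"


subsection \<open>Blaschke products\<close>

definition blaschke_products :: "nat \<Rightarrow> (complex \<Rightarrow> complex) set" where
  "blaschke_products d =
     {f. \<exists>a :: nat \<Rightarrow> complex. (\<forall>i\<in>{1..d-1}. cmod (a i) < 1) \<and>
           f = (\<lambda>z. z * (\<Prod>i=1..d-1. (z - a i) / (1 - cnj (a i) * z)))}"

text \<open>A labelling lists each critical point in the disk as often as its multiplicity, which is
  the vanishing order of the derivative (\<open>zorder\<close> is 0 where the derivative does not vanish).\<close>

definition critical_labelling ::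
    "nat \<Rightarrow> (complex \<Rightarrow> complex) \<Rightarrow> (nat \<Rightarrow> complex) \<Rightarrow> bool" where
  "critical_labelling d f c \<longleftrightarrow>
     (\<forall>i\<in>{1..d-1}. c i \<in> unit_disk) \<and>
     (\<forall>z\<in>unit_disk. int (card {i\<in>{1..d-1}. c i = z}) = zorder (deriv f) z)"

definition K_quasi_pcf :: "real \<Rightarrow> nat \<Rightarrow> (nat \<Rightarrow> complex \<Rightarrow> complex) \<Rightarrow> bool" where
  "K_quasi_pcf K d f \<longleftrightarrow>
     (\<exists>c :: nat \<Rightarrow> nat \<Rightarrow> complex.
        (\<forall>n. critical_labelling d (f n) (\<lambda>i. c i n)) \<and>
        (\<forall>i\<in>{1..d-1}. \<exists>l q. q \<ge> 1 \<and>
           (\<forall>n. hyp_dist ((f n ^^ l) (c i n)) ((f n ^^ (l + q)) (c i n)) \<le> K)))"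

definition quasi_pcf :: "nat \<Rightarrow> (nat \<Rightarrow> complex \<Rightarrow> complex) \<Rightarrow> bool" where
  "quasi_pcf d f \<longleftrightarrow> (\<exists>K. K_quasi_pcf K d f)"


subsection \<open>Finite ribbon trees\<close>

text \<open>Edges are two-element sets of vertices. For an edge \<open>e\<close> at a vertex \<open>v\<close>, \<open>nxt T v e\<close> is the
  successor of \<open>e\<close> in the cyclic ordering at \<open>v\<close>.\<close>

record 'v ribbon_graph =
  verts :: "'v set"
  edges :: "'v set set"
  nxt   :: "'v \<Rightarrow> 'v set \<Rightarrow> 'v set"

definition edges_at :: "('v, 'b) ribbon_graph_scheme \<Rightarrow> 'v \<Rightarrow> 'v set set" where
  "edges_at T v = {e \<in> edges T. v \<in> e}"

definition simple_path_between ::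
    "('v, 'b) ribbon_graph_scheme \<Rightarrow> 'v \<Rightarrow> 'v \<Rightarrow> 'v list \<Rightarrow> bool" where
  "simple_path_between T u v xs \<longleftrightarrow>
     xs \<noteq> [] \<and> hd xs = u \<and> last xs = v \<and> distinct xs \<and> set xs \<subseteq> verts T \<and>
     successively (\<lambda>x y. {x, y} \<in> edges T) xs"

definition finite_tree :: "('v, 'b) ribbon_graph_scheme \<Rightarrow> bool" where
  "finite_tree T \<longleftrightarrow>
     finite (verts T) \<and> verts T \<noteq> {} \<and>
     (\<forall>e\<in>edges T. e \<subseteq> verts T \<and> card e = 2) \<and>
     (\<forall>u\<in>verts T. \<forall>v\<in>verts T. \<exists>!xs. simple_path_between T u v xs)"

definition finite_ribbon_tree :: "('v, 'b) ribbon_graph_scheme \<Rightarrow> bool" where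
  "finite_ribbon_tree T \<longleftrightarrow>
     finite_tree T \<and>
     (\<forall>v\<in>verts T. edges_at T v \<noteq> {} \<longrightarrow> cyclic_on (nxt T v) (edges_at T v))"

definition pointed_ribbon_tree :: "('v, 'b) ribbon_graph_scheme \<Rightarrow> 'v \<Rightarrow> bool" where
  "pointed_ribbon_tree T p \<longleftrightarrow> finite_ribbon_tree T \<and> p \<in> verts T"

text \<open>A simplicial map is given on vertices; its action on edges is \<open>e \<mapsto> F ` e\<close>.\<close>

definition pointed_simplicial_map ::
    "('v, 'b) ribbon_graph_scheme \<Rightarrow> 'v \<Rightarrow> ('v \<Rightarrow> 'v) \<Rightarrow> bool" where
  "pointed_simplicial_map T p F \<longleftrightarrow>
     F ` verts T \<subseteq> verts T \<and> (\<forall>e\<in>edges T. F ` e \<in> edges T) \<and> F p = p"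

definition pointed_ribbon_iso ::
    "('v, 'b) ribbon_graph_scheme \<Rightarrow> 'v \<Rightarrow> ('w, 'c) ribbon_graph_scheme \<Rightarrow> 'w \<Rightarrow> ('v \<Rightarrow> 'w) \<Rightarrow> bool" where
  "pointed_ribbon_iso T p T' p' \<phi> \<longleftrightarrow>
     bij_betw \<phi> (verts T) (verts T') \<and>
     edges T' = (\<lambda>e. \<phi> ` e) ` edges T \<and>
     (\<forall>v\<in>verts T. \<forall>e\<in>edges_at T v. nxt T' (\<phi> v) (\<phi> ` e) = \<phi> ` nxt T v e) \<and>
     \<phi> p = p'"

text \<open>The period of an edge is its least period: a bound on the displacement under the first
  return of the edge cannot hold uniformly for all further returns, as the orbits of a Blaschke
  product of degree at least 2 fixing 0 converge to 0.\<close>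

definition edge_has_period :: "('v \<Rightarrow> 'v) \<Rightarrow> 'v set \<Rightarrow> nat \<Rightarrow> bool" where
  "edge_has_period F e q \<longleftrightarrow>
     q \<ge> 1 \<and> (F ^^ q) ` e = e \<and> (\<forall>j. 1 \<le> j \<and> j < q \<longrightarrow> (F ^^ j) ` e \<noteq> e)"


subsection \<open>Ribbon trees embedded in the disk\<close>

text \<open>The vertices are points of the disk and every edge is realised by an arc.\<close>

record plane_ribbon_graph = "complex ribbon_graph" +
  edge_arc :: "complex set \<Rightarrow> complex set"

text \<open>The point \<open>x\<close> at which the arc \<open>A\<close>, followed from its endpoint \<open>v\<close>, first meets the circle of
  radius \<open>r\<close> about \<open>v\<close>.\<close>

definition first_exit :: "complex set \<Rightarrow> complex \<Rightarrow> real \<Rightarrow> complex \<Rightarrow> bool" where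
  "first_exit A v r x \<longleftrightarrow>
     (\<exists>\<gamma>. arc \<gamma> \<and> path_image \<gamma> \<subseteq> A \<and> pathstart \<gamma> = v \<and> pathfinish \<gamma> = x \<and>
          dist v x = r \<and> (\<forall>t\<in>{0..<1}. dist v (\<gamma> t) < r))"

definition ccw_angle :: "complex \<Rightarrow> complex \<Rightarrow> complex \<Rightarrow> real" where
  "ccw_angle v x y = Arg2pi ((y - v) / (x - v))"

text \<open>The cyclic ordering induced by the embedding: on all small circles about \<open>v\<close>, the first
  exit point of \<open>nxt T v e\<close> is the next one counterclockwise after that of \<open>e\<close>. If \<open>e\<close> is not the
  only edge at \<open>v\<close>, then \<open>nxt T v e \<noteq> e\<close> because \<open>nxt T v\<close> is cyclic.\<close>

definition ribbon_from_plane :: "plane_ribbon_graph \<Rightarrow> bool" where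
  "ribbon_from_plane T \<longleftrightarrow>
     (\<forall>v\<in>verts T. \<forall>\<^sub>F r in at_right 0.
        \<forall>e\<in>edges_at T v. \<forall>e'\<in>edges_at T v - {e}. \<forall>x y z.
          first_exit (edge_arc T e) v r x \<and>
          first_exit (edge_arc T (nxt T v e)) v r y \<and>
          first_exit (edge_arc T e') v r z \<longrightarrow>
          ccw_angle v x y \<le> ccw_angle v x z)"

definition pointed_ribbon_tree_in_disk :: "plane_ribbon_graph \<Rightarrow> complex \<Rightarrow> bool" where
  "pointed_ribbon_tree_in_disk T p \<longleftrightarrow>
     pointed_ribbon_tree T p \<and>
     verts T \<subseteq> unit_disk \<and>
     (\<forall>e\<in>edges T. \<exists>\<gamma>. arc \<gamma> \<and> path_image \<gamma> = edge_arc T e \<and>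
                      {pathstart \<gamma>, pathfinish \<gamma>} = e) \<and>
     (\<forall>e\<in>edges T. edge_arc T e \<subseteq> unit_disk \<and> edge_arc T e \<inter> verts T = e) \<and>
     (\<forall>e\<in>edges T. \<forall>e'\<in>edges T. e \<noteq> e' \<longrightarrow> edge_arc T e \<inter> edge_arc T e' \<subseteq> e \<inter> e') \<and>
     ribbon_from_plane T"

end

theory Submission
  imports Defs "HOL-Computational_Algebra.Fundamental_Theorem_Algebra"
begin

text \<open>Fix a free ultrafilter and consider sequences of points of the disk up to bounded distance
  along it. By the four-point inequality they behave like the points of a tree, on which the maps
  \<open>f n\<close> induce a single 1-Lipschitz map \<open>f\<close>. The distance of \<open>f z\<close> to \<open>f w\<close> is, up to a constant, the
  distance of \<open>z\<close> to the nearest preimage of \<open>f w\<close>, and two close preimages of one point force a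
  critical point nearby; hence \<open>f\<close> is isometric on every segment without critical points in its
  interior. The critical orbits are finite in the limit. The branch points of their hull together
  with the points of the hull that are eventually mapped to them form a finite invariant vertex set,
  because \<open>f\<close> cannot lengthen an edge. Choosing representing sequences for these vertices, all
  requirements hold for ultrafilter-many \<open>n\<close>, which yields the subsequence.\<close>

subsection \<open>The hyperbolic metric\<close>

text \<open>Distinct edges may degenerate at incomparable rates, so no single rescaling of the
  hyperbolic metric yields a metric tree that keeps all vertices apart. The limit object is
  therefore purely relational: \<open>near\<close> (bounded distance) and \<open>btw\<close>
  (bounded defect in the triangle inequality). Lengths stay sequences of reals that are compared up
  to bounded errors. The ultrafilter decides every alternative for whole sequences at once: an
  index, a case of the four-point inequality or a cyclic order that depends on n may be taken
  constant. The additive constants have two sources: 6 comes from the four-point inequality, and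
  logarithms of the degree come from comparing a product of d pseudo-hyperbolic distances with its
  smallest factor. The obstacle to isometry is that a preimage far from both ends of a segment may
  still compete with the nearby one; only the absence of critical points excludes this.\<close>

abbreviation mob :: "complex \<Rightarrow> complex \<Rightarrow> complex" where
  "mob v z \<equiv> (z - v) / (1 - cnj v * z)"

lemma one_minus_cnj_mult_nonzero:
  assumes "cmod v \<le> 1" "cmod z < 1"
  shows "1 - cnj v * z \<noteq> 0"
proof
  assume "1 - cnj v * z = 0"
  hence "cmod (cnj v * z) = 1" by (metis eq_iff_diff_eq_0 norm_one)
  hence "cmod v * cmod z = 1" by (simp add: norm_mult)
  moreover have "cmod v * cmod z \<le> 1 * cmod z" by (intro mult_right_mono assms(1)) auto
  ultimately show False using assms(2) by simp
qed

text \<open>The sign of the right-hand side decides whether \<open>cmod (mob v z)\<close> is below,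
  equal to or above 1. The identity is applied inside the disk, on the circle and outside.\<close>

lemma cmod_diff_cnj_identity:
  "(cmod (1 - cnj v * z))\<^sup>2 - (cmod (z - v))\<^sup>2 = (1 - (cmod v)\<^sup>2) * (1 - (cmod z)\<^sup>2)"
  unfolding cmod_power2 by (simp add: algebra_simps power2_eq_square)

lemma one_minus_mob_sq:
  assumes "cmod v < 1" "cmod z < 1"
  shows "1 - (cmod (mob v z))\<^sup>2 = (1 - (cmod v)\<^sup>2) * (1 - (cmod z)\<^sup>2) / (cmod (1 - cnj v * z))\<^sup>2"
proof -
  have "cmod (1 - cnj v * z) \<noteq> 0" using one_minus_cnj_mult_nonzero[of v z] assms by simp
  thus ?thesis
    unfolding cmod_diff_cnj_identity[symmetric] by (simp add: norm_divide power_divide field_simps)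
qed

lemma cmod_mob_less_1:
  assumes "cmod v < 1" "cmod z < 1"
  shows "cmod (mob v z) < 1"
proof -
  have "cmod (1 - cnj v * z) \<noteq> 0" using one_minus_cnj_mult_nonzero[of v z] assms by simp
  hence "1 - (cmod (mob v z))\<^sup>2 > 0"
    unfolding one_minus_mob_sq[OF assms] using assms
    by (intro divide_pos_pos mult_pos_pos) (auto simp: power_less_one_iff abs_square_less_1)
  thus ?thesis using power2_less_imp_less[of "cmod (mob v z)" 1] by simp
qed

lemma mob_inverse:
  assumes "cmod v < 1" "cmod z < 1"
  shows "mob (- v) (mob v z) = z" "mob v (mob (- v) z) = z"
proof -
  have key: "mob (- u) (mob u z) = z" if u: "cmod u < 1" for u
  proof -
    have n: "1 - cnj u * z \<noteq> 0" using one_minus_cnj_mult_nonzero[of u z] u assms by simp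
    have n2: "1 - cnj u * u \<noteq> 0" using one_minus_cnj_mult_nonzero[of u u] u by simp
    have a: "mob u z + u = z * (1 - cnj u * u) / (1 - cnj u * z)"
      using n by (simp add: field_simps)
    have b: "1 + cnj u * mob u z = (1 - cnj u * u) / (1 - cnj u * z)"
      using n by (simp add: field_simps)
    have "mob (- u) (mob u z) = (mob u z + u) / (1 + cnj u * mob u z)" by simp
    also have "\<dots> = z" unfolding a b using n n2 by simp
    finally show ?thesis .
  qed
  show "mob (- v) (mob v z) = z" using key[of v] assms by simp
  show "mob v (mob (- v) z) = z" using key[of "-v"] assms by simp
qed

lemma cmod_mob_commute: "cmod (mob z w) = cmod (mob w z)"
proof -
  have "cmod (1 - cnj z * w) = cmod (cnj (1 - cnj z * w))" by (simp only: complex_mod_cnj)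
  also have "\<dots> = cmod (1 - cnj w * z)" by (simp add: mult.commute)
  finally show ?thesis by (simp add: norm_divide norm_minus_commute)
qed

text \<open>Numerator and denominator of the outer quotient pick up the same factor
  \<open>1 - cnj v * v\<close>; what remains differs only by a conjugation, which the modulus does
  not see.\<close>

lemma cmod_mob_invariant:
  assumes "cmod v < 1" "cmod z < 1" "cmod w < 1"
  shows "cmod (mob (mob v w) (mob v z)) = cmod (mob w z)"
proof -
  have nz: "1 - cnj v * z \<noteq> 0" "1 - cnj v * w \<noteq> 0" "1 - cnj w * z \<noteq> 0" "1 - v * cnj w \<noteq> 0"
    using one_minus_cnj_mult_nonzero[of v z] one_minus_cnj_mult_nonzero[of v w]
      one_minus_cnj_mult_nonzero[of w z] one_minus_cnj_mult_nonzero[of w v] assms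
    by (auto simp: mult.commute)
  have n2: "1 - cnj v * v \<noteq> 0" using one_minus_cnj_mult_nonzero[of v v] assms by simp
  have a: "mob v z - mob v w = (z - w) * (1 - cnj v * v) / ((1 - cnj v * z) * (1 - cnj v * w))"
    using nz by (simp add: diff_frac_eq) (simp add: algebra_simps)
  have b: "1 - cnj (mob v w) * mob v z
      = (1 - cnj w * z) * (1 - cnj v * v) / ((1 - cnj v * z) * (1 - v * cnj w))"
    using nz by (simp add: divide_simps) (simp add: algebra_simps)
  have c: "cmod (1 - cnj v * w) = cmod (1 - v * cnj w)"
    by (metis complex_cnj_cnj complex_cnj_diff complex_cnj_mult complex_cnj_one complex_mod_cnj)
  show ?thesis using nz n2 unfolding norm_divide[of "mob v z - mob v w"] a b
    by (simp add: norm_mult norm_divide c)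
qed

lemma hyp_dist_mob: "hyp_dist z w = 2 * artanh (cmod (mob w z))"
  by (simp add: hyp_dist_def)

lemma hyp_dist_commute: "hyp_dist z w = hyp_dist w z"
  by (simp add: hyp_dist_mob cmod_mob_commute[of w])

lemma hyp_dist_refl [simp]: "hyp_dist z z = 0"
  by (simp add: hyp_dist_def)

lemma hyp_dist_mob_invariant:
  assumes "cmod v < 1" "cmod z < 1" "cmod w < 1"
  shows "hyp_dist (mob v z) (mob v w) = hyp_dist z w"
  unfolding hyp_dist_mob cmod_mob_invariant[OF assms] ..

lemma artanh_mono:
  fixes x y :: real
  assumes "-1 < x" "x \<le> y" "y < 1"
  shows "artanh x \<le> artanh y"
proof -
  have "(1 + x) / (1 - x) \<le> (1 + y) / (1 - y)"
    using assms by (intro frac_le) auto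
  thus ?thesis unfolding artanh_def using assms by (simp add: divide_right_mono)
qed

lemma tanh_artanh_real:
  fixes x :: real
  assumes "-1 < x" "x < 1"
  shows "tanh (artanh x) = x"
proof -
  have p: "(1 + x) / (1 - x) > 0" using assms by simp
  have "exp (- 2 * artanh x) = (1 - x) / (1 + x)"
    using p by (simp add: artanh_def exp_minus)
  hence "tanh (artanh x) = (1 - (1 - x) / (1 + x)) / (1 + (1 - x) / (1 + x))"
    using tanh_real_altdef[of "artanh x"] by simp
  also have "\<dots> = x" using assms by (simp add: field_simps)
  finally show ?thesis .
qed

lemma hyp_dist_nonneg:
  assumes "cmod z < 1" "cmod w < 1"
  shows "hyp_dist z w \<ge> 0"
  using artanh_mono[of 0 "cmod (mob w z)"] cmod_mob_less_1[of w z] assms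
  by (simp add: hyp_dist_mob)

lemma tanh_hyp_dist:
  assumes "cmod z < 1" "cmod w < 1"
  shows "tanh (hyp_dist z w / 2) = cmod (mob w z)"
  unfolding hyp_dist_mob using cmod_mob_less_1[of w z] assms
  by (simp add: tanh_artanh_real less_le_trans[OF _ norm_ge_zero])

lemma hyp_dist_le_iff:
  assumes "cmod z < 1" "cmod w < 1" "cmod z' < 1" "cmod w' < 1"
  shows "hyp_dist z w \<le> hyp_dist z' w' \<longleftrightarrow> cmod (mob w z) \<le> cmod (mob w' z')"
  using assms by (simp flip: tanh_hyp_dist)

lemma hyp_dist_0: "hyp_dist z 0 = 2 * artanh (cmod z)"
  by (simp add: hyp_dist_mob)

lemma artanh_add:
  fixes x y :: real
  assumes "0 \<le> x" "x < 1" "0 \<le> y" "y < 1"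
  shows "artanh ((x + y) / (1 + x * y)) = artanh x + artanh y"
proof -
  have p: "1 + x * y > 0" using assms by (simp add: add_pos_nonneg)
  have "1 + (x + y) / (1 + x * y) = (1 + x) * (1 + y) / (1 + x * y)"
    "1 - (x + y) / (1 + x * y) = (1 - x) * (1 - y) / (1 + x * y)"
    using p by (simp_all add: field_simps)
  thus ?thesis using assms p
    by (simp add: artanh_def ln_mult ln_div add_divide_distrib[symmetric] del: ln_mult_pos)
qed

text \<open>For given moduli the extreme case is that of points on opposite sides of 0, where
  \<open>cmod (1 - cnj w * z)\<close> takes its largest value \<open>1 + cmod z * cmod w\<close>.
  Together with the addition law of \<open>artanh\<close> this is the triangle inequality through
  0.\<close>

lemma cmod_mob_le:
  assumes "cmod z < 1" "cmod w < 1"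
  shows "cmod (mob w z) \<le> (cmod z + cmod w) / (1 + cmod z * cmod w)"
proof -
  define r where "r = cmod w"
  define s where "s = cmod z"
  have rs: "0 \<le> r" "r < 1" "0 \<le> s" "s < 1" using assms by (auto simp: r_def s_def)
  have p: "1 + s * r > 0" using rs by (simp add: add_pos_nonneg)
  have nz: "cmod (1 - cnj w * z) > 0" using one_minus_cnj_mult_nonzero[of w z] assms by simp
  have le: "cmod (1 - cnj w * z) \<le> 1 + s * r"
    using norm_triangle_ineq4[of 1 "cnj w * z"] by (simp add: norm_mult r_def s_def mult.commute)
  have "1 - (cmod (mob w z))\<^sup>2 = (1 - r\<^sup>2) * (1 - s\<^sup>2) / (cmod (1 - cnj w * z))\<^sup>2"
    using one_minus_mob_sq[of w z] assms by (simp add: r_def s_def)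
  also have "\<dots> \<ge> (1 - r\<^sup>2) * (1 - s\<^sup>2) / (1 + s * r)\<^sup>2"
    using rs nz le by (intro divide_left_mono power_mono mult_nonneg_nonneg mult_pos_pos)
      (auto simp: power_le_one)
  finally have "(cmod (mob w z))\<^sup>2 \<le> 1 - (1 - r\<^sup>2) * (1 - s\<^sup>2) / (1 + s * r)\<^sup>2" by simp
  also have "\<dots> = ((s + r) / (1 + s * r))\<^sup>2"
    using p by (simp add: power_divide divide_simps) (simp add: power2_eq_square algebra_simps)
  finally show ?thesis
    unfolding r_def[symmetric] s_def[symmetric]
    by (rule power2_le_imp_le) (use rs p in auto)
qed

text \<open>The automorphism \<open>mob y\<close> moves the middle point to 0, where
  \<open>cmod_mob_le\<close> and \<open>artanh_add\<close> apply.\<close>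

lemma hyp_dist_triangle:
  assumes "cmod x < 1" "cmod y < 1" "cmod z < 1"
  shows "hyp_dist x z \<le> hyp_dist x y + hyp_dist y z"
proof -
  let ?a = "mob y x" and ?b = "mob y z"
  have ab: "cmod ?a < 1" "cmod ?b < 1" using cmod_mob_less_1 assms by auto
  have "hyp_dist x z = 2 * artanh (cmod (mob ?b ?a))"
    using hyp_dist_mob_invariant[of y x z] assms by (simp add: hyp_dist_mob)
  also have "\<dots> \<le> 2 * artanh ((cmod ?a + cmod ?b) / (1 + cmod ?a * cmod ?b))"
  proof -
    have "(cmod ?a + cmod ?b) / (1 + cmod ?a * cmod ?b) < 1"
    proof -
      have "(1 - cmod ?a) * (1 - cmod ?b) > 0" using ab by simp
      thus ?thesis using ab by (simp add: divide_simps add_pos_nonneg algebra_simps)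
    qed
    hence "artanh (cmod (mob ?b ?a)) \<le> artanh ((cmod ?a + cmod ?b) / (1 + cmod ?a * cmod ?b))"
      by (intro artanh_mono cmod_mob_le ab less_le_trans[OF _ norm_ge_zero]) simp_all
    thus ?thesis by (rule mult_left_mono) simp
  qed
  also have "\<dots> = 2 * artanh (cmod ?a) + 2 * artanh (cmod ?b)"
    using artanh_add[of "cmod ?a" "cmod ?b"] ab by simp
  also have "\<dots> = hyp_dist x y + hyp_dist y z"
    by (simp only: hyp_dist_mob cmod_mob_commute[of z y])
  finally show ?thesis .
qed

text \<open>From sinh^2 = tanh^2 / (1 - tanh^2) and \<open>one_minus_mob_sq\<close>. Unlike that of
  \<open>cmod (mob w z)\<close>, the denominator splits into one factor per endpoint.\<close>

lemma sinh_half_hyp_dist: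
  assumes "cmod z < 1" "cmod w < 1"
  shows "sinh (hyp_dist z w / 2) = cmod (z - w) / (sqrt (1 - (cmod z)\<^sup>2) * sqrt (1 - (cmod w)\<^sup>2))"
proof -
  define t where "t = hyp_dist z w / 2"
  have t: "t \<ge> 0" using hyp_dist_nonneg[OF assms] by (simp add: t_def)
  have nz: "cmod (1 - cnj w * z) > 0" using one_minus_cnj_mult_nonzero[of w z] assms by simp
  have c0: "cosh t \<noteq> 0" by (simp add: cosh_real_nonzero)
  define A where "A = 1 - (cmod z)\<^sup>2"
  define B where "B = 1 - (cmod w)\<^sup>2"
  have AB: "A > 0" "B > 0" using assms by (auto simp: abs_square_less_1 A_def B_def)
  have "(cosh t)\<^sup>2 - (sinh t)\<^sup>2 = 1" by (rule hyperbolic_pythagoras)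
  hence "1 - (tanh t)\<^sup>2 = 1 / (cosh t)\<^sup>2"
    using c0 by (simp add: tanh_def power_divide diff_divide_eq_iff)
  hence c: "(cosh t)\<^sup>2 = 1 / (1 - (tanh t)\<^sup>2)" using c0 by simp
  have "(sinh t)\<^sup>2 = (tanh t)\<^sup>2 * (cosh t)\<^sup>2" using c0 by (simp add: tanh_def power_divide)
  also have "\<dots> = (cmod (mob w z))\<^sup>2 / (1 - (cmod (mob w z))\<^sup>2)"
    unfolding c using tanh_hyp_dist[OF assms] by (simp add: t_def)
  also have "\<dots> = (cmod (z - w))\<^sup>2 / ((1 - (cmod w)\<^sup>2) * (1 - (cmod z)\<^sup>2))"
    unfolding one_minus_mob_sq[OF assms(2,1)] using nz by (simp add: norm_divide power_divide)
  also have "\<dots> = (cmod (z - w) / (sqrt A * sqrt B))\<^sup>2"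
  proof -
    have "(sqrt A * sqrt B)\<^sup>2 = B * A"
      using AB by (simp add: power_mult_distrib)
    thus ?thesis by (simp only: power_divide A_def B_def)
  qed
  finally have "sinh t = cmod (z - w) / (sqrt A * sqrt B)"
    by (rule power2_eq_imp_eq) (use t AB in auto)
  thus ?thesis by (simp only: t_def A_def B_def)
qed

text \<open>The factors \<open>sqrt (1 - |z|\<^sup>2)\<close> cancel in products over opposite sides, so Ptolemy's
  inequality in the plane holds for \<open>sinh (d/2)\<close>, and \<open>sinh (d/2)\<close> is \<open>exp (d/2)\<close> up to a factor.\<close>

lemma hyp_dist_four_point:
  assumes "cmod x < 1" "cmod y < 1" "cmod z < 1" "cmod w < 1"
  shows "hyp_dist x y + hyp_dist z w
    \<le> max (hyp_dist x z + hyp_dist y w) (hyp_dist x w + hyp_dist y z) + 6"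
proof -
  let ?d = hyp_dist
  note tri = hyp_dist_triangle
  note nn = hyp_dist_nonneg
  show ?thesis
  \<comment> \<open>The lower bound \<open>exp t / 4 \<le> sinh t\<close> is available for t \<ge>
    1, that is for distances of at least 2. With a shorter side the triangle inequality already
    gives the claim, with error 4.\<close>
  proof (cases "?d x y \<le> 2 \<or> ?d z w \<le> 2")
    case True
    have "?d z w \<le> ?d x z + (?d x y + ?d y w)"
      using tri[of z x w] tri[of x y w] assms by (simp add: hyp_dist_commute[of z x])
    moreover have "?d x y \<le> ?d x z + (?d z w + ?d y w)"
      using tri[of x z y] tri[of z w y] assms by (simp add: hyp_dist_commute[of w y])
    ultimately have "?d x y + ?d z w \<le> ?d x z + ?d y w + 6" using True by linarith
    thus ?thesis by linarith
  next
    case False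
    define q where "q a = sqrt (1 - (cmod a)\<^sup>2)" for a :: complex
    have q: "q a > 0" if "cmod a < 1" for a using that by (simp add: q_def abs_square_less_1)
    have s: "sinh (?d a b / 2) = cmod (a - b) / (q a * q b)" if "cmod a < 1" "cmod b < 1" for a b
      using sinh_half_hyp_dist[OF that] by (simp add: q_def)
    have "(x - y) * (z - w) = (x - z) * (y - w) - (x - w) * (y - z)" by (simp add: algebra_simps)
    hence "cmod ((x - y) * (z - w)) = cmod ((x - z) * (y - w) - (x - w) * (y - z))" by (rule arg_cong)
    also have "\<dots> \<le> cmod ((x - z) * (y - w)) + cmod ((x - w) * (y - z))"
      by (rule norm_triangle_ineq4)
    finally have pt: "cmod (x - y) * cmod (z - w) \<le> cmod (x - z) * cmod (y - w) + cmod (x - w) * cmod (y - z)"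
      by (simp add: norm_mult)
    define Q where "Q = q x * q y * q z * q w"
    have Q: "Q > 0" using q assms by (simp add: Q_def)
    have "sinh (?d x y / 2) * sinh (?d z w / 2) = cmod (x - y) * cmod (z - w) / Q"
      using assms by (simp add: s Q_def mult_ac)
    also have "\<dots> \<le> (cmod (x - z) * cmod (y - w) + cmod (x - w) * cmod (y - z)) / Q"
      using pt Q by (intro divide_right_mono) auto
    also have "\<dots> = sinh (?d x z / 2) * sinh (?d y w / 2) + sinh (?d x w / 2) * sinh (?d y z / 2)"
      using assms by (simp add: s Q_def mult_ac add_divide_distrib)
    finally have P: "sinh (?d x y / 2) * sinh (?d z w / 2)
      \<le> sinh (?d x z / 2) * sinh (?d y w / 2) + sinh (?d x w / 2) * sinh (?d y z / 2)" .
    have up: "sinh t \<le> exp t / 2" for t :: real by (simp add: sinh_def)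
    have lo: "exp t / 4 \<le> sinh t" if "t \<ge> 1" for t :: real
    proof -
      have "exp (-t) \<le> 1" using that by simp
      moreover have "exp t \<ge> 2" using exp_ge_add_one_self[of t] that by linarith
      ultimately have "exp (-t) * 2 \<le> exp t" by linarith
      thus ?thesis by (simp add: sinh_def)
    qed
    have nz: "sinh (?d a b / 2) \<ge> 0" if "cmod a < 1" "cmod b < 1" for a b
      using nn[OF that] by simp
    define M where "M = max (?d x z + ?d y w) (?d x w + ?d y z)"
    have upp: "sinh (?d a b / 2) * sinh (?d a' b' / 2) \<le> exp (M / 2) / 4"
      if "cmod a < 1" "cmod b < 1" "cmod a' < 1" "cmod b' < 1" "?d a b + ?d a' b' \<le> M" for a b a' b'
    proof -
      have "sinh (?d a b / 2) * sinh (?d a' b' / 2) \<le> (exp (?d a b / 2) / 2) * (exp (?d a' b' / 2) / 2)"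
        using up nz that by (intro mult_mono) auto
      also have "\<dots> = exp ((?d a b + ?d a' b') / 2) / 4" by (simp add: add_divide_distrib exp_add)
      also have "\<dots> \<le> exp (M / 2) / 4" using that by simp
      finally show ?thesis .
    qed
    have "exp ((?d x y + ?d z w) / 2) / 16 = (exp (?d x y / 2) / 4) * (exp (?d z w / 2) / 4)"
      by (simp add: add_divide_distrib exp_add)
    also have "\<dots> \<le> sinh (?d x y / 2) * sinh (?d z w / 2)"
      using lo[of "?d x y / 2"] lo[of "?d z w / 2"] False by (intro mult_mono) auto
    also have "\<dots> \<le> exp (M / 2) / 4 + exp (M / 2) / 4"
      using P upp[of x z y w] upp[of x w y z] assms by (auto simp: M_def)
    finally have e: "exp ((?d x y + ?d z w) / 2) \<le> 8 * exp (M / 2)" by simp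
    \<comment> \<open>The factor 8 collects 16 from the lower bounds and 1/4 + 1/4 from the upper
      ones. It is at most exp 3, and 3 doubles to 6 because the exponents are half
      distances.\<close>
    have "(8::real) \<le> exp 3"
    proof -
      have "(2::real) ^ 3 \<le> exp 1 ^ 3"
        using exp_ge_add_one_self[of "1::real"] by (intro power_mono) auto
      also have "(exp 1 :: real) ^ 3 = exp 3" by (simp flip: exp_of_nat_mult)
      finally show ?thesis by simp
    qed
    hence "8 * exp (M / 2) \<le> exp 3 * exp (M / 2)" by (intro mult_right_mono) auto
    also have "\<dots> = exp ((M + 6) / 2)" by (simp add: exp_add[symmetric] add_divide_distrib add.commute)
    finally have "exp ((?d x y + ?d z w) / 2) \<le> exp ((M + 6) / 2)" using e by linarith
    thus ?thesis by (simp add: M_def)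
  qed
qed

subsection \<open>Geodesic segments\<close>

text \<open>Geodesics from 0 are Euclidean radii; \<open>mob (- v)\<close> carries 0 to v and the
  radius to \<open>mob v w\<close> to the geodesic from v to w.\<close>

definition hseg :: "complex \<Rightarrow> complex \<Rightarrow> complex set" where
  "hseg v w = mob (- v) ` closed_segment 0 (mob v w)"

lemma hyp_dist_0_left: "hyp_dist 0 z = 2 * artanh (cmod z)"
  by (simp add: hyp_dist_0 hyp_dist_commute[of 0])

lemma artanh_diff:
  fixes x y :: real
  assumes "0 \<le> x" "x \<le> y" "y < 1"
  shows "artanh ((y - x) / (1 - x * y)) = artanh y - artanh x"
proof -
  have xy: "x * y < 1" using assms mult_left_le_one_le[of y x] by (auto simp: mult.commute)
  define u where "u = (y - x) / (1 - x * y)"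
  have u0: "0 \<le> u" using assms xy by (simp add: u_def)
  have "(1 - y) * (1 + x) > 0" using assms by simp
  hence u1: "u < 1" using xy by (simp add: u_def field_simps)
  have x2: "x * x < 1" using assms mult_left_le_one_le[of x x] by auto
  have "1 + x * u > 0" using assms u0 by (simp add: add_pos_nonneg)
  have a: "x + u = y * (1 - x * x) / (1 - x * y)" using xy by (simp add: u_def field_simps)
  have b: "1 + x * u = (1 - x * x) / (1 - x * y)" using xy by (simp add: u_def field_simps)
  have "(x + u) / (1 + x * u) = y" unfolding a b using xy x2 by simp
  thus ?thesis using artanh_add[of x u] assms u0 u1 by (simp add: u_def)
qed

lemma cmod_scaleR_diff:
  assumes "s \<le> t" "t * cmod a < 1" "0 \<le> s"
  shows "cmod (mob (of_real t * a) (of_real s * a)) = (t * cmod a - s * cmod a) / (1 - (s * cmod a) * (t * cmod a))"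
proof -
  have sa: "0 \<le> s * cmod a" "s * cmod a \<le> t * cmod a" using assms by (auto intro: mult_right_mono)
  have "(s * cmod a) * (t * cmod a) \<le> 1 * (t * cmod a)"
    using sa assms by (intro mult_right_mono) auto
  hence lt: "(s * cmod a) * (t * cmod a) < 1" using assms by simp
  have "of_real s * a - of_real t * a = of_real (s - t) * a" by (simp add: algebra_simps)
  hence n: "cmod (of_real s * a - of_real t * a) = t * cmod a - s * cmod a"
    using assms by (simp only: norm_mult norm_of_real) (simp add: left_diff_distrib)
  have "cnj (of_real t * a) * (of_real s * a) = of_real (s * t) * (a * cnj a)" by (simp add: mult_ac)
  also have "\<dots> = of_real ((s * cmod a) * (t * cmod a))"
    by (simp only: complex_norm_square[symmetric] flip: of_real_mult of_real_power)
       (simp add: power2_eq_square mult_ac)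
  finally have "1 - cnj (of_real t * a) * (of_real s * a) = of_real (1 - (s * cmod a) * (t * cmod a))"
    by simp
  hence "cmod (1 - cnj (of_real t * a) * (of_real s * a)) = 1 - (s * cmod a) * (t * cmod a)"
    using lt by (simp only: norm_of_real)
  thus ?thesis by (simp only: norm_divide n)
qed

lemma hyp_dist_radial:
  assumes "0 \<le> s" "s \<le> t" "t * cmod a < 1"
  shows "hyp_dist (of_real s * a) (of_real t * a) = hyp_dist 0 (of_real t * a) - hyp_dist 0 (of_real s * a)"
proof -
  have sa: "0 \<le> s * cmod a" "s * cmod a \<le> t * cmod a" using assms by (auto intro: mult_right_mono)
  have "hyp_dist (of_real s * a) (of_real t * a) = 2 * (artanh (t * cmod a) - artanh (s * cmod a))"
    unfolding hyp_dist_mob cmod_scaleR_diff[OF assms(2,3,1)]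
    using artanh_diff[OF sa assms(3)] by simp
  thus ?thesis using assms by (simp add: hyp_dist_0_left norm_mult)
qed

lemma closed_segment_0_iff:
  fixes a y :: complex
  shows "y \<in> closed_segment 0 a \<longleftrightarrow> (\<exists>t\<in>{0..1}. y = of_real t * a)"
  by (auto simp: closed_segment_def scaleR_conv_of_real)

lemma artanh_inj:
  fixes x y :: real
  assumes "-1 < x" "x < 1" "-1 < y" "y < 1" "artanh x = artanh y"
  shows "x = y"
  using tanh_artanh_real[OF assms(1,2)] tanh_artanh_real[OF assms(3,4)] assms(5) by metis

text \<open>For the converse, equality in the triangle inequality fixes
  \<open>cmod (mob a y)\<close> and hence \<open>cmod (1 - cnj a * y) = 1 - cmod a * cmod y\<close>.
  This is possible only if \<open>cnj a * y\<close> is the nonnegative real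
  \<open>cmod a * cmod y\<close>, so y lies on the radius through a.\<close>

lemma closed_segment_0_dist_iff:
  assumes "cmod a < 1" "cmod y < 1"
  shows "y \<in> closed_segment 0 a \<longleftrightarrow> hyp_dist 0 y + hyp_dist y a = hyp_dist 0 a"
proof
  assume "y \<in> closed_segment 0 a"
  then obtain t where "0 \<le> t" "t \<le> 1" "y = of_real t * a" by (auto simp: closed_segment_0_iff)
  thus "hyp_dist 0 y + hyp_dist y a = hyp_dist 0 a"
    using hyp_dist_radial[of t 1 a] assms by simp
next
  assume eq: "hyp_dist 0 y + hyp_dist y a = hyp_dist 0 a"
  define r where "r = cmod y"
  define b where "b = cmod a"
  define s where "s = cmod (mob a y)"
  have r: "0 \<le> r" "r < 1" and b: "0 \<le> b" "b < 1" and s: "0 \<le> s" "s < 1"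
    using assms cmod_mob_less_1[of a y] by (auto simp: r_def b_def s_def)
  have sum: "artanh r + artanh s = artanh b"
    using eq by (simp add: hyp_dist_0_left r_def b_def s_def hyp_dist_mob)
  have "artanh s \<ge> 0" using artanh_mono[of 0 s] s by simp
  have rb: "r \<le> b"
  proof (rule ccontr)
    assume "\<not> r \<le> b"
    hence "artanh b \<le> artanh r" using artanh_mono[of b r] b r by simp
    hence "artanh r = artanh b" using sum \<open>artanh s \<ge> 0\<close> by simp
    hence "r = b" using artanh_inj[of r b] r b by simp
    thus False using \<open>\<not> r \<le> b\<close> by simp
  qed
  show "y \<in> closed_segment 0 a"
  proof (cases "a = 0")
    case True
    hence "r = 0" using rb r b by (simp add: b_def)
    thus ?thesis by (simp add: r_def)
  next
    case False
    have lt: "r * b < 1" using r b mult_left_le_one_le[of b r] by (auto simp: mult.commute)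
    define q where "q = (b - r) / (1 - r * b)"
    have "artanh s = artanh q" using sum artanh_diff[of r b] r b rb by (simp add: q_def)
    moreover have "(1 - b) * (1 + r) > 0" using r b by simp
    hence "b - r < 1 - r * b" by (simp add: algebra_simps)
    hence "q < 1" using lt by (simp add: q_def divide_less_eq_1_pos)
    moreover have "0 \<le> b - r" "0 \<le> 1 - r * b" using rb lt by linarith+
    hence "q \<ge> 0" unfolding q_def by (rule divide_nonneg_nonneg)
    ultimately have "s = q" using s artanh_inj[of s q] by linarith
    moreover have "1 - q\<^sup>2 = (1 - b\<^sup>2) * (1 - r\<^sup>2) / (1 - r * b)\<^sup>2"
    proof -
      have "1 - q\<^sup>2 = ((1 - r * b)\<^sup>2 - (b - r)\<^sup>2) / (1 - r * b)\<^sup>2"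
        unfolding q_def power_divide using lt by (subst diff_divide_distrib) simp
      also have "(1 - r * b)\<^sup>2 - (b - r)\<^sup>2 = (1 - b\<^sup>2) * (1 - r\<^sup>2)"
        by (simp add: power2_eq_square algebra_simps)
      finally show ?thesis .
    qed
    ultimately have "1 - s\<^sup>2 = (1 - b\<^sup>2) * (1 - r\<^sup>2) / (1 - r * b)\<^sup>2" by simp
    moreover have "1 - s\<^sup>2 = (1 - b\<^sup>2) * (1 - r\<^sup>2) / (cmod (1 - cnj a * y))\<^sup>2"
      using one_minus_mob_sq[of a y] assms by (simp add: s_def b_def r_def)
    moreover have "(1 - b\<^sup>2) * (1 - r\<^sup>2) \<noteq> 0" using r b abs_square_less_1[of r] abs_square_less_1[of b] by auto
    ultimately have e: "(cmod (1 - cnj a * y))\<^sup>2 = (1 - r * b)\<^sup>2"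
      by (metis divide_cancel_left)
    define u where "u = cnj a * y"
    have n: "(Re u)\<^sup>2 + (Im u)\<^sup>2 = (r * b)\<^sup>2"
      unfolding cmod_power2[symmetric] by (simp add: u_def norm_mult r_def b_def mult.commute)
    have "(1 - Re u)\<^sup>2 + (Im u)\<^sup>2 = (1 - r * b)\<^sup>2"
      using e unfolding u_def[symmetric] cmod_power2 by simp
    hence re: "Re u = r * b" using n by (simp add: power2_eq_square algebra_simps)
    hence im: "Im u = 0" using n by simp
    have c: "cnj a * y = of_real (r * b)"
      unfolding u_def[symmetric] by (intro complex_eqI) (simp_all add: re im)
    have "of_real (b * b) * y = a * (cnj a * y)"
      unfolding b_def using complex_norm_square[of a] by (simp add: power2_eq_square mult_ac)
    also have "\<dots> = of_real (r * b) * a" unfolding c by (rule mult.commute)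
    finally have "y = of_real (r / b) * a" using False by (simp add: b_def field_simps)
    moreover have "r / b \<in> {0..1}" using r rb b by (auto simp: divide_le_eq_1)
    ultimately show ?thesis unfolding closed_segment_0_iff by blast
  qed
qed

lemma cmod_less_1_closed_segment:
  assumes "cmod a < 1" "y \<in> closed_segment 0 a"
  shows "cmod y < 1"
  using assms mult_left_le_one_le[of "cmod a"] by (auto simp: closed_segment_0_iff norm_mult)
    (metis le_less_trans norm_ge_zero)

lemma mob_self [simp]: "mob v v = 0"
  by simp

lemma mem_hseg_iff_mob:
  assumes "cmod v < 1" "cmod w < 1"
  shows "z \<in> hseg v w \<longleftrightarrow> cmod z < 1 \<and> mob v z \<in> closed_segment 0 (mob v w)"
proof
  assume "z \<in> hseg v w"
  then obtain y where y: "y \<in> closed_segment 0 (mob v w)" "z = mob (- v) y" by (auto simp: hseg_def)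
  have y1: "cmod y < 1" using cmod_less_1_closed_segment[OF cmod_mob_less_1[OF assms] y(1)] .
  have "mob v z = y" unfolding y(2) by (rule mob_inverse(2)[OF assms(1) y1])
  moreover have "cmod z < 1" unfolding y(2) by (rule cmod_mob_less_1) (use assms y1 in simp_all)
  ultimately show "cmod z < 1 \<and> mob v z \<in> closed_segment 0 (mob v w)" using y(1) by simp
next
  assume z: "cmod z < 1 \<and> mob v z \<in> closed_segment 0 (mob v w)"
  hence "z = mob (- v) (mob v z)" using mob_inverse(1)[OF assms(1), of z] by (metis (no_types))
  thus "z \<in> hseg v w" unfolding hseg_def by (rule image_eqI) (rule conjunct2[OF z])
qed

text \<open>This symmetric description links geodesics to \<open>btw\<close>: on \<open>hseg\<close>
  the defect in the triangle inequality is 0, in \<open>btw\<close> it is bounded.\<close>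

lemma mem_hseg_iff:
  assumes "cmod v < 1" "cmod w < 1"
  shows "z \<in> hseg v w \<longleftrightarrow> cmod z < 1 \<and> hyp_dist v z + hyp_dist z w = hyp_dist v w"
proof (cases "cmod z < 1")
  case True
  have "mob v z \<in> closed_segment 0 (mob v w) \<longleftrightarrow>
    hyp_dist (mob v v) (mob v z) + hyp_dist (mob v z) (mob v w) = hyp_dist (mob v v) (mob v w)"
    using closed_segment_0_dist_iff[of "mob v w" "mob v z"] cmod_mob_less_1 assms True by simp
  thus ?thesis unfolding mem_hseg_iff_mob[OF assms] using assms True
    by (simp only: hyp_dist_mob_invariant)
qed (simp add: mem_hseg_iff_mob[OF assms])

lemma hseg_commute:
  assumes "cmod v < 1" "cmod w < 1"
  shows "hseg v w = hseg w v"
  using assms by (auto simp: mem_hseg_iff hyp_dist_commute)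

lemma hseg_subset: "cmod v < 1 \<Longrightarrow> cmod w < 1 \<Longrightarrow> hseg v w \<subseteq> unit_disk"
  by (auto simp: mem_hseg_iff)

lemma hseg_endpoints:
  assumes "cmod v < 1" "cmod w < 1"
  shows "v \<in> hseg v w" "w \<in> hseg v w"
  using assms by (auto simp: mem_hseg_iff)

lemma tanh_less_1_real: "tanh (t::real) < 1"
  using tanh_real_bounds[of t] by auto

lemma geodesic_param:
  assumes "cmod v < 1" "cmod w < 1" "v \<noteq> w"
  obtains \<gamma> where "\<gamma> ` {0..hyp_dist v w} = hseg v w" "\<gamma> 0 = v" "\<gamma> (hyp_dist v w) = w"
    "\<And>s t. s \<in> {0..hyp_dist v w} \<Longrightarrow> t \<in> {0..hyp_dist v w} \<Longrightarrow> hyp_dist (\<gamma> s) (\<gamma> t) = \<bar>s - t\<bar>"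
proof -
  define a where "a = mob v w"
  have a1: "cmod a < 1" using cmod_mob_less_1 assms by (simp add: a_def)
  have a0: "a \<noteq> 0" using assms one_minus_cnj_mult_nonzero[of v w] by (simp add: a_def)
  define L where "L = hyp_dist v w"
  have L: "tanh (L / 2) = cmod a" using tanh_hyp_dist[of v w] assms cmod_mob_commute[of w v]
    by (simp add: L_def a_def)
  \<comment> \<open>A point at distance t from 0 has Euclidean modulus tanh (t/2); dividing by
    \<open>cmod a\<close> gives its parameter on the segment from 0 to a.\<close>
  define g where "g t = tanh (t / 2) / cmod a" for t :: real
  define \<gamma> where "\<gamma> t = mob (- v) (of_real (g t) * a)" for t
  have g: "0 \<le> g t" "g t \<le> 1" if "t \<in> {0..L}" for t
  proof -
    show "0 \<le> g t" using that by (simp add: g_def)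
    have "tanh (t / 2) \<le> tanh (L / 2)" using that by simp
    thus "g t \<le> 1" using a0 L by (simp add: g_def)
  qed
  have ga: "g t * cmod a = tanh (t / 2)" for t using a0 by (simp add: g_def)
  have n: "cmod (of_real (g t) * a) = tanh (t / 2)" if "t \<ge> 0" for t
  proof -
    have "\<bar>g t\<bar> = g t" using that by (simp add: g_def)
    thus ?thesis using ga[of t] by (simp only: norm_mult norm_of_real)
  qed
  have d0: "hyp_dist 0 (of_real (g t) * a) = t" if "t \<ge> 0" for t
    unfolding hyp_dist_0_left n[OF that] artanh_tanh_real by simp
  have in1: "cmod (of_real (g t) * a) < 1" if "t \<in> {0..L}" for t
    using n[of t] tanh_less_1_real[of "t/2"] that by auto
  have le: "hyp_dist (\<gamma> s) (\<gamma> t) = t - s" if "s \<in> {0..L}" "t \<in> {0..L}" "s \<le> t" for s t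
  proof -
    have "g s \<le> g t" using that by (simp add: g_def divide_right_mono)
    hence "hyp_dist (of_real (g s) * a) (of_real (g t) * a) = t - s"
      using hyp_dist_radial[of "g s" "g t" a] that g[of s] d0 ga[of t] tanh_less_1_real[of "t/2"] by auto
    thus ?thesis unfolding \<gamma>_def
      using hyp_dist_mob_invariant[of "-v" "of_real (g s) * a" "of_real (g t) * a"] assms in1 that by simp
  qed
  have gs: "g ` {0..L} = {0..1}"
  proof (intro equalityI subsetI)
    fix x :: real assume x: "x \<in> {0..1}"
    define t where "t = 2 * artanh (x * cmod a)"
    have xa: "0 \<le> x * cmod a" "x * cmod a \<le> cmod a" using x by (auto intro: mult_left_le_one_le)
    have "t \<ge> 0" using artanh_mono[of 0 "x * cmod a"] xa a1 by (simp add: t_def)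
    moreover have "t \<le> L"
      using artanh_mono[of "x * cmod a" "cmod a"] xa a1 L artanh_tanh_real[of "L/2"]
      by (simp add: t_def)
    moreover have "g t = x" using a0 tanh_artanh_real[of "x * cmod a"] xa a1 by (simp add: g_def t_def)
    ultimately show "x \<in> g ` {0..L}" by auto
  qed (use g in auto)
  have "\<gamma> ` {0..L} = mob (- v) ` ((\<lambda>x. of_real x * a) ` g ` {0..L})"
    unfolding image_image by (rule image_cong[OF refl \<gamma>_def])
  also have "(\<lambda>x. of_real x * a) ` g ` {0..L} = closed_segment 0 a"
    unfolding gs by (auto simp only: closed_segment_0_iff image_iff)
  finally have im: "\<gamma> ` {0..L} = hseg v w" by (simp add: hseg_def a_def)
  have "g L = 1" using L a0 by (simp add: g_def)
  hence e: "\<gamma> L = w" using mob_inverse(1)[of v w] assms by (simp add: \<gamma>_def a_def)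
  have s: "\<gamma> 0 = v" by (simp add: \<gamma>_def g_def)
  have "hyp_dist (\<gamma> s) (\<gamma> t) = \<bar>s - t\<bar>" if "s \<in> {0..L}" "t \<in> {0..L}" for s t
    using le[of s t] le[of t s] that hyp_dist_commute[of "\<gamma> s"] by (cases "s \<le> t") auto
  thus thesis using that[of \<gamma>] im e s by (simp add: L_def)
qed

lemma hyp_geodesic_segment_hseg:
  assumes "cmod v < 1" "cmod w < 1"
  shows "hyp_geodesic_segment (hseg v w) v w"
proof (cases "v = w")
  case True
  hence "hseg v w = {v}" by (simp add: hseg_def)
  thus ?thesis using True assms unfolding hyp_geodesic_segment_def
    by (intro exI[of _ "\<lambda>_. v"]) auto
next
  case False
  show ?thesis
    by (rule geodesic_param[OF assms False], unfold hyp_geodesic_segment_def) (use hseg_subset[OF assms] in blast)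
qed

lemma hseg_point_at:
  assumes "cmod v < 1" "cmod w < 1" "0 \<le> s" "s \<le> hyp_dist v w"
  obtains z where "z \<in> hseg v w" "hyp_dist v z = s" "hyp_dist z w = hyp_dist v w - s"
proof (cases "v = w")
  case True
  thus thesis using that[of v] assms hseg_endpoints[of v w] by auto
next
  case False
  obtain \<gamma> where g: "\<gamma> ` {0..hyp_dist v w} = hseg v w" "\<gamma> 0 = v"
    "\<And>s t. s \<in> {0..hyp_dist v w} \<Longrightarrow> t \<in> {0..hyp_dist v w} \<Longrightarrow> hyp_dist (\<gamma> s) (\<gamma> t) = \<bar>s - t\<bar>"
    by (rule geodesic_param[OF assms(1,2) False]) blast
  have "\<gamma> s \<in> hseg v w" using g(1) assms by auto
  moreover have "hyp_dist v (\<gamma> s) = s" using g(3)[of 0 s] g(2) assms by simp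
  ultimately show thesis using that[of "\<gamma> s"] assms by (auto simp: mem_hseg_iff)
qed

lemma arc_hseg:
  assumes "cmod v < 1" "cmod w < 1" "v \<noteq> w"
  obtains \<gamma> where "arc \<gamma>" "path_image \<gamma> = hseg v w" "pathstart \<gamma> = v" "pathfinish \<gamma> = w"
proof -
  define a where "a = mob v w"
  have a1: "cmod a < 1" using cmod_mob_less_1 assms by (simp add: a_def)
  have a0: "a \<noteq> 0" using assms one_minus_cnj_mult_nonzero[of v w] by (simp add: a_def)
  have c1: "cmod y < 1" if "y \<in> closed_segment 0 a" for y using cmod_less_1_closed_segment[OF a1 that] .
  let ?g = "mob (- v) \<circ> linepath 0 a"
  have "arc ?g" unfolding arc_def
  proof
    show "path ?g"
    proof (rule path_continuous_image)
      show "continuous_on (path_image (linepath 0 a)) (mob (- v))"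
        using one_minus_cnj_mult_nonzero[of "-v"] c1 assms by (auto intro!: continuous_intros)
    qed simp
    have "inj_on (mob (- v)) (closed_segment 0 a)"
      by (rule inj_on_inverseI[of _ "mob v"]) (use mob_inverse(2) assms c1 in auto)
    moreover have "inj_on (linepath 0 a) {0..1}" using a0 by (intro arc_imp_inj_on arc_linepath) auto
    moreover have "linepath 0 a ` {0..1} = closed_segment 0 a"
      using path_image_linepath[of 0 a] by (simp only: path_image_def)
    ultimately show "inj_on ?g {0..1}" by (intro comp_inj_on) (simp_all only:)
  qed
  moreover have "path_image ?g = hseg v w"
    by (simp add: path_image_compose hseg_def a_def)
  moreover have "pathstart ?g = v" by (simp add: pathstart_compose)
  moreover have "pathfinish ?g = w"
    using mob_inverse(1)[of v w] assms by (simp add: pathfinish_compose a_def)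
  ultimately show thesis using that by blast
qed

subsection \<open>Blaschke products and their critical points\<close>

lemma monic_degree_prod_linear:
  fixes a :: "nat \<Rightarrow> complex"
  shows "degree (\<Prod>i<d. [:- a i, 1:]) = d \<and> coeff (\<Prod>i<d. [:- a i, 1:]) d = 1"
proof (induction d)
  case (Suc d)
  let ?p = "\<Prod>i<d. [:- a i, 1:]"
  have "?p \<noteq> 0" by (simp add: prod_zero_iff)
  hence deg: "degree (?p * [:- a d, 1:]) = Suc d"
    using Suc degree_mult_eq[of ?p "[:- a d, 1:]"] by simp
  have "lead_coeff (?p * [:- a d, 1:]) = lead_coeff ?p * lead_coeff [:- a d, 1:]"
    by (rule lead_coeff_mult)
  thus ?case using deg Suc by simp
qed simp

lemma degree_coeff_prod_reversed_linear:
  fixes a :: "nat \<Rightarrow> complex"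
  shows "degree (\<Prod>i<d. [:1, a i:]) \<le> d \<and> coeff (\<Prod>i<d. [:1, a i:]) d = (\<Prod>i<d. a i)"
proof (induction d)
  case (Suc d)
  let ?p = "\<Prod>i<d. [:1, a i:]"
  have "degree (?p * [:1, a d:]) \<le> degree ?p + degree [:1, a d:]" by (rule degree_mult_le)
  hence deg: "degree (?p * [:1, a d:]) \<le> Suc d" using Suc by (auto split: if_splits)
  have "coeff ?p (Suc d) = 0" using Suc by (intro coeff_eq_0) simp
  hence "coeff ([:1, a d:] * ?p) (Suc d) = a d * coeff ?p d" by simp
  thus ?case using deg Suc by (simp add: mult.commute)
qed simp

lemma complex_poly_factor_indexed:
  fixes p :: "complex poly"
  assumes "p \<noteq> 0"
  obtains w :: "nat \<Rightarrow> complex" where "\<And>z. poly p z = lead_coeff p * (\<Prod>i<degree p. z - w i)"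
proof -
  obtain xs where xs: "mset xs = proots p" by (metis ex_mset)
  have len: "length xs = degree p" using xs by (metis size_mset size_proots_complex)
  have "poly p z = lead_coeff p * (\<Prod>i<degree p. z - xs ! i)" for z
  proof -
    have "poly p z = poly (smult (lead_coeff p) (\<Prod>x\<in>#mset xs. [:- x, 1:])) z"
      by (simp only: xs complex_poly_decompose_multiset)
    also have "\<dots> = lead_coeff p * (\<Prod>x\<in>#mset xs. z - x)"
      by (simp add: poly_prod_mset image_mset.compositionality o_def)
    also have "(\<Prod>x\<in>#mset xs. z - x) = prod_list (map (\<lambda>x. z - x) xs)"
      by (metis mset_map prod_mset_prod_list)
    also have "\<dots> = (\<Prod>i<degree p. z - xs ! i)"
      using prod.list_conv_set_nth[of "map (\<lambda>x. z - x) xs"] by (simp add: len atLeast0LessThan)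
    finally show ?thesis .
  qed
  thus thesis using that by blast
qed

lemma cmod_diff_ge_outside:
  assumes "cmod a < 1" "cmod z \<ge> 1"
  shows "cmod (1 - cnj a * z) \<le> cmod (z - a)"
proof -
  have "(1 - (cmod a)\<^sup>2) * (1 - (cmod z)\<^sup>2) \<le> 0"
    using assms by (intro mult_nonneg_nonpos) (auto simp: power_le_one)
  hence "(cmod (1 - cnj a * z))\<^sup>2 \<le> (cmod (z - a))\<^sup>2"
    using cmod_diff_cnj_identity[of a z] by linarith
  thus ?thesis by (rule power2_le_imp_le) simp
qed

lemma prod_le_one_real:
  fixes x :: "'a \<Rightarrow> real"
  assumes "finite A" "i \<in> A" "\<And>j. j \<in> A \<Longrightarrow> 0 \<le> x j" "\<And>j. j \<in> A \<Longrightarrow> x j \<le> 1"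
  shows "prod x A \<le> x i"
proof -
  have "prod x A = x i * prod x (A - {i})" using assms by (simp add: prod.remove)
  also have "\<dots> \<le> x i * 1" using assms by (intro mult_left_mono prod_le_1) auto
  finally show ?thesis by simp
qed

text \<open>The zeros are arbitrary points, since moving \<open>f w\<close> to 0 by a disk
  automorphism leaves the class of products that vanish at 0.\<close>

definition bprod :: "nat \<Rightarrow> (nat \<Rightarrow> complex) \<Rightarrow> complex \<Rightarrow> complex" where
  "bprod d a z = (\<Prod>i<d. mob (a i) z)"

lemma cmod_bprod_less_1:
  assumes "d > 0" "\<And>i. i < d \<Longrightarrow> cmod (a i) < 1" "cmod z < 1"
  shows "cmod (bprod d a z) < 1"
proof -
  have lt: "cmod (mob (a j) z) < 1" if "j < d" for j
    by (rule cmod_mob_less_1[OF assms(2)[OF that] assms(3)])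
  have "cmod (bprod d a z) \<le> cmod (mob (a 0) z)"
    unfolding bprod_def prod_norm[symmetric]
    using prod_le_one_real[of "{..<d}" 0 "\<lambda>j. cmod (mob (a j) z)"] assms(1) less_imp_le[OF lt]
    by (simp only: lessThan_iff norm_ge_zero finite_lessThan)
  also have "\<dots> < 1" by (rule lt[OF assms(1)])
  finally show ?thesis .
qed

text \<open>Postcomposing with a disk automorphism gives a Blaschke product again: if the numerator
  \<open>P - c Q\<close> is \<open>L \<Prod> (z - w\<^sub>i)\<close>, the denominator \<open>Q - cnj c P\<close> is its reflection
  \<open>cnj L \<Prod> (1 - cnj w\<^sub>i z)\<close>.\<close>

lemma mob_bprod:
  assumes a: "\<And>i. i < d \<Longrightarrow> cmod (a i) < 1" and c: "cmod c < 1"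
  obtains \<kappa> w where "cmod \<kappa> = 1" "\<And>i. i < d \<Longrightarrow> cmod (w i) < 1"
    "\<And>z. cmod z < 1 \<Longrightarrow> mob c (bprod d a z) = \<kappa> * bprod d w z"
proof -
  define P where "P = (\<Prod>i<d. [:- a i, 1:])"
  define Q where "Q = (\<Prod>i<d. [:1, - cnj (a i):])"
  define N where "N = P - smult c Q"
  \<comment> \<open>The leading coefficient of the numerator. Its modulus is at least
    \<open>1 - cmod c\<close>, so the numerator has exactly d roots.\<close>
  define L where "L = 1 - c * (\<Prod>i<d. - cnj (a i))"
  have pP: "poly P z = (\<Prod>i<d. z - a i)" for z by (simp add: P_def poly_prod)
  have pQ: "poly Q z = (\<Prod>i<d. 1 - cnj (a i) * z)" for z by (simp add: Q_def poly_prod mult.commute)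
  have "cmod (\<Prod>i<d. - cnj (a i)) \<le> 1"
    unfolding prod_norm[symmetric] using a by (intro prod_le_1) (auto simp: less_imp_le)
  hence "cmod c * cmod (\<Prod>i<d. - cnj (a i)) \<le> cmod c * 1" by (intro mult_left_mono) auto
  hence "cmod (c * (\<Prod>i<d. - cnj (a i))) < 1" using c by (simp only: norm_mult)
  hence L0: "L \<noteq> 0" unfolding L_def by (metis eq_iff_diff_eq_0 less_irrefl norm_one)
  have cN: "coeff N d = L"
    using monic_degree_prod_linear[where d = d and a = a]
      degree_coeff_prod_reversed_linear[where d = d and a = "\<lambda>i. - cnj (a i)"]
    by (simp add: N_def P_def Q_def L_def)
  have "degree N \<le> d"
    using monic_degree_prod_linear[where d = d and a = a]
      degree_coeff_prod_reversed_linear[where d = d and a = "\<lambda>i. - cnj (a i)"]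
    unfolding N_def P_def Q_def by (intro degree_diff_le) (auto intro: order_trans[OF degree_smult_le])
  moreover have "degree N \<ge> d" using cN L0 by (intro le_degree) simp
  ultimately have dN: "degree N = d" by simp
  have "N \<noteq> 0" using cN L0 by auto
  then obtain w where w: "\<And>z. poly N z = lead_coeff N * (\<Prod>i<degree N. z - w i)"
    by (rule complex_poly_factor_indexed) blast
  have Nw: "(\<Prod>i<d. z - a i) - c * (\<Prod>i<d. 1 - cnj (a i) * z) = L * (\<Prod>i<d. z - w i)" for z
  proof -
    have "poly N z = L * (\<Prod>i<d. z - w i)" using w[of z] by (simp only: dN cN)
    thus ?thesis by (simp add: N_def pP pQ)
  qed
  \<comment> \<open>On and outside the unit circle each \<open>z - a i\<close> is at least as large
    as \<open>1 - cnj (a i) * z\<close>, so with \<open>cmod c < 1\<close> the numerator has no zero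
    there.\<close>
  have w1: "cmod (w i) < 1" if i: "i < d" for i
  proof (rule ccontr)
    assume ge: "\<not> cmod (w i) < 1"
    define p where "p = (\<Prod>j<d. cmod (w i - a j))"
    have z0: "(\<Prod>j<d. w i - w j) = 0" using i by (intro prod_zero) auto
    hence "(\<Prod>j<d. w i - a j) = c * (\<Prod>j<d. 1 - cnj (a j) * w i)"
      using Nw[of "w i"] unfolding z0 by simp
    hence "cmod (\<Prod>j<d. w i - a j) = cmod (c * (\<Prod>j<d. 1 - cnj (a j) * w i))" by simp
    hence "p = cmod c * (\<Prod>j<d. cmod (1 - cnj (a j) * w i))"
      by (simp only: norm_mult prod_norm[symmetric] p_def)
    moreover have "(\<Prod>j<d. cmod (1 - cnj (a j) * w i)) \<le> p"
      unfolding p_def using ge a by (intro prod_mono conjI cmod_diff_ge_outside) auto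
    moreover have pp: "p > 0" unfolding p_def
    proof (intro prod_pos ballI)
      fix j assume "j \<in> {..<d}"
      hence "w i \<noteq> a j" using a[of j] ge by auto
      thus "cmod (w i - a j) > 0" by simp
    qed
    ultimately have "p \<le> cmod c * p" by (metis mult_left_mono norm_ge_zero)
    thus False using pp c by simp
  qed
  have refl: "(\<Prod>i<d. 1 - cnj (a i) * z) - cnj c * (\<Prod>i<d. z - a i) = cnj L * (\<Prod>i<d. 1 - cnj (w i) * z)" for z
  proof (cases "z = 0")
    case True
    thus ?thesis by (simp add: L_def)
  next
    case False
    \<comment> \<open>Reflection in the unit circle. Conjugating \<open>Nw\<close> at u and
      multiplying by \<open>z ^ d\<close> exchanges factors of the form \<open>z - b\<close> and
      \<open>1 - cnj b * z\<close>.\<close>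
    define u where "u = 1 / cnj z"
    have zu: "z * cnj u = 1" using False by (simp add: u_def)
    have "z ^ d * cnj ((\<Prod>i<d. u - a i) - c * (\<Prod>i<d. 1 - cnj (a i) * u)) = z ^ d * cnj (L * (\<Prod>i<d. u - w i))"
      by (simp only: Nw)
    moreover have r: "z ^ d * (\<Prod>i<d. g i) = (\<Prod>i<d. z * g i)" for g :: "nat \<Rightarrow> complex"
      by (simp add: prod.distrib)
    ultimately have "(\<Prod>i<d. z * (cnj u - cnj (a i))) - cnj c * (\<Prod>i<d. z * (1 - a i * cnj u))
        = cnj L * (\<Prod>i<d. z * (cnj u - cnj (w i)))"
      by (simp add: right_diff_distrib cnj_prod mult.left_commute[of "z ^ d"] r del: prod.distrib)
    moreover have "z * (cnj u - b) = 1 - b * z" "z * (1 - b * cnj u) = z - b" for b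
      using zu by (simp_all add: algebra_simps)
    ultimately show ?thesis by simp
  qed
  define \<kappa> where "\<kappa> = L / cnj L"
  have "mob c (bprod d a z) = \<kappa> * bprod d w z" if z: "cmod z < 1" for z
  proof -
    let ?p = "\<Prod>i<d. z - a i" and ?q = "\<Prod>i<d. 1 - cnj (a i) * z"
    have q0: "?q \<noteq> 0" using one_minus_cnj_mult_nonzero a z by (auto simp: less_imp_le)
    have b: "bprod d a z = ?p / ?q" by (simp add: bprod_def prod_dividef)
    have "mob c (bprod d a z) = ((?p - c * ?q) / ?q) / ((?q - cnj c * ?p) / ?q)"
      unfolding b using q0 by (simp add: diff_divide_distrib)
    also have "\<dots> = (?p - c * ?q) / (?q - cnj c * ?p)" using q0 by simp
    also have "\<dots> = \<kappa> * bprod d w z" unfolding Nw refl by (simp add: \<kappa>_def bprod_def prod_dividef)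
    finally show ?thesis .
  qed
  moreover have "cmod \<kappa> = 1" using L0 by (simp add: \<kappa>_def norm_divide)
  ultimately show thesis using that w1 by blast
qed

text \<open>The numerator of the derivative of \<open>bprod d w\<close>, over the denominator
  \<open>\<Prod> (1 - cnj w\<^sub>j z)\<^sup>2\<close>.\<close>

definition crit_poly :: "nat \<Rightarrow> (nat \<Rightarrow> complex) \<Rightarrow> complex poly" where
  "crit_poly d w = (\<Sum>i<d. smult (of_real (1 - (cmod (w i))\<^sup>2))
     (\<Prod>j\<in>{..<d} - {i}. [:- w j, 1:] * [:1, - cnj (w j):]))"

lemma poly_crit_poly:
  "poly (crit_poly d w) z = (\<Sum>i<d. of_real (1 - (cmod (w i))\<^sup>2) *
     (\<Prod>j\<in>{..<d} - {i}. (z - w j) * (1 - cnj (w j) * z)))"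
  unfolding crit_poly_def poly_sum poly_smult poly_prod poly_mult
  by (simp add: mult.commute)

text \<open>Each summand is a product of d - 1 quadratic factors. The rounded bound 2 * d becomes
  the exponent of \<open>t\<close> in the next estimate.\<close>

lemma degree_crit_poly: "degree (crit_poly d w) \<le> 2 * d"
  unfolding crit_poly_def
proof (intro degree_sum_le)
  fix i assume "i \<in> {..<d}"
  have "degree (\<Prod>j\<in>{..<d} - {i}. [:- w j, 1:] * [:1, - cnj (w j):])
    \<le> sum (degree \<circ> (\<lambda>j. [:- w j, 1:] * [:1, - cnj (w j):])) ({..<d} - {i})"
    by (rule degree_prod_sum_le) simp
  also have "\<dots> \<le> sum (\<lambda>j. 2) ({..<d} - {i})"
    by (intro sum_mono) (auto intro: order_trans[OF degree_mult_le])
  also have "\<dots> \<le> 2 * d" by (simp add: card_Diff_singleton_if)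
  finally show "degree (smult (of_real (1 - (cmod (w i))\<^sup>2))
     (\<Prod>j\<in>{..<d} - {i}. [:- w j, 1:] * [:1, - cnj (w j):])) \<le> 2 * d"
    by (intro order_trans[OF degree_smult_le])
qed simp

lemma mob_has_derivative:
  assumes "1 - cnj a * z \<noteq> 0"
  shows "(mob a has_field_derivative (of_real (1 - (cmod a)\<^sup>2) / (1 - cnj a * z)\<^sup>2)) (at z)"
proof -
  have e: "(1 - cnj a * z) - (z - a) * (- cnj a) = of_real (1 - (cmod a)\<^sup>2)"
    using complex_norm_square[of a] by (simp add: algebra_simps)
  have "(mob a has_field_derivative
     ((1 - cnj a * z) - (z - a) * (- cnj a)) / ((1 - cnj a * z) * (1 - cnj a * z))) (at z)"
    using assms by (auto intro!: derivative_eq_intros)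
  thus ?thesis unfolding e by (simp add: power2_eq_square)
qed

lemma bprod_has_derivative:
  assumes "\<And>i. i < d \<Longrightarrow> 1 - cnj (w i) * z \<noteq> 0"
  shows "(bprod d w has_field_derivative (poly (crit_poly d w) z / (\<Prod>i<d. (1 - cnj (w i) * z)\<^sup>2))) (at z)"
proof -
  let ?q = "\<lambda>i. 1 - cnj (w i) * z"
  have "((\<lambda>z. \<Prod>i<d. mob (w i) z) has_field_derivative
     (\<Sum>i<d. of_real (1 - (cmod (w i))\<^sup>2) / (?q i)\<^sup>2 * (\<Prod>j\<in>{..<d} - {i}. mob (w j) z))) (at z)"
    by (rule has_field_derivative_prod) (use assms mob_has_derivative in auto)
  moreover have "of_real (1 - (cmod (w i))\<^sup>2) / (?q i)\<^sup>2 * (\<Prod>j\<in>{..<d} - {i}. mob (w j) z)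
    = of_real (1 - (cmod (w i))\<^sup>2) * (\<Prod>j\<in>{..<d} - {i}. (z - w j) * ?q j) / (\<Prod>i<d. (?q i)\<^sup>2)"
    if i: "i < d" for i
  proof -
    have "(\<Prod>j\<in>{..<d} - {i}. mob (w j) z) = (\<Prod>j\<in>{..<d} - {i}. ((z - w j) * ?q j) / (?q j)\<^sup>2)"
      using assms by (intro prod.cong) (auto simp: power2_eq_square)
    also have "\<dots> = (\<Prod>j\<in>{..<d} - {i}. (z - w j) * ?q j) / (\<Prod>j\<in>{..<d} - {i}. (?q j)\<^sup>2)"
      by (rule prod_dividef)
    finally have e: "(\<Prod>j\<in>{..<d} - {i}. mob (w j) z)
      = (\<Prod>j\<in>{..<d} - {i}. (z - w j) * ?q j) / (\<Prod>j\<in>{..<d} - {i}. (?q j)\<^sup>2)" .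
    have "(\<Prod>i<d. (?q i)\<^sup>2) = (?q i)\<^sup>2 * (\<Prod>j\<in>{..<d} - {i}. (?q j)\<^sup>2)"
      using i by (intro prod.remove) auto
    thus ?thesis unfolding e by simp
  qed
  hence "(\<Sum>i<d. of_real (1 - (cmod (w i))\<^sup>2) / (?q i)\<^sup>2 * (\<Prod>j\<in>{..<d} - {i}. mob (w j) z))
    = poly (crit_poly d w) z / (\<Prod>i<d. (?q i)\<^sup>2)"
    unfolding poly_crit_poly sum_divide_distrib by (intro sum.cong) (simp_all only: lessThan_iff)
  ultimately show ?thesis unfolding bprod_def[abs_def] by (simp only:)
qed

text \<open>Divide \<open>crit_poly\<close> by the Blaschke product of its zeros in the disk. On the unit circle the
  quotient dominates the summand of index \<open>k\<close>, and the maximum principle carries this to \<open>w k\<close>.\<close>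

lemma prod_crit_le_prod_preimages:
  assumes w: "\<And>i. i < d \<Longrightarrow> cmod (w i) < 1" and k: "k < d" and t: "0 \<le> t" "t \<le> 1"
    and crit: "\<And>x. cmod x < 1 \<Longrightarrow> poly (crit_poly d w) x = 0 \<Longrightarrow> t \<le> cmod (mob x (w k))"
  shows "t ^ (2 * d) \<le> (\<Prod>j\<in>{..<d} - {k}. cmod (mob (w j) (w k)))"
proof -
  define N where "N = crit_poly d w"
  \<comment> \<open>The summand of index k with every \<open>z - w j\<close> replaced by
    \<open>1 - cnj (w j) * z\<close>: the modulus on the circle is unchanged, and there is no zero
    in the disk.\<close>
  define Kf where "Kf z = of_real (1 - (cmod (w k))\<^sup>2) * (\<Prod>j\<in>{..<d} - {k}. (1 - cnj (w j) * z)\<^sup>2)" for z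
  have circ: "cmod (Kf z) \<le> cmod (poly N z)" "poly N z \<noteq> 0" if z: "cmod z = 1" for z
  proof -
    have e: "(z - b) * (1 - cnj b * z) = z * of_real ((cmod (1 - cnj b * z))\<^sup>2)" for b
    proof -
      have "z * cnj z = 1" using complex_norm_square[of z] z by simp
      hence "z * cnj (1 - cnj b * z) = z - b" by (simp add: algebra_simps)
      thus ?thesis using complex_norm_square[of "1 - cnj b * z"] by (simp add: mult_ac)
    qed
    define s where "s i = (1 - (cmod (w i))\<^sup>2) * (\<Prod>j\<in>{..<d} - {i}. (cmod (1 - cnj (w j) * z))\<^sup>2)" for i
    have pos: "s i > 0" if "i < d" for i
    proof -
      have "1 - cnj (w j) * z \<noteq> 0" if "j < d" for j
      proof
        assume "1 - cnj (w j) * z = 0"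
        hence "cmod (cnj (w j) * z) = 1" by (metis eq_iff_diff_eq_0 norm_one)
        thus False using w[OF that] z by (simp add: norm_mult)
      qed
      thus ?thesis unfolding s_def using w[OF that]
        by (intro mult_pos_pos prod_pos) (auto simp: abs_square_less_1)
    qed
    \<comment> \<open>On the circle every summand of \<open>N\<close> is \<open>z ^ (d - 1)\<close>
      times a positive number. The moduli therefore add up without cancellation, and the single
      summand k is dominated by the sum.\<close>
    have "poly N z = (\<Sum>i<d. z ^ (d - 1) * of_real (s i))"
      unfolding N_def poly_crit_poly e prod.distrib s_def
      by (intro sum.cong) (auto simp: card_Diff_singleton_if of_real_prod mult_ac)
    also have "\<dots> = z ^ (d - 1) * of_real (\<Sum>i<d. s i)" by (simp add: sum_distrib_left)
    finally have "cmod (poly N z) = \<bar>\<Sum>i<d. s i\<bar>" using z by (simp add: norm_mult norm_power del: of_real_sum)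
    also have "\<dots> = (\<Sum>i<d. s i)" using pos by (intro abs_of_nonneg sum_nonneg) (auto intro: less_imp_le)
    finally have n: "cmod (poly N z) = (\<Sum>i<d. s i)" .
    have sk: "s k \<le> (\<Sum>i<d. s i)" using pos k by (intro member_le_sum) (auto intro: less_imp_le)
    have "cmod (Kf z) = \<bar>1 - (cmod (w k))\<^sup>2\<bar> * (\<Prod>j\<in>{..<d} - {k}. (cmod (1 - cnj (w j) * z))\<^sup>2)"
      by (simp only: Kf_def norm_mult norm_of_real prod_norm[symmetric] norm_power)
    also have "\<dots> = s k" using w[OF k] by (simp add: s_def power_le_one)
    finally show "cmod (Kf z) \<le> cmod (poly N z)" using n sk by simp
    show "poly N z \<noteq> 0" using n sk pos[OF k] by auto
  qed
  have "N \<noteq> 0" using circ(2)[of 1] by auto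
  then obtain x where x: "\<And>z. poly N z = lead_coeff N * (\<Prod>i<degree N. z - x i)"
    by (rule complex_poly_factor_indexed) blast
  have x0: "poly N (x i) = 0" if "i < degree N" for i
    unfolding x using that by auto
  have L0: "lead_coeff N \<noteq> 0" using \<open>N \<noteq> 0\<close> by simp
  \<comment> \<open>Zeros of \<open>N\<close> inside the disk are reflected, those outside are kept;
    \<open>G\<close> then has the modulus of \<open>N\<close> on the circle and no zero in the
    closed disk, as the maximum principle for \<open>Kf / G\<close> requires.\<close>
  define h where "h i z = (if cmod (x i) < 1 then 1 - cnj (x i) * z else z - x i)" for i z
  define G where "G z = lead_coeff N * (\<Prod>i<degree N. h i z)" for z
  have h0: "h i z \<noteq> 0" if "i < degree N" "cmod z \<le> 1" for i z
  proof (cases "cmod (x i) < 1")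
    case True
    have "1 - cnj (x i) * z \<noteq> 0"
      using one_minus_cnj_mult_nonzero[of z "x i"] True that
      by (metis complex_cnj_cnj complex_cnj_diff complex_cnj_mult complex_cnj_one complex_cnj_zero_iff mult.commute)
    thus ?thesis using True by (simp add: h_def)
  next
    case False
    have "x i \<noteq> z"
    proof
      assume "x i = z"
      hence "cmod z = 1" "poly N z = 0" using False that x0 by auto
      thus False using circ(2) by blast
    qed
    thus ?thesis using False by (simp add: h_def)
  qed
  have G0: "G z \<noteq> 0" if "cmod z \<le> 1" for z using h0 that L0 by (simp add: G_def)
  have hc: "cmod (h i z) = cmod (z - x i)" if "cmod z = 1" for i z
  proof -
    have "(cmod (1 - cnj (x i) * z))\<^sup>2 = (cmod (z - x i))\<^sup>2"
      using cmod_diff_cnj_identity[of "x i" z] that by simp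
    hence "cmod (1 - cnj (x i) * z) = cmod (z - x i)" by (rule power2_eq_imp_eq) auto
    thus ?thesis by (simp add: h_def)
  qed
  have Gc: "cmod (G z) = cmod (poly N z)" if "cmod z = 1" for z
    using that by (simp only: G_def x norm_mult prod_norm[symmetric] hc)
  have hholo: "h i holomorphic_on A" for i A
    unfolding h_def[abs_def] by (cases "cmod (x i) < 1") (auto intro!: holomorphic_intros)
  have hol: "(\<lambda>z. Kf z / G z) holomorphic_on cball 0 1"
    unfolding Kf_def using G0 unfolding G_def
    by (intro holomorphic_intros hholo) auto
  have wk: "cmod (w k) < 1" by (rule w[OF k])
  have "cmod (Kf (w k) / G (w k)) \<le> 1"
  proof (rule maximum_modulus_frontier[of "\<lambda>z. Kf z / G z" "ball 0 1"])
    show "(\<lambda>z. Kf z / G z) holomorphic_on interior (ball 0 1)"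
      using hol by (rule holomorphic_on_subset) auto
    show "continuous_on (closure (ball 0 1)) (\<lambda>z. Kf z / G z)"
      using hol by (simp add: holomorphic_on_imp_continuous_on)
    fix z :: complex assume "z \<in> frontier (ball 0 1)"
    hence "cmod z = 1" by (simp add: frontier_ball)
    thus "cmod (Kf z / G z) \<le> 1" using circ[of z] Gc[of z] by (simp add: norm_divide divide_le_eq_1)
  qed (use wk in auto)
  hence KG: "cmod (Kf (w k)) \<le> cmod (G (w k))" using G0[of "w k"] wk by (simp add: norm_divide divide_le_eq_1)
  \<comment> \<open>At \<open>w k\<close> every summand other than the k-th contains the vanishing
    factor for j = k, so \<open>N\<close> is there an explicit multiple of
    \<open>Kf\<close>.\<close>
  have "(\<Prod>j\<in>{..<d} - {i}. (w k - w j) * (1 - cnj (w j) * w k)) = 0" if "i < d" "i \<noteq> k" for i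
    using that k by (intro prod_zero) auto
  hence "poly N (w k) = (\<Sum>i<d. if i = k then of_real (1 - (cmod (w k))\<^sup>2) *
     (\<Prod>j\<in>{..<d} - {k}. (w k - w j) * (1 - cnj (w j) * w k)) else 0)"
    unfolding N_def poly_crit_poly by (intro sum.cong) auto
  also have "\<dots> = of_real (1 - (cmod (w k))\<^sup>2) *
     (\<Prod>j\<in>{..<d} - {k}. (w k - w j) * (1 - cnj (w j) * w k))" using k by simp
  also have "(\<Prod>j\<in>{..<d} - {k}. (w k - w j) * (1 - cnj (w j) * w k))
     = (\<Prod>j\<in>{..<d} - {k}. (1 - cnj (w j) * w k)\<^sup>2 * mob (w j) (w k))"
    using one_minus_cnj_mult_nonzero[OF less_imp_le[OF w] wk]
    by (intro prod.cong) (auto simp: power2_eq_square)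
  finally have Nk: "poly N (w k) = Kf (w k) * (\<Prod>j\<in>{..<d} - {k}. mob (w j) (w k))"
    by (simp only: Kf_def prod.distrib mult.assoc)
  have "t ^ (2 * d) \<le> t ^ degree N"
    using t degree_crit_poly[of d w] by (intro power_decreasing) (auto simp: N_def)
  also have "t ^ degree N = (\<Prod>i<degree N. t)" by simp
  also have "\<dots> \<le> (\<Prod>i<degree N. cmod (w k - x i) / cmod (h i (w k)))"
  proof (intro prod_mono conjI t(1))
    fix i assume i: "i \<in> {..<degree N}"
    show "t \<le> cmod (w k - x i) / cmod (h i (w k))"
    proof (cases "cmod (x i) < 1")
      case True
      thus ?thesis using crit[of "x i"] x0[of i] i by (simp add: h_def N_def norm_divide)
    next
      case False
      hence "w k - x i \<noteq> 0" using wk by auto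
      thus ?thesis using False t by (simp add: h_def)
    qed
  qed
  also have "\<dots> = cmod (poly N (w k)) / cmod (G (w k))"
    using L0 by (simp add: x G_def norm_mult prod_norm[symmetric] prod_dividef)
  also have "\<dots> \<le> cmod (poly N (w k)) / cmod (Kf (w k))"
  proof (rule divide_left_mono[OF KG])
    have "Kf (w k) \<noteq> 0" unfolding Kf_def
      using one_minus_cnj_mult_nonzero[OF less_imp_le[OF w] wk] w wk abs_square_less_1[of "cmod (w k)"]
      by (auto simp flip: of_real_power of_real_diff)
    thus "0 < cmod (G (w k)) * cmod (Kf (w k))" using G0[of "w k"] wk by simp
  qed simp
  also have "\<dots> \<le> (\<Prod>j\<in>{..<d} - {k}. cmod (mob (w j) (w k)))"
    by (simp add: Nk norm_mult prod_norm prod_nonneg)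
  finally show ?thesis .
qed

section \<open>Contraction, preimages and critical points of the normalised Blaschke
  products\<close>

lemma blaschke_products_bprod:
  assumes "f \<in> blaschke_products d" "d \<ge> 1"
  obtains a where "\<And>i. i < d \<Longrightarrow> cmod (a i) < 1" "f = bprod d a" "a 0 = 0"
proof -
  obtain a :: "nat \<Rightarrow> complex" where a: "\<forall>i\<in>{1..d-1}. cmod (a i) < 1"
    "f = (\<lambda>z. z * (\<Prod>i=1..d-1. mob (a i) z))"
    using assms(1) by (auto simp: blaschke_products_def)
  define b where "b i = (if i = 0 then 0 else a i)" for i :: nat
  have set: "{..<d} = insert 0 {1..d-1}" using assms(2) by auto
  have "f = bprod d b"
  proof
    fix z
    have "(\<Prod>i\<in>insert 0 {1..d-1}. mob (b i) z) = mob (b 0) z * (\<Prod>i\<in>{1..d-1}. mob (b i) z)"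
      by (rule prod.insert) auto
    moreover have "(\<Prod>i\<in>{1..d-1}. mob (b i) z) = (\<Prod>i=1..d-1. mob (a i) z)"
      by (intro prod.cong) (auto simp: b_def)
    ultimately show "f z = bprod d b z" unfolding bprod_def set a(2) by (simp add: b_def)
  qed
  moreover have "cmod (b i) < 1" if "i < d" for i using a(1) that by (auto simp: b_def)
  moreover have "b 0 = 0" by (simp add: b_def)
  ultimately show thesis using that by blast
qed

lemma blaschke_products_0:
  assumes "f \<in> blaschke_products d"
  shows "f 0 = 0"
  using assms by (auto simp: blaschke_products_def)

lemma blaschke_products_unit_disk:
  assumes "f \<in> blaschke_products d" "d \<ge> 1" "cmod z < 1"
  shows "cmod (f z) < 1"
proof -
  obtain a where "\<And>i. i < d \<Longrightarrow> cmod (a i) < 1" "f = bprod d a"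
    using blaschke_products_bprod[OF assms(1,2)] by metis
  thus ?thesis using cmod_bprod_less_1[of d a z] assms by simp
qed

lemma bprod_differentiable:
  assumes "\<And>i. i < d \<Longrightarrow> cmod (a i) < 1" "cmod z < 1"
  shows "bprod d a field_differentiable at z"
proof -
  have "1 - cnj (a i) * z \<noteq> 0" if "i < d" for i
    using one_minus_cnj_mult_nonzero[of "a i" z] assms(1)[OF that] assms(2) by simp
  thus ?thesis using bprod_has_derivative field_differentiable_def by blast
qed

lemma blaschke_products_differentiable:
  assumes "f \<in> blaschke_products d" "d \<ge> 1" "cmod z < 1"
  shows "f field_differentiable at z"
proof -
  obtain a where "\<And>i. i < d \<Longrightarrow> cmod (a i) < 1" "f = bprod d a"
    using blaschke_products_bprod[OF assms(1,2)] by metis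
  thus ?thesis using bprod_differentiable[of d a z] assms by simp
qed

text \<open>For t = tanh (r/2) the distance r equals -ln (1 - t) up to ln 2, and Bernoulli's
  inequality gives 1 - t^d \<le> d (1 - t). Replacing t by its d-th power therefore costs at most ln
  (2 * d) in distance.\<close>

lemma hyp_dist_power_ge:
  fixes t p :: real
  assumes "0 \<le> t" "t < 1" "t ^ d \<le> p" "p < 1" "d \<ge> 1"
  shows "2 * artanh t - ln (2 * real d) \<le> 2 * artanh p"
proof -
  have td: "t ^ d < 1" using assms by (simp add: power_less_one_iff)
  have "1 + real d * (t - 1) \<le> (1 + (t - 1)) ^ d" by (rule Bernoulli_inequality) (use assms in simp)
  hence bern: "1 - t ^ d \<le> real d * (1 - t)" by (simp add: algebra_simps)
  have "2 * artanh t = ln ((1 + t) / (1 - t))" by (simp add: artanh_def)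
  also have "\<dots> \<le> ln (2 / (1 - t))" using assms by (intro ln_mono divide_right_mono) auto
  also have "\<dots> = ln (2 * real d) - ln (real d * (1 - t))"
    using assms by (simp add: ln_div ln_mult)
  also have "\<dots> \<le> ln (2 * real d) - ln (1 - t ^ d)"
    using bern td assms by (intro diff_left_mono ln_mono) auto
  finally have A: "2 * artanh t \<le> ln (2 * real d) - ln (1 - t ^ d)" .
  have "- ln (1 - t ^ d) = ln (1 / (1 - t ^ d))" using td by (simp add: ln_div)
  also have "\<dots> \<le> ln ((1 + t ^ d) / (1 - t ^ d))" using td assms by (intro ln_mono divide_right_mono) auto
  also have "\<dots> = 2 * artanh (t ^ d)" by (simp add: artanh_def)
  also have "\<dots> \<le> 2 * artanh p"
    using assms td artanh_mono[of "t ^ d" p] by (simp add: less_le_trans[of _ 0])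
  finally show ?thesis using A by linarith
qed

text \<open>The points \<open>ws j\<close> are the preimages of \<open>f w\<close>, with multiplicity.\<close>

lemma blaschke_preimages:
  assumes f: "f \<in> blaschke_products d" and d: "d \<ge> 1" and w: "cmod w < 1"
  obtains ws k where "\<And>j. j < d \<Longrightarrow> cmod (ws j) < 1" "\<And>j. j < d \<Longrightarrow> f (ws j) = f w"
    "k < d" "ws k = w"
    "\<And>z. cmod z < 1 \<Longrightarrow> hyp_dist (f z) (f w) \<le> hyp_dist z w"
    "\<And>z. cmod z < 1 \<Longrightarrow> \<exists>j<d. hyp_dist z (ws j) - ln (2 * real d) \<le> hyp_dist (f z) (f w)"
    "\<And>t j. 0 \<le> t \<Longrightarrow> t \<le> 1 \<Longrightarrow> (\<And>x. cmod x < 1 \<Longrightarrow> deriv f x = 0 \<Longrightarrow> t \<le> cmod (mob x w))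
       \<Longrightarrow> j < d \<Longrightarrow> j \<noteq> k \<Longrightarrow> t ^ (2 * d) \<le> cmod (mob (ws j) w)"
proof -
  obtain a where a: "\<And>i. i < d \<Longrightarrow> cmod (a i) < 1" "f = bprod d a"
    using blaschke_products_bprod[OF f d] by metis
  define c where "c = f w"
  have fD: "cmod (f z) < 1" if "cmod z < 1" for z
    using blaschke_products_unit_disk[OF f d that] .
  have c: "cmod c < 1" using fD w by (simp add: c_def)
  obtain \<kappa> ws where k: "cmod \<kappa> = 1" and ws: "\<And>i. i < d \<Longrightarrow> cmod (ws i) < 1"
    and eq: "\<And>z. cmod z < 1 \<Longrightarrow> mob c (f z) = \<kappa> * bprod d ws z"
    unfolding a(2) using mob_bprod[of d a c] a(1) c by metis
  have \<kappa>0: "\<kappa> \<noteq> 0" using k by auto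
  have "\<kappa> * bprod d ws w = 0" using eq[OF w] by (simp add: c_def)
  hence "bprod d ws w = 0" using \<kappa>0 by simp
  then obtain k where k0: "k < d" "mob (ws k) w = 0" unfolding bprod_def by (auto simp: prod_zero_iff)
  have kw: "ws k = w" using k0 one_minus_cnj_mult_nonzero[of "ws k" w] ws[OF k0(1)] w by auto
  have fws: "f (ws j) = f w" if j: "j < d" for j
  proof -
    have "bprod d ws (ws j) = 0" unfolding bprod_def using j by (intro prod_zero) auto
    hence "mob c (f (ws j)) = 0" using eq[OF ws[OF j]] by simp
    thus ?thesis using one_minus_cnj_mult_nonzero[of c "f (ws j)"] c fD[OF ws[OF j]] by (auto simp: c_def)
  qed
  \<comment> \<open>With \<open>f w\<close> moved to 0, the pseudo-hyperbolic distance of the images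
    is the product of those from z to the preimages. The factor of index k yields the contraction,
    the smallest factor the lower bound.\<close>
  have rho: "cmod (mob (f w) (f z)) = (\<Prod>j<d. cmod (mob (ws j) z))" if "cmod z < 1" for z
    unfolding c_def[symmetric] eq[OF that] norm_mult k bprod_def prod_norm
    using \<open>cmod \<kappa> = 1\<close> by simp
  have r1: "cmod (mob (ws j) z) < 1" if "cmod z < 1" "j < d" for z j
    using cmod_mob_less_1[OF ws] that by blast
  have lip: "hyp_dist (f z) (f w) \<le> hyp_dist z w" if z: "cmod z < 1" for z
  proof -
    have "cmod (mob (f w) (f z)) \<le> cmod (mob (ws k) z)"
      using prod_le_one_real[of "{..<d}" k "\<lambda>j. cmod (mob (ws j) z)"] k0(1) less_imp_le[OF r1[OF z]]
      by (simp only: rho[OF z] lessThan_iff norm_ge_zero finite_lessThan)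
    thus ?thesis unfolding kw using hyp_dist_le_iff[of "f z" "f w" z w] fD z w by blast
  qed
  have low: "\<exists>j<d. hyp_dist z (ws j) - ln (2 * real d) \<le> hyp_dist (f z) (f w)" if z: "cmod z < 1" for z
  proof -
    define m where "m = Min ((\<lambda>j. cmod (mob (ws j) z)) ` {..<d})"
    have ne: "(\<lambda>j. cmod (mob (ws j) z)) ` {..<d} \<noteq> {}" using k0 by auto
    have "m \<in> (\<lambda>j. cmod (mob (ws j) z)) ` {..<d}" unfolding m_def using ne by (intro Min_in) auto
    then obtain j where j: "j < d" "m = cmod (mob (ws j) z)" by auto
    have "m ^ d = (\<Prod>j<d. m)" by simp
    also have "\<dots> \<le> (\<Prod>j<d. cmod (mob (ws j) z))"
      by (intro prod_mono conjI) (auto simp: j(2), auto simp: m_def j(2)[symmetric])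
    finally have "m ^ d \<le> cmod (mob (f w) (f z))" using rho[OF z] by simp
    moreover have "cmod (mob (f w) (f z)) < 1" using cmod_mob_less_1[OF fD[OF w] fD[OF z]] .
    ultimately have "2 * artanh m - ln (2 * real d) \<le> 2 * artanh (cmod (mob (f w) (f z)))"
      using r1[OF z j(1)] j(2) d by (intro hyp_dist_power_ge) auto
    thus ?thesis using j by (auto simp: hyp_dist_mob)
  qed
  \<comment> \<open>Postcomposition with an automorphism and a constant does not change critical
    points, because the derivative of \<open>mob c\<close> vanishes nowhere in the disk.\<close>
  have crit: "deriv f x = 0" if x: "cmod x < 1" "poly (crit_poly d ws) x = 0" for x
  proof -
    have nz: "1 - cnj (ws i) * x \<noteq> 0" if "i < d" for i
      using one_minus_cnj_mult_nonzero[of "ws i" x] ws[OF that] x by simp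
    have "(bprod d ws has_field_derivative 0) (at x)"
      using bprod_has_derivative[of d ws x] nz x by simp
    hence 1: "((\<lambda>z. \<kappa> * bprod d ws z) has_field_derivative 0) (at x)"
      using DERIV_cmult[of "bprod d ws" 0 x UNIV \<kappa>] by simp
    have 2: "((\<lambda>z. mob c (f z)) has_field_derivative 0) (at x)"
      by (rule has_field_derivative_transform_within_open[OF 1, of "ball 0 1"]) (use x eq in auto)
    have fx: "(f has_field_derivative deriv f x) (at x)"
      using blaschke_products_differentiable[OF f d x(1)] by (simp add: field_differentiable_derivI)
    have n1: "1 - cnj c * f x \<noteq> 0" using one_minus_cnj_mult_nonzero[of c "f x"] c fD[OF x(1)] by simp
    have 3: "((\<lambda>z. mob c (f z)) has_field_derivative
        (of_real (1 - (cmod c)\<^sup>2) / (1 - cnj c * f x)\<^sup>2) * deriv f x) (at x)"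
      using DERIV_chain2[OF mob_has_derivative[OF n1] fx] .
    have "(of_real (1 - (cmod c)\<^sup>2) / (1 - cnj c * f x)\<^sup>2) * deriv f x = 0"
      by (rule DERIV_unique[OF 3 2])
    moreover have "1 - (cmod c)\<^sup>2 \<noteq> 0" using c abs_square_less_1[of "cmod c"] by simp
    hence "complex_of_real (1 - (cmod c)\<^sup>2) \<noteq> 0" by (simp only: of_real_eq_0_iff not_False_eq_True)
    ultimately show ?thesis using n1 by (simp del: of_real_diff)
  qed
  have cl: "t ^ (2 * d) \<le> cmod (mob (ws j) w)" if t: "0 \<le> t" "t \<le> 1"
    and cr: "\<And>x. cmod x < 1 \<Longrightarrow> deriv f x = 0 \<Longrightarrow> t \<le> cmod (mob x w)" and j: "j < d" "j \<noteq> k" for t j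
  proof -
    have "t ^ (2 * d) \<le> (\<Prod>j\<in>{..<d} - {k}. cmod (mob (ws j) (ws k)))"
      by (rule prod_crit_le_prod_preimages[OF ws k0(1) t]) (use cr crit kw in auto)
    also have "\<dots> \<le> cmod (mob (ws j) (ws k))"
      using prod_le_one_real[of "{..<d} - {k}" j "\<lambda>j. cmod (mob (ws j) (ws k))"] j
        less_imp_le[OF r1[OF ws[OF k0(1)]]]
      by (simp only: Diff_iff singleton_iff lessThan_iff norm_ge_zero finite_lessThan finite_Diff not_False_eq_True)
    finally show ?thesis by (simp only: kw)
  qed
  show thesis by (rule that[OF ws fws k0(1) kw lip low cl])
qed

text \<open>The Schwarz-Pick inequality.\<close>

lemma blaschke_products_contract:
  assumes "f \<in> blaschke_products d" "d \<ge> 1" "cmod z < 1" "cmod w < 1"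
  shows "hyp_dist (f z) (f w) \<le> hyp_dist z w"
  by (rule blaschke_preimages[OF assms(1,2,4)]) (use assms(3) in blast)

text \<open>A zero of \<open>deriv f\<close> has positive \<open>zorder\<close> once
  \<open>deriv f\<close> is not identically zero. If it were, f would be constantly f 0 = 0,
  although its only zeros in the disk are the finitely many \<open>a i\<close>.\<close>

lemma critical_labelling_complete:
  assumes f: "f \<in> blaschke_products d" and d: "d \<ge> 1" and l: "critical_labelling d f c"
    and x: "cmod x < 1" "deriv f x = 0"
  shows "\<exists>i\<in>{1..d-1}. c i = x"
proof -
  obtain a where a: "\<And>i. i < d \<Longrightarrow> cmod (a i) < 1" "f = bprod d a"
    using blaschke_products_bprod[OF f d] by metis
  have hol: "f holomorphic_on ball 0 1"
    using blaschke_products_differentiable[OF f d]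
    by (auto simp: holomorphic_on_def intro: field_differentiable_at_within)
  have "\<exists>y\<in>ball 0 1. deriv f y \<noteq> 0"
  proof (rule ccontr)
    assume "\<not> ?thesis"
    hence "\<And>y. y \<in> ball 0 1 \<Longrightarrow> (f has_field_derivative 0) (at y)"
      using blaschke_products_differentiable[OF f d] field_differentiable_derivI by fastforce
    hence "f constant_on ball 0 1"
      by (intro has_field_derivative_0_imp_constant_on) auto
    then obtain b where b: "\<And>z. z \<in> ball 0 1 \<Longrightarrow> f z = b" by (auto simp: constant_on_def)
    have "b = 0" using b[of 0] blaschke_products_0[OF f] by simp
    have "ball 0 1 \<subseteq> a ` {..<d}"
    proof
      fix z :: complex assume z: "z \<in> ball 0 1"
      hence "bprod d a z = 0" using b \<open>b = 0\<close> a(2) by simp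
      then obtain i where i: "i < d" "mob (a i) z = 0" unfolding bprod_def by (auto simp: prod_zero_iff)
      hence "z = a i" using one_minus_cnj_mult_nonzero[of "a i" z] a(1) z by (auto simp: less_imp_le)
      thus "z \<in> a ` {..<d}" using i by auto
    qed
    hence "finite (ball (0::complex) 1)" by (rule finite_subset) simp
    thus False using uncountable_ball[of 1 "0::complex"] countable_finite by auto
  qed
  hence "zorder (deriv f) x > 0"
    using zorder_exist_zero[of "deriv f" "ball 0 1" x] x hol holomorphic_deriv[OF hol] by auto
  moreover have "int (card {i\<in>{1..d-1}. c i = x}) = zorder (deriv f) x"
    using l x by (simp add: critical_labelling_def)
  ultimately have "card {i\<in>{1..d-1}. c i = x} \<noteq> 0" by linarith
  hence "{i\<in>{1..d-1}. c i = x} \<noteq> {}" by (metis card.empty)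
  thus ?thesis by blast
qed

subsection \<open>Points up to bounded distance\<close>

text \<open>Zorn's lemma gives a maximal family of sets all of whose finite intersections are
  infinite; infinite rather than nonempty makes the filter free. If neither A nor its complement
  belonged to the family, two finite subfamilies would meet A and its complement in finite sets, and
  their union would have a finite intersection.\<close>

lemma exists_free_ultrafilter:
  obtains U :: "nat filter" where "U \<noteq> bot" "U \<le> sequentially"
    "\<And>P. eventually P U \<or> eventually (\<lambda>n. \<not> P n) U"
proof -
  define \<A> where "\<A> = {M :: nat set set. \<forall>F. finite F \<longrightarrow> F \<subseteq> M \<longrightarrow> infinite (\<Inter>F)}"
  have "\<exists>M\<in>\<A>. \<forall>X\<in>\<A>. M \<subseteq> X \<longrightarrow> X = M"
  proof (rule subset_Zorn)
    fix C assume C: "subset.chain \<A> C"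
    show "\<exists>Y\<in>\<A>. \<forall>X\<in>C. X \<subseteq> Y"
    proof (cases "C = {}")
      case True
      have "{} \<in> \<A>" by (auto simp: \<A>_def)
      thus ?thesis using True by blast
    next
      case False
      have "\<Union>C \<in> \<A>" unfolding \<A>_def
      proof (safe)
        fix F assume F: "finite F" "F \<subseteq> \<Union>C" "finite (\<Inter>F)"
        obtain B where "B \<in> C" "F \<subseteq> B" using finite_subset_Union_chain[OF F(1,2) False C] by blast
        moreover have "B \<in> \<A>" using C \<open>B \<in> C\<close> by (auto simp: subset.chain_def)
        ultimately show False using F by (auto simp: \<A>_def)
      qed
      thus ?thesis by blast
    qed
  qed
  then obtain M where M: "M \<in> \<A>" "\<And>X. X \<in> \<A> \<Longrightarrow> M \<subseteq> X \<Longrightarrow> X = M" by blast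
  have inf: "infinite (\<Inter>F)" if "finite F" "F \<subseteq> M" for F using M(1) that by (auto simp: \<A>_def)
  have dich: "A \<in> M \<or> - A \<in> M" for A
  proof (rule ccontr)
    assume *: "\<not> ?thesis"
    have ex: "\<exists>G. finite G \<and> G \<subseteq> M \<and> finite (\<Inter>G \<inter> B)" if "B \<notin> M" for B
    proof -
      have "insert B M \<notin> \<A>" using M(2)[of "insert B M"] that by blast
      then obtain F where F: "finite F" "F \<subseteq> insert B M" "finite (\<Inter>F)" by (auto simp: \<A>_def)
      have "\<Inter>(F - {B}) \<inter> B \<subseteq> \<Inter>F" by auto
      hence "finite (\<Inter>(F - {B}) \<inter> B)" using F(3) finite_subset by blast
      thus ?thesis using F by (intro exI[of _ "F - {B}"]) auto
    qed
    obtain G where G: "finite G" "G \<subseteq> M" "finite (\<Inter>G \<inter> A)" using ex * by blast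
    obtain G' where G': "finite G'" "G' \<subseteq> M" "finite (\<Inter>G' \<inter> - A)" using ex * by blast
    have "\<Inter>(G \<union> G') \<subseteq> (\<Inter>G \<inter> A) \<union> (\<Inter>G' \<inter> - A)" by auto
    hence "finite (\<Inter>(G \<union> G'))" using G G' finite_subset by blast
    thus False using inf[of "G \<union> G'"] G G' by auto
  qed
  define U where "U = (INF A\<in>M. principal A)"
  have ev: "eventually P U" if "{n. P n} \<in> M" for P
    unfolding U_def by (rule eventually_INF1[OF that]) (simp add: eventually_principal)
  have "U \<noteq> bot"
  proof
    assume "U = bot"
    hence "eventually (\<lambda>_. False) U" by simp
    hence "\<exists>X\<subseteq>M. finite X \<and> eventually (\<lambda>_. False) (INF b\<in>X. principal b)"
      unfolding U_def by (rule eventually_INF[THEN iffD1])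
    then obtain X where X: "X \<subseteq> M" "finite X" "eventually (\<lambda>_. False) (INF b\<in>X. principal b)" by blast
    hence "\<forall>x. \<exists>A\<in>X. x \<notin> A" by (simp add: INF_principal_finite eventually_principal)
    hence "\<Inter>X = {}" by blast
    thus False using inf[OF X(2,1)] by simp
  qed
  moreover have "U \<le> sequentially"
  proof (rule filter_leI)
    fix P :: "nat \<Rightarrow> bool" assume "eventually P sequentially"
    then obtain N where N: "\<And>n. n \<ge> N \<Longrightarrow> P n" by (auto simp: eventually_sequentially)
    have "\<not> - {n. P n} \<in> M"
    proof
      assume "- {n. P n} \<in> M"
      hence "infinite (\<Inter>{- {n. P n}})" by (intro inf) auto
      moreover have "- {n. P n} \<subseteq> {..<N}" using N not_less by auto
      ultimately show False using finite_subset by auto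
    qed
    thus "eventually P U" using dich ev by blast
  qed
  moreover have "eventually P U \<or> eventually (\<lambda>n. \<not> P n) U" for P
    using dich[of "{n. P n}"] ev[of P] ev[of "\<lambda>n. \<not> P n"] by (auto simp: Collect_neg_eq)
  ultimately show thesis using that by blast
qed

text \<open>Membership is required for every n and not only along the filter, so that metric
  inequalities can be used pointwise.\<close>

definition pts :: "(nat \<Rightarrow> complex) set" where
  "pts = {x. \<forall>n. cmod (x n) < 1}"

text \<open>Sequences in the disk up to bounded distance along \<open>U\<close>. By the four-point
  inequality they behave like the points of a tree; \<open>btw x y z\<close> means that \<open>y\<close> lies on the segment
  from \<open>x\<close> to \<open>z\<close> of that tree.\<close>

locale asymptotic_tree =
  fixes U :: "nat filter"
  assumes proper: "U \<noteq> bot"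
    and ultra: "\<And>P. eventually P U \<or> eventually (\<lambda>n. \<not> P n) U"
begin

text \<open>One-sided on purpose: besides distances and defects it is applied to signed differences
  of lengths.\<close>

definition bdd :: "(nat \<Rightarrow> real) \<Rightarrow> bool" where
  "bdd a \<longleftrightarrow> (\<exists>C. \<forall>\<^sub>F n in U. a n \<le> C)"

abbreviation dst :: "(nat \<Rightarrow> complex) \<Rightarrow> (nat \<Rightarrow> complex) \<Rightarrow> nat \<Rightarrow> real" where
  "dst x y n \<equiv> hyp_dist (x n) (y n)"

definition near :: "(nat \<Rightarrow> complex) \<Rightarrow> (nat \<Rightarrow> complex) \<Rightarrow> bool" where
  "near x y \<longleftrightarrow> bdd (dst x y)"

definition btw :: "(nat \<Rightarrow> complex) \<Rightarrow> (nat \<Rightarrow> complex) \<Rightarrow> (nat \<Rightarrow> complex) \<Rightarrow> bool" where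
  "btw x y z \<longleftrightarrow> bdd (\<lambda>n. dst x y n + dst y z n - dst x z n)"

text \<open>Pigeonhole along an ultrafilter: a choice among finitely many indices that depends on n
  becomes a single index.\<close>

lemma ev_ex_finite:
  assumes "finite J" "\<forall>\<^sub>F n in U. \<exists>j\<in>J. P j n"
  shows "\<exists>j\<in>J. \<forall>\<^sub>F n in U. P j n"
proof (rule ccontr)
  assume "\<not> ?thesis"
  hence "\<forall>j\<in>J. \<forall>\<^sub>F n in U. \<not> P j n" using ultra by blast
  hence "\<forall>\<^sub>F n in U. \<forall>j\<in>J. \<not> P j n" using assms(1) by (simp add: eventually_ball_finite)
  hence "\<forall>\<^sub>F n in U. False" using assms(2) by eventually_elim blast
  thus False using proper by (simp add: trivial_limit_def)
qed

lemma ev_False: "\<forall>\<^sub>F n in U. False \<Longrightarrow> False"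
  using proper by (simp add: trivial_limit_def)

text \<open>Along an ultrafilter, not bounded means tending to infinity; for plain sequences this
  would take a further subsequence.\<close>

lemma not_bddD: "\<not> bdd a \<Longrightarrow> \<forall>\<^sub>F n in U. a n > C"
  using ultra[of "\<lambda>n. a n \<le> C"] by (auto simp: bdd_def not_le)

lemma not_bddI: "(\<And>C. \<forall>\<^sub>F n in U. a n > C) \<Longrightarrow> \<not> bdd a"
proof
  assume a: "\<And>C. \<forall>\<^sub>F n in U. a n > C" and "bdd a"
  then obtain C where "\<forall>\<^sub>F n in U. a n \<le> C" by (auto simp: bdd_def)
  hence "\<forall>\<^sub>F n in U. False" using a[of C] by eventually_elim simp
  thus False by (rule ev_False)
qed

lemma bdd_le:
  assumes "bdd a" "\<And>n. b n \<le> a n + K"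
  shows "bdd b"
proof -
  obtain C where "\<forall>\<^sub>F n in U. a n \<le> C" using assms(1) by (auto simp: bdd_def)
  hence "\<forall>\<^sub>F n in U. b n \<le> C + K" by eventually_elim (use assms(2) in \<open>smt (verit)\<close>)
  thus ?thesis by (auto simp: bdd_def)
qed

lemma bdd_ev_le:
  assumes "bdd a" "\<forall>\<^sub>F n in U. b n \<le> a n + K"
  shows "bdd b"
proof -
  obtain C where "\<forall>\<^sub>F n in U. a n \<le> C" using assms(1) by (auto simp: bdd_def)
  hence "\<forall>\<^sub>F n in U. b n \<le> C + K" using assms(2) by eventually_elim simp
  thus ?thesis by (auto simp: bdd_def)
qed

lemma bdd_add: "bdd a \<Longrightarrow> bdd b \<Longrightarrow> bdd (\<lambda>n. a n + b n)"
proof -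
  assume "bdd a" "bdd b"
  then obtain C D where "\<forall>\<^sub>F n in U. a n \<le> C" "\<forall>\<^sub>F n in U. b n \<le> D" by (auto simp: bdd_def)
  hence "\<forall>\<^sub>F n in U. a n + b n \<le> C + D" by eventually_elim simp
  thus ?thesis by (auto simp: bdd_def)
qed

lemma bdd_le2:
  assumes "bdd a" "bdd b" "\<And>n. c n \<le> a n + b n + K"
  shows "bdd c"
  by (rule bdd_le[OF bdd_add[OF assms(1,2)] assms(3)])

lemma bdd_le3:
  assumes "bdd a" "bdd b" "bdd c" "\<And>n. e n \<le> a n + b n + c n + K"
  shows "bdd e"
  by (rule bdd_le[OF bdd_add[OF bdd_add[OF assms(1,2)] assms(3)] assms(4)])

lemma bdd_const: "(\<And>n. a n \<le> K) \<Longrightarrow> bdd a"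
  unfolding bdd_def by (intro exI[of _ K]) simp

lemma dst_commute: "dst x y n = dst y x n"
  by (rule hyp_dist_commute)

lemma dst_nonneg: "x \<in> pts \<Longrightarrow> y \<in> pts \<Longrightarrow> 0 \<le> dst x y n"
  by (simp add: pts_def hyp_dist_nonneg)

lemma dst_triangle: "x \<in> pts \<Longrightarrow> y \<in> pts \<Longrightarrow> z \<in> pts \<Longrightarrow> dst x z n \<le> dst x y n + dst y z n"
  by (simp add: pts_def hyp_dist_triangle)

lemma four_point:
  "x \<in> pts \<Longrightarrow> y \<in> pts \<Longrightarrow> z \<in> pts \<Longrightarrow> w \<in> pts \<Longrightarrow>
   dst x y n + dst z w n \<le> max (dst x z n + dst y w n) (dst x w n + dst y z n) + 6"
  by (simp only: pts_def hyp_dist_four_point mem_Collect_eq)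

lemma near_refl [simp]: "near x x"
  unfolding near_def by (rule bdd_const[of _ 0]) simp

lemma near_sym: "near x y \<Longrightarrow> near y x"
  by (simp add: near_def dst_commute[of y])

lemma near_trans:
  assumes "near x y" "near y z" "x \<in> pts" "y \<in> pts" "z \<in> pts"
  shows "near x z"
  using assms(1,2) unfolding near_def
  by (rule bdd_le2[of _ _ _ 0]) (use dst_triangle[OF assms(3-5)] in simp)

lemma btw_sym: "btw x y z \<Longrightarrow> btw z y x"
  unfolding btw_def by (erule bdd_le[of _ _ 0]) (simp add: hyp_dist_commute)

lemma btw_left [simp]: "btw x x y" and btw_right [simp]: "btw x y y"
  unfolding btw_def by (rule bdd_const[of _ 0], simp)+

text \<open>Moving the three points changes the defect by at most twice the sum of the
  displacements. Hence \<open>btw\<close> is a relation between classes of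
  \<open>near\<close>.\<close>

lemma btw_near:
  assumes "btw x y z" "near x x'" "near y y'" "near z z'"
    and pt: "x \<in> pts" "y \<in> pts" "z \<in> pts" "x' \<in> pts" "y' \<in> pts" "z' \<in> pts"
  shows "btw x' y' z'"
proof -
  have "bdd (\<lambda>n. 2 * (dst x x' n + dst y y' n + dst z z' n))"
  proof -
    have b: "bdd (\<lambda>n. dst x x' n + dst y y' n + dst z z' n)"
      using assms(2-4) unfolding near_def by (intro bdd_add)
    show ?thesis by (rule bdd_le2[OF b b, of _ 0]) simp
  qed
  with assms(1) show ?thesis unfolding btw_def
  proof (rule bdd_le2[of _ _ _ 0])
    fix n
    show "dst x' y' n + dst y' z' n - dst x' z' n \<le> dst x y n + dst y z n - dst x z n +
       2 * (dst x x' n + dst y y' n + dst z z' n) + 0"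
      using dst_triangle[of x' x y' n] dst_triangle[of x y y' n] dst_triangle[of y' y z' n]
        dst_triangle[of y z z' n] dst_triangle[of x x' z n] dst_triangle[of x' z' z n] pt
      by (simp add: dst_commute[of x' _ x] dst_commute[of y' _ y] dst_commute[of z' _ z])
  qed
qed

text \<open>Valid in any metric space: by one triangle inequality, each new defect is at most the
  sum of the two given ones.\<close>

lemma btw_trans:
  assumes "btw x y z" "btw x z w" and pt: "x \<in> pts" "y \<in> pts" "z \<in> pts" "w \<in> pts"
  shows "btw x y w" "btw y z w"
  unfolding btw_def
  by (rule bdd_le2[OF assms(1,2)[unfolded btw_def], of _ 0],
      use dst_triangle[OF pt(2,3,4)] dst_triangle[OF pt(1,2,4)] in \<open>smt (verit)\<close>)+

text \<open>The two defects add up to twice the distance from y to z.\<close>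

lemma btw_antisym:
  assumes "btw x y z" "btw x z y" "y \<in> pts" "z \<in> pts"
  shows "near y z"
  unfolding near_def
proof (rule bdd_le2[OF assms(1,2)[unfolded btw_def], of _ 0])
  fix n show "dst y z n \<le> dst x y n + dst y z n - dst x z n + (dst x z n + dst z y n - dst x y n) + 0"
    using dst_nonneg[OF assms(3,4), of n] by (simp add: dst_commute[of z _ y])
qed

text \<open>The order on a segment is that of the distances from x, which the ultrafilter compares
  once and for all. The four-point inequality for the pairs y, w and x, z then bounds the defect; in
  a general metric space two points on geodesics from x to z need not be comparable.\<close>

lemma btw_linear:
  assumes "btw x y z" "btw x w z" and pt: "x \<in> pts" "y \<in> pts" "z \<in> pts" "w \<in> pts"
  shows "btw x y w \<or> btw x w y"
proof -
  have *: "btw x y w" if "btw x y z" "btw x w z" "\<forall>\<^sub>F n in U. dst x y n \<le> dst x w n"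
    "y \<in> pts" "w \<in> pts" for y w
    unfolding btw_def
  proof (rule bdd_ev_le[OF bdd_add[OF that(1,2)[unfolded btw_def]], of _ 6])
    show "\<forall>\<^sub>F n in U. dst x y n + dst y w n - dst x w n \<le>
      dst x y n + dst y z n - dst x z n + (dst x w n + dst w z n - dst x z n) + 6"
      using that(3)
    proof eventually_elim
      case (elim n)
      thus ?case using four_point[OF that(4,5) pt(1,3), of n] dst_triangle[OF pt(1) that(4) pt(3), of n]
          dst_triangle[OF pt(1) that(5) pt(3), of n]
        by (simp add: dst_commute[of y _ x] dst_commute[of w _ x] max_def split: if_splits)
    qed
  qed
  have "(\<forall>\<^sub>F n in U. dst x y n \<le> dst x w n) \<or> (\<forall>\<^sub>F n in U. dst x w n \<le> dst x y n)"
    using ultra[of "\<lambda>n. dst x y n \<le> dst x w n"]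
  proof
    assume "\<forall>\<^sub>F n in U. \<not> dst x y n \<le> dst x w n"
    hence "\<forall>\<^sub>F n in U. dst x w n \<le> dst x y n" by eventually_elim simp
    thus ?thesis ..
  qed simp
  thus ?thesis using *[of y w] *[of w y] assms by blast
qed

text \<open>Removing y separates x from z, so w is separated by y from at least one of them. The two
  cases are the two terms of the maximum in the four-point inequality, and the ultrafilter selects
  one.\<close>

lemma btw_split:
  assumes "btw x y z" and pt: "x \<in> pts" "y \<in> pts" "z \<in> pts" "w \<in> pts"
  shows "btw x y w \<or> btw w y z"
proof -
  have *: "dst x z n + dst y w n \<le> max (dst x y n + dst z w n) (dst x w n + dst y z n) + 6" for n
    using four_point[OF pt(1,3,2,4), of n] by (simp add: dst_commute[of z _ y])
  show ?thesis
  proof (cases "\<forall>\<^sub>F n in U. dst x z n + dst y w n \<le> dst x w n + dst y z n + 6")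
    case True
    have "btw x y w" unfolding btw_def
      by (rule bdd_ev_le[OF assms(1)[unfolded btw_def], of _ 6])
         (use True in \<open>auto elim!: eventually_mono\<close>)
    thus ?thesis ..
  next
    case False
    hence "\<forall>\<^sub>F n in U. \<not> (dst x z n + dst y w n \<le> dst x w n + dst y z n + 6)" using ultra by blast
    hence "\<forall>\<^sub>F n in U. dst w y n + dst y z n - dst w z n \<le> dst x y n + dst y z n - dst x z n + 6"
    proof eventually_elim
      case (elim n)
      thus ?case using *[of n] by (simp add: dst_commute[of w] max_def split: if_splits)
    qed
    hence "btw w y z" unfolding btw_def by (rule bdd_ev_le[OF assms(1)[unfolded btw_def]])
    thus ?thesis ..
  qed
qed

text \<open>Two segments that overlap in \<open>[y, z]\<close> form one segment. The overlap must be
  unbounded: for y near z the path could turn back there.\<close>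

lemma btw_extend:
  assumes "btw x y z" "btw y z w" "\<not> near y z" and pt: "x \<in> pts" "y \<in> pts" "z \<in> pts" "w \<in> pts"
  shows "btw x y w" "btw x z w"
proof -
  show "btw x y w"
  proof (rule ccontr)
    assume "\<not> btw x y w"
    hence "btw w y z" using btw_split[OF assms(1) pt] by blast
    hence "btw z y w" by (rule btw_sym)
    moreover have "btw w z y" using assms(2) by (rule btw_sym)
    hence "near y z" using btw_antisym[of w y z] \<open>btw w y z\<close> pt by blast
    thus False using assms(3) by blast
  qed
  show "btw x z w"
  proof (rule ccontr)
    assume "\<not> btw x z w"
    hence "btw x z y" using btw_split[OF btw_sym[OF assms(2)] pt(4,3,2,1)] btw_sym by blast
    hence "near y z" using btw_antisym[of x y z] assms(1) pt by blast
    thus False using assms(3) by blast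
  qed
qed

definition med :: "(nat \<Rightarrow> complex) \<Rightarrow> (nat \<Rightarrow> complex) \<Rightarrow> (nat \<Rightarrow> complex) \<Rightarrow> (nat \<Rightarrow> complex) \<Rightarrow> bool" where
  "med x y z m \<longleftrightarrow> m \<in> pts \<and> btw x m y \<and> btw y m z \<and> btw x m z"

lemma med_exists:
  assumes pt: "x \<in> pts" "y \<in> pts" "z \<in> pts"
  shows "\<exists>m. med x y z m"
proof -
  \<comment> \<open>The Gromov product of y and z based at x, that is the length along which the
    segments from x to y and from x to z run together.\<close>
  define g where "g n = (dst x y n + dst x z n - dst y z n) / 2" for n
  have "\<exists>u. u \<in> hseg (x n) (y n) \<and> hyp_dist (x n) u = g n \<and> hyp_dist u (y n) = dst x y n - g n" for n
  proof -
    have "0 \<le> g n" "g n \<le> dst x y n"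
      using dst_triangle[of y x z n] dst_triangle[of x y z n] pt by (auto simp: g_def dst_commute[of y _ x])
    thus ?thesis using hseg_point_at[of "x n" "y n" "g n"] pt by (metis mem_Collect_eq pts_def)
  qed
  then obtain m where m: "\<And>n. m n \<in> hseg (x n) (y n)" "\<And>n. dst x m n = g n"
    "\<And>n. dst m y n = dst x y n - g n" by metis
  have mp: "m \<in> pts" using m(1) hseg_subset pt by (fastforce simp: pts_def)
  have mz: "dst m z n \<le> (dst x z n + dst y z n - dst x y n) / 2 + 6" for n
    using four_point[OF mp pt(3,1,2), of n] m(2,3)[of n]
    by (simp add: g_def dst_commute[of m _ x] dst_commute[of z _ y] dst_commute[of z _ x] max_def field_simps)
  have "btw x m y" unfolding btw_def by (rule bdd_const[of _ 0]) (use m in simp)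
  moreover have "dst y m n + dst m z n - dst y z n \<le> 6" "dst x m n + dst m z n - dst x z n \<le> 6" for n
    using m(2,3)[of n] mz[of n] by (simp_all add: g_def dst_commute[of y _ m] field_simps)
  hence "btw y m z" "btw x m z" unfolding btw_def by (auto intro: bdd_const)
  ultimately show ?thesis using mp by (auto simp: med_def)
qed

text \<open>Both medians lie on the segment from x to y, so one of them, say m, precedes m' as seen
  from x. From m the point m' then lies towards y and towards z. But m separates y from z, and
  \<open>btw_split\<close> leaves m' on only one side unless m and m' are near.\<close>

lemma med_unique:
  assumes "med x y z m" "med x y z m'" and pt: "x \<in> pts" "y \<in> pts" "z \<in> pts"
  shows "near m m'"
proof -
  have *: "near m m'" if m: "med x y z m" "med x y z m'" and xm: "btw x m m'" for m m'
  proof -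
    have p: "m \<in> pts" "m' \<in> pts" using m by (auto simp: med_def)
    have "btw x m' y" "btw x m' z" "btw y m z" using m by (auto simp: med_def)
    hence a: "btw m m' y" "btw m m' z" using btw_trans(2)[OF xm] p pt by blast+
    show ?thesis
    proof (cases "near m m'")
      case False
      from btw_split[OF \<open>btw y m z\<close> pt(2) p(1) pt(3) p(2)] show ?thesis
      proof
        assume "btw y m m'"
        thus ?thesis using btw_antisym[of y m m'] btw_sym[OF a(1)] p by blast
      next
        assume "btw m' m z"
        hence "near m' m" using btw_antisym[of z m' m] btw_sym[OF a(2)] btw_sym p by blast
        thus ?thesis by (rule near_sym)
      qed
    qed
  qed
  have "m \<in> pts" "m' \<in> pts" "btw x m y" "btw x m' y" using assms by (auto simp: med_def)
  hence "btw x m m' \<or> btw x m' m" using btw_linear pt by blast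
  thus ?thesis using *[OF assms(1,2)] *[OF assms(2,1)] near_sym by blast
qed

end

section \<open>The induced map: isometry away from critical points, finiteness of fibres\<close>

locale blaschke_sequence = asymptotic_tree U for U +
  fixes d :: nat and f :: "nat \<Rightarrow> complex \<Rightarrow> complex"
  assumes d: "d \<ge> 1" and f: "\<And>n. f n \<in> blaschke_products d"
begin

definition ap :: "(nat \<Rightarrow> complex) \<Rightarrow> nat \<Rightarrow> complex" where
  "ap x n = f n (x n)"

lemma ap_pts: "x \<in> pts \<Longrightarrow> ap x \<in> pts"
  using blaschke_products_unit_disk[OF f d] by (simp add: pts_def ap_def)

lemma ap_contract: "x \<in> pts \<Longrightarrow> y \<in> pts \<Longrightarrow> dst (ap x) (ap y) n \<le> dst x y n"
  using blaschke_products_contract[OF f d] by (simp add: pts_def ap_def)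

lemma ap_near: "near x y \<Longrightarrow> x \<in> pts \<Longrightarrow> y \<in> pts \<Longrightarrow> near (ap x) (ap y)"
  unfolding near_def by (erule bdd_le[of _ _ 0]) (simp add: ap_contract)

text \<open>The distance from \<open>m n\<close> to the set of critical points tends to infinity
  along \<open>U\<close>. Quantifying over all critical points of \<open>f n\<close> avoids
  selecting one for each n.\<close>

definition noncrit :: "(nat \<Rightarrow> complex) \<Rightarrow> bool" where
  "noncrit m \<longleftrightarrow> (\<forall>B. \<forall>\<^sub>F n in U. \<forall>c. cmod c < 1 \<longrightarrow> deriv (f n) c = 0 \<longrightarrow> B < hyp_dist (m n) c)"

text \<open>Without critical points within T of u, every other preimage of \<open>f n u\<close> is
  at distance at least T - ln (4 * d) \<ge> 2 * d(u, v) from u, hence no closer to v than u itself.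
  The nearest-preimage bound then loses only ln (2 * d). The 4 * d stems from the exponent 2 * d in
  the bound on close preimages.\<close>

lemma local_rigidity:
  assumes u: "cmod u < 1" "cmod v < 1"
    and T: "2 * hyp_dist u v + ln (4 * real d) \<le> T"
    and crit: "\<And>c. cmod c < 1 \<Longrightarrow> deriv (f n) c = 0 \<Longrightarrow> T \<le> hyp_dist u c"
  shows "hyp_dist u v - ln (2 * real d) \<le> hyp_dist (f n u) (f n v)"
proof -
  obtain ws k where ws: "\<And>j. j < d \<Longrightarrow> cmod (ws j) < 1" "k < d" "ws k = u"
    and ex: "\<And>z. cmod z < 1 \<Longrightarrow> \<exists>j<d. hyp_dist z (ws j) - ln (2 * real d) \<le> hyp_dist (f n z) (f n u)"
    and cl: "\<And>t j. 0 \<le> t \<Longrightarrow> t \<le> 1 \<Longrightarrow> (\<And>x. cmod x < 1 \<Longrightarrow> deriv (f n) x = 0 \<Longrightarrow> t \<le> cmod (mob x u))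
       \<Longrightarrow> j < d \<Longrightarrow> j \<noteq> k \<Longrightarrow> t ^ (2 * d) \<le> cmod (mob (ws j) u)"
    using blaschke_preimages[OF f d u(1), of n] by metis
  obtain j where j: "j < d" "hyp_dist v (ws j) - ln (2 * real d) \<le> hyp_dist (f n v) (f n u)"
    using ex[OF u(2)] by blast
  have "hyp_dist u v \<le> hyp_dist v (ws j)"
  proof (cases "j = k")
    case True
    thus ?thesis using ws by (simp add: hyp_dist_commute)
  next
    case False
    define t where "t = tanh (T / 2)"
    have "ln (4 * real d) \<ge> 0" using d by simp
    hence T0: "T \<ge> 0" using T hyp_dist_nonneg[OF u] by linarith
    have t: "0 \<le> t" "t < 1" using T0 tanh_less_1_real by (auto simp: t_def)
    have "t \<le> cmod (mob x u)" if "cmod x < 1" "deriv (f n) x = 0" for x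
    proof -
      have "tanh (T / 2) \<le> tanh (hyp_dist u x / 2)" using crit[OF that] by simp
      also have "\<dots> = cmod (mob x u)" by (rule tanh_hyp_dist[OF u(1) that(1)])
      finally show ?thesis by (simp only: t_def)
    qed
    hence "t ^ (2 * d) \<le> cmod (mob (ws j) u)" using cl[of t j] t j(1) False by simp
    hence "2 * artanh t - ln (2 * real (2 * d)) \<le> 2 * artanh (cmod (mob (ws j) u))"
      using t d cmod_mob_less_1[OF ws(1)[OF j(1)] u(1)] by (intro hyp_dist_power_ge) auto
    hence "T - ln (4 * real d) \<le> hyp_dist u (ws j)"
      by (simp add: t_def artanh_tanh_real hyp_dist_mob)
    thus ?thesis using hyp_dist_triangle[of u v "ws j"] u ws(1)[OF j(1)] T by linarith
  qed
  thus ?thesis using j(2) by (simp add: hyp_dist_commute[of "f n u"])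
qed

text \<open>If \<open>f\<close> shortened \<open>[v, w]\<close>, it would fold it at the midpoint \<open>m\<close> between \<open>v\<close> and another
  preimage of \<open>f v\<close>. For the fold closest to \<open>v\<close>, two points on either side of \<open>m\<close> at a fixed large
  distance have images at bounded distance, against \<open>local_rigidity\<close>.\<close>

lemma isometric_off_critical:
  assumes v: "v \<in> pts" and w: "w \<in> pts"
    and nc: "\<And>m. m \<in> pts \<Longrightarrow> btw v m w \<Longrightarrow> \<not> near m v \<Longrightarrow> \<not> near m w \<Longrightarrow> noncrit m"
  shows "bdd (\<lambda>n. dst v w n - dst (ap v) (ap w) n)"
proof (rule ccontr)
  assume loss: "\<not> ?thesis"
  define l where "l = ln (2 * real d)"
  have l0: "l \<ge> 0" using d by (simp add: l_def)
  have vn: "cmod (v n) < 1" and wn: "cmod (w n) < 1" for n using v w by (auto simp: pts_def)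
  have "\<exists>ws. (\<forall>j<d. cmod (ws j) < 1) \<and> (\<forall>j<d. f n (ws j) = f n (v n)) \<and>
     (\<forall>z. cmod z < 1 \<longrightarrow> (\<exists>j<d. hyp_dist z (ws j) - l \<le> hyp_dist (f n z) (f n (v n))))" for n
    by (rule blaschke_preimages[OF f d vn, of n n]) (metis l_def)
  then obtain ws where ws: "\<And>n j. j < d \<Longrightarrow> cmod (ws n j) < 1"
      "\<And>n j. j < d \<Longrightarrow> f n (ws n j) = f n (v n)"
    and ex: "\<And>n z. cmod z < 1 \<Longrightarrow> \<exists>j<d. hyp_dist z (ws n j) - l \<le> hyp_dist (f n z) (f n (v n))"
    by metis
  \<comment> \<open>The amount by which the j-th preimage of f v is closer to w than v is. The image
    of w is about as far from f v as w is from its nearest preimage, so a loss of length makes some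
    \<open>D j\<close> unbounded; \<open>J\<close> collects these j.\<close>
  define D where "D j n = dst v w n - hyp_dist (w n) (ws n j)" for j n
  define e where "e j n = hyp_dist (v n) (ws n j)" for j n
  define J where "J = {j. j < d \<and> \<not> bdd (D j)}"
  have finJ: "finite J" by (simp add: J_def)
  have "\<exists>C. \<forall>\<^sub>F n in U. D j n \<le> C" if "j < d" "j \<notin> J" for j using that by (auto simp: J_def bdd_def)
  then obtain C where C: "\<And>j. j < d \<Longrightarrow> j \<notin> J \<Longrightarrow> \<forall>\<^sub>F n in U. D j n \<le> C j" by metis
  define Cm where "Cm = Max (insert 0 (C ` {..<d}))"
  have Cm: "C j \<le> Cm" "0 \<le> Cm" if "j < d" for j using that by (auto simp: Cm_def)
  have Cm0: "0 \<le> Cm" by (auto simp: Cm_def)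
  have "\<forall>\<^sub>F n in U. \<forall>j\<in>{..<d} - J. D j n \<le> C j"
    using C by (intro eventually_ball_finite) auto
  hence evC: "\<forall>\<^sub>F n in U. \<forall>j<d. j \<notin> J \<longrightarrow> D j n \<le> Cm"
  proof eventually_elim
    case (elim n)
    thus ?case using Cm(1) by (meson DiffI lessThan_iff order_trans)
  qed
  have "J \<noteq> {}"
  proof
    assume "J = {}"
    have "\<forall>\<^sub>F n in U. False" using evC not_bddD[OF loss, of "Cm + l"]
    proof eventually_elim
      case (elim n)
      obtain j where "j < d" "hyp_dist (w n) (ws n j) - l \<le> hyp_dist (f n (w n)) (f n (v n))"
        using ex[OF wn] by blast
      thus False using elim \<open>J = {}\<close> by (force simp: D_def ap_def hyp_dist_commute[of "f n (v n)"])
    qed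
    thus False by (rule ev_False)
  qed
  have "\<forall>\<^sub>F n in U. \<exists>j\<in>J. \<forall>i\<in>J. e j n \<le> e i n"
  proof (intro always_eventually allI)
    fix n
    have "Min ((\<lambda>j. e j n) ` J) \<in> (\<lambda>j. e j n) ` J" using finJ \<open>J \<noteq> {}\<close> by (intro Min_in) auto
    then obtain j where "j \<in> J" "e j n = Min ((\<lambda>j. e j n) ` J)" by auto
    thus "\<exists>j\<in>J. \<forall>i\<in>J. e j n \<le> e i n" using finJ by (intro bexI[of _ j]) auto
  qed
  from ev_ex_finite[OF finJ this] obtain j where j: "j \<in> J" "\<forall>\<^sub>F n in U. \<forall>i\<in>J. e j n \<le> e i n" by blast
  have jd: "j < d" and Dj: "\<not> bdd (D j)" using j by (auto simp: J_def)
  have ev0: "\<forall>\<^sub>F n in U. D j n > B" for B by (rule not_bddD[OF Dj])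
  have e0: "e j n \<ge> 0" for n unfolding e_def by (rule hyp_dist_nonneg[OF vn ws(1)[OF jd]])
  have e1: "e j n \<le> 2 * dst v w n - D j n" for n
    using hyp_dist_triangle[OF vn[of n] wn[of n] ws(1)[OF jd, of n]] by (simp add: e_def D_def)
  have e2: "D j n \<le> e j n" for n
    using hyp_dist_triangle[OF vn[of n] ws(1)[OF jd, of n] wn[of n]]
    by (simp add: e_def D_def hyp_dist_commute[of "w n"])
  \<comment> \<open>The segments from v to w and from v to the preimage j run together up to
    distance about (e + D) / 2 from v. So the point of the former at distance e / 2 is, up to a
    bounded error, the midpoint between v and that preimage. Where \<open>D j n\<close> is negative
    any point of the disk serves.\<close>
  have "\<exists>u. cmod u < 1 \<and> (D j n \<ge> 0 \<longrightarrow> hyp_dist (v n) u = e j n / 2 \<and> hyp_dist u (w n) = dst v w n - e j n / 2)" for n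
  proof (cases "D j n \<ge> 0")
    case True
    obtain u where "u \<in> hseg (v n) (w n)" "hyp_dist (v n) u = e j n / 2" "hyp_dist u (w n) = dst v w n - e j n / 2"
      by (rule hseg_point_at[OF vn[of n] wn[of n], of "e j n / 2"]) (use True e0[of n] e1[of n] in auto)
    moreover have "cmod u < 1" using hseg_subset[OF vn[of n] wn[of n]] calculation(1) by auto
    ultimately show ?thesis by blast
  qed (use vn in auto)
  then obtain m where m: "\<And>n. cmod (m n) < 1"
    "\<And>n. D j n \<ge> 0 \<Longrightarrow> dst v m n = e j n / 2" "\<And>n. D j n \<ge> 0 \<Longrightarrow> dst m w n = dst v w n - e j n / 2"
    by metis
  have mp: "m \<in> pts" using m by (simp add: pts_def)
  have "btw v m w" unfolding btw_def bdd_def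
    by (intro exI[of _ 0]) (use ev0[of 0] in \<open>eventually_elim, simp add: m\<close>)
  moreover have "\<not> near m v" unfolding near_def
  proof (rule not_bddI)
    fix B show "\<forall>\<^sub>F n in U. B < dst m v n"
      using ev0[of "2 * B"] ev0[of 0]
    proof eventually_elim
      case (elim n) thus ?case using m(2)[of n] e2[of n] by (simp add: dst_commute[of m _ v])
    qed
  qed
  moreover have "\<not> near m w" unfolding near_def
  proof (rule not_bddI)
    fix B show "\<forall>\<^sub>F n in U. B < dst m w n"
      using ev0[of "2 * B"] ev0[of 0]
    proof eventually_elim
      case (elim n) thus ?case using m(3)[of n] e1[of n] by simp
    qed
  qed
  ultimately have ncm: "noncrit m" using nc mp by blast
  \<comment> \<open>f does not shorten the segment from v to m by more than a constant: a preimage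
    with index in \<open>J\<close> is at least e from v by the minimal choice of j, and one outside
    \<open>J\<close> is hardly closer to w than v is, so all of them are about e / 2 or more away
    from m.\<close>
  have fm: "\<forall>\<^sub>F n in U. e j n / 2 - Cm - l \<le> hyp_dist (f n (m n)) (f n (v n))"
    using evC j(2) ev0[of 0]
  proof eventually_elim
    case (elim n)
    obtain i where i: "i < d" "hyp_dist (m n) (ws n i) - l \<le> hyp_dist (f n (m n)) (f n (v n))"
      using ex[OF m(1)] by blast
    have "e j n / 2 - Cm \<le> hyp_dist (m n) (ws n i)"
    proof (cases "i \<in> J")
      case True
      hence "e j n \<le> e i n" using elim by blast
      thus ?thesis using hyp_dist_triangle[OF vn[of n] m(1)[of n] ws(1)[OF i(1), of n]] m(2)[of n] elim Cm0
        by (simp add: e_def)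
    next
      case False
      hence "D i n \<le> Cm" using elim i by blast
      thus ?thesis using hyp_dist_triangle[OF wn[of n] m(1)[of n] ws(1)[OF i(1), of n]] m(3)[of n] elim
        by (simp add: D_def hyp_dist_commute[of "w n" "m n"])
    qed
    thus ?case using i(2) by linarith
  qed
  \<comment> \<open>The final four-point inequality yields 2 * R \<le> Cm + 2 * l + 18, which this
    value contradicts.\<close>
  define R where "R = Cm + 2 * l + 20"
  have R0: "R > 0" using Cm0 l0 by (simp add: R_def)
  \<comment> \<open>\<open>4 * R + ln (4 * real d)\<close> is the radius that
    \<open>local_rigidity\<close> asks for when the points are 2 * R apart; another R is added
    because critical points are measured from m instead of u.\<close>
  define B where "B = 4 * R + ln (4 * real d) + R"
  have "\<forall>\<^sub>F n in U. \<forall>c. cmod c < 1 \<longrightarrow> deriv (f n) c = 0 \<longrightarrow> B < hyp_dist (m n) c"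
    using ncm by (simp add: noncrit_def)
  hence "\<forall>\<^sub>F n in U. False" using fm ev0[of 0] ev0[of "2 * R"]
  proof eventually_elim
    case (elim n)
    note mv = m(2)[OF less_imp_le[OF elim(3)]] and mw = m(3)[OF less_imp_le[OF elim(3)]]
    have Rmv: "R \<le> dst m v n" using mv e2[of n] elim(4) by (simp add: dst_commute[of m])
    have Rmw: "R \<le> dst m w n" using mw e1[of n] elim(4) by simp
    obtain u where u: "u \<in> hseg (m n) (v n)" "hyp_dist (m n) u = R" "hyp_dist u (v n) = dst m v n - R"
      by (rule hseg_point_at[OF m(1)[of n] vn[of n], of R]) (use R0 Rmv in auto)
    obtain u' where u': "u' \<in> hseg (m n) (w n)" "hyp_dist (m n) u' = R" "hyp_dist u' (w n) = dst m w n - R"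
      by (rule hseg_point_at[OF m(1)[of n] wn[of n], of R]) (use R0 Rmw in auto)
    have U1: "cmod u < 1" "cmod u' < 1"
      using u(1) u'(1) hseg_subset[OF m(1)[of n] vn[of n]] hseg_subset[OF m(1)[of n] wn[of n]] by auto
    have F1: "cmod (f n z) < 1" if "cmod z < 1" for z using blaschke_products_unit_disk[OF f d that] .
    have lip: "hyp_dist (f n y) (f n z) \<le> hyp_dist y z" if "cmod y < 1" "cmod z < 1" for y z
      using blaschke_products_contract[OF f d that] .
    let ?h = hyp_dist
    have uu: "?h u u' \<ge> 2 * R"
      using hyp_dist_triangle[OF vn[of n] U1(1) wn[of n]] hyp_dist_triangle[OF U1 wn[of n]] mv mw u(3) u'(3)
      by (simp add: hyp_dist_commute[of "v n" u] dst_commute[of m _ v])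
    have uu2: "?h u u' \<le> 2 * R"
      using hyp_dist_triangle[OF U1(1) m(1)[of n] U1(2)] u(2) u'(2) by (simp add: hyp_dist_commute[of u "m n"])
    have "?h u u' - l \<le> ?h (f n u) (f n u')" unfolding l_def
    proof (rule local_rigidity[OF U1, of "4 * R + ln (4 * real d)"])
      show "2 * hyp_dist u u' + ln (4 * real d) \<le> 4 * R + ln (4 * real d)" using uu2 by simp
      fix c assume c: "cmod c < 1" "deriv (f n) c = 0"
      hence "B < ?h (m n) c" using elim(1) by blast
      thus "4 * R + ln (4 * real d) \<le> ?h u c"
        using hyp_dist_triangle[OF m(1)[of n] U1(1) c(1)] u(2) by (simp add: B_def)
    qed
    hence far: "2 * R - l \<le> ?h (f n u) (f n u')" using uu by linarith
    have W: "cmod (ws n j) < 1" using ws(1)[OF jd] .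
    have mws: "?h (m n) (ws n j) \<le> e j n / 2 + 6"
      using hyp_dist_four_point[OF m(1)[of n] W vn[of n] wn[of n]] mv mw elim(3)
      by (simp add: dst_commute[of m _ v] hyp_dist_commute[of "ws n j"] e_def D_def max_def split: if_splits)
    have u'ws: "?h u' (ws n j) \<le> e j n / 2 - R + 12"
      using hyp_dist_four_point[OF U1(2) W m(1)[of n] wn[of n]] u'(2,3) mws mw elim(4)
      by (simp add: hyp_dist_commute[of u' "m n"] hyp_dist_commute[of "ws n j"] D_def max_def split: if_splits)
    have a: "?h (f n u') (f n (v n)) \<le> e j n / 2 - R + 12"
      using lip[OF U1(2) W] u'ws ws(2)[OF jd] by simp
    have b: "?h (f n u) (f n (v n)) \<le> e j n / 2 - R"
      using lip[OF U1(1) vn[of n]] u(3) mv by (simp add: dst_commute[of m])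
    have c: "?h (f n u) (f n (m n)) \<le> R" "?h (f n u') (f n (m n)) \<le> R"
      using lip[OF U1(1) m(1)[of n]] lip[OF U1(2) m(1)[of n]] u(2) u'(2)
      by (simp_all add: hyp_dist_commute[of _ "m n"] order_trans)
    \<comment> \<open>u is R closer to v than m is, and u' is about R closer to the other preimage
      of f v. Both images therefore lie about R from f m on the way to f v and must be close
      together, while rigidity keeps them about 2 * R apart.\<close>
    have "?h (f n u) (f n u') + ?h (f n (m n)) (f n (v n))
      \<le> max (?h (f n u) (f n (m n)) + ?h (f n u') (f n (v n))) (?h (f n u) (f n (v n)) + ?h (f n u') (f n (m n))) + 6"
      by (rule hyp_dist_four_point) (use F1 U1 m(1) vn in auto)
    also have "\<dots> \<le> e j n / 2 + 18" using a b c by (simp add: max_def)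
    finally show False using far elim(2) Cm0 l0 by (simp add: R_def)
  qed
  thus False by (rule ev_False)
qed

text \<open>For each n one of the d preimages is within bounded distance of \<open>x n\<close>, and
  the ultrafilter fixes its index. So at most d classes of \<open>near\<close> are mapped to that of
  y.\<close>

lemma finite_preimages:
  assumes y: "y \<in> pts"
  shows "\<exists>B. finite B \<and> B \<subseteq> pts \<and> (\<forall>x\<in>pts. near (ap x) y \<longrightarrow> (\<exists>b\<in>B. near x b))"
proof (cases "\<exists>x0\<in>pts. near (ap x0) y")
  case True
  then obtain v where v: "v \<in> pts" "near (ap v) y" by blast
  define l where "l = ln (2 * real d)"
  have vn: "cmod (v n) < 1" for n using v by (auto simp: pts_def)
  have "\<exists>ws. (\<forall>j<d. cmod (ws j) < 1) \<and>
     (\<forall>z. cmod z < 1 \<longrightarrow> (\<exists>j<d. hyp_dist z (ws j) - l \<le> hyp_dist (f n z) (f n (v n))))" for n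
    by (rule blaschke_preimages[OF f d vn, of n n]) (metis l_def)
  then obtain ws where ws: "\<And>n j. j < d \<Longrightarrow> cmod (ws n j) < 1"
    and ex: "\<And>n z. cmod z < 1 \<Longrightarrow> \<exists>j<d. hyp_dist z (ws n j) - l \<le> hyp_dist (f n z) (f n (v n))"
    by metis
  have "\<exists>b\<in>(\<lambda>j n. ws n j) ` {..<d}. near x b" if x: "x \<in> pts" "near (ap x) y" for x
  proof -
    have "near (ap x) (ap v)" using near_trans[OF x(2) near_sym[OF v(2)]] x v y ap_pts by blast
    then obtain C where C: "\<forall>\<^sub>F n in U. dst (ap x) (ap v) n \<le> C" by (auto simp: near_def bdd_def)
    have "\<forall>\<^sub>F n in U. \<exists>j\<in>{..<d}. hyp_dist (x n) (ws n j) \<le> C + l"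
      using C
    proof eventually_elim
      case (elim n)
      thus ?case using ex[of "x n" n] x(1) by (force simp: pts_def ap_def)
    qed
    from ev_ex_finite[OF _ this] obtain j where "j < d" "\<forall>\<^sub>F n in U. hyp_dist (x n) (ws n j) \<le> C + l" by auto
    hence "near x (\<lambda>n. ws n j)" by (auto simp: near_def bdd_def)
    thus ?thesis using \<open>j < d\<close> by auto
  qed
  thus ?thesis using ws by (intro exI[of _ "(\<lambda>j n. ws n j) ` {..<d}"]) (auto simp: pts_def)
next
  case False
  thus ?thesis by (intro exI[of _ "{}"]) auto
qed

end

subsection \<open>Trees and the invariant vertex set\<close>

text \<open>The properties of \<open>btw\<close> on a finite set of representatives, where
  \<open>near\<close> becomes equality. \<open>Bt_med\<close> rules out cycles: without its centre,
  the three ends of a tripod would be pairwise adjacent.\<close>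

locale finite_betweenness =
  fixes S :: "'a set" and Bt :: "'a \<Rightarrow> 'a \<Rightarrow> 'a \<Rightarrow> bool"
  assumes fin: "finite S" and ne: "S \<noteq> {}"
    and Bt_left: "\<And>x y. x \<in> S \<Longrightarrow> y \<in> S \<Longrightarrow> Bt x x y"
    and Bt_sym: "\<And>x y z. x \<in> S \<Longrightarrow> y \<in> S \<Longrightarrow> z \<in> S \<Longrightarrow> Bt x y z \<Longrightarrow> Bt z y x"
    and Bt_trans: "\<And>x y z w. x \<in> S \<Longrightarrow> y \<in> S \<Longrightarrow> z \<in> S \<Longrightarrow> w \<in> S \<Longrightarrow>
      Bt x y z \<Longrightarrow> Bt x z w \<Longrightarrow> Bt x y w \<and> Bt y z w"
    and Bt_antisym: "\<And>x y z. x \<in> S \<Longrightarrow> y \<in> S \<Longrightarrow> z \<in> S \<Longrightarrow> Bt x y z \<Longrightarrow> Bt x z y \<Longrightarrow> y = z"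
    and Bt_linear: "\<And>x y z w. x \<in> S \<Longrightarrow> y \<in> S \<Longrightarrow> z \<in> S \<Longrightarrow> w \<in> S \<Longrightarrow>
      Bt x y z \<Longrightarrow> Bt x w z \<Longrightarrow> Bt x y w \<or> Bt x w y"
    and Bt_extend: "\<And>x y z w. x \<in> S \<Longrightarrow> y \<in> S \<Longrightarrow> z \<in> S \<Longrightarrow> w \<in> S \<Longrightarrow>
      Bt x y z \<Longrightarrow> Bt y z w \<Longrightarrow> y \<noteq> z \<Longrightarrow> Bt x y w"
    and Bt_med: "\<And>x y z. x \<in> S \<Longrightarrow> y \<in> S \<Longrightarrow> z \<in> S \<Longrightarrow> \<exists>m\<in>S. Bt x m y \<and> Bt y m z \<and> Bt x m z"
begin

definition adj :: "'a \<Rightarrow> 'a \<Rightarrow> bool" where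
  "adj u v \<longleftrightarrow> u \<in> S \<and> v \<in> S \<and> u \<noteq> v \<and> (\<forall>w\<in>S. Bt u w v \<longrightarrow> w = u \<or> w = v)"

lemma Bt_right: "x \<in> S \<Longrightarrow> y \<in> S \<Longrightarrow> Bt x y y"
  using Bt_left Bt_sym by blast

lemma adj_sym: "adj u v \<Longrightarrow> adj v u"
  unfolding adj_def using Bt_sym by blast

text \<open>The median of x, y, z lies on both edges and is thus their common end y.\<close>

lemma adj_turn:
  assumes "adj x y" "adj y z" "x \<noteq> z"
  shows "Bt x y z"
proof -
  have S: "x \<in> S" "y \<in> S" "z \<in> S" using assms by (auto simp: adj_def)
  obtain m where m: "m \<in> S" "Bt x m y" "Bt y m z" "Bt x m z" using Bt_med S by blast
  have "m = x \<or> m = y" "m = y \<or> m = z" using assms m by (auto simp: adj_def)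
  thus ?thesis using m assms(3) by blast
qed

text \<open>A path without backtracking runs along a segment: each turn is straight by
  \<open>adj_turn\<close>, and \<open>Bt_extend\<close> joins the turns.\<close>

lemma path_second_between:
  assumes "successively adj (x # y # zs)" "distinct (x # y # zs)"
  shows "Bt x y (last (y # zs))"
  using assms
proof (induction zs arbitrary: x y)
  case Nil
  thus ?case by (auto simp: adj_def intro: Bt_right)
next
  case (Cons z zs)
  have IH: "Bt y z (last (z # zs))" using Cons.IH[of y z] Cons.prems by auto
  have a: "adj x y" "adj y z" "x \<noteq> z" "y \<noteq> z" using Cons.prems by auto
  have "set (y # z # zs) \<subseteq> S"
  proof -
    have "set ws \<subseteq> S" if "successively adj (w # ws)" for w ws
      using that by (induction ws arbitrary: w) (auto simp: adj_def)
    thus ?thesis using Cons.prems(1) by blast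
  qed
  hence "last (z # zs) \<in> S" using last_in_set[of "z # zs"] by auto
  thus ?case using Bt_extend[of x y z "last (z # zs)"] adj_turn[OF a(1-3)] IH a by (auto simp: adj_def)
qed

text \<open>The second vertices of both paths lie on the segment from x to the common end and are
  therefore comparable. Both are adjacent to x, so neither lies strictly before the other.\<close>

lemma path_unique:
  assumes "successively adj xs" "distinct xs" "xs \<noteq> []" "successively adj ys" "distinct ys" "ys \<noteq> []"
    "hd xs = hd ys" "last xs = last ys" "hd xs \<in> S" "last xs \<in> S"
  shows "xs = ys"
  using assms
proof (induction xs arbitrary: ys)
  case (Cons x xs)
  obtain ys' where ys: "ys = x # ys'" using Cons.prems by (cases ys) auto
  show ?case
  proof (cases xs)
    case Nil
    hence "last ys = x" using Cons.prems by simp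
    hence "ys' = []" using Cons.prems(5) ys by (metis distinct.simps(2) last.simps last_in_set)
    thus ?thesis using Nil ys by simp
  next
    case (Cons x1 xs1)
    note xs = this
    have "last ys = last xs" using Cons.prems xs by simp
    hence "ys' \<noteq> []" using Cons.prems(2) ys xs
      by (metis distinct.simps(2) last.simps last_in_set list.distinct(1))
    then obtain y1 ys1 where ys': "ys' = y1 # ys1" by (cases ys') auto
    have S: "x \<in> S" "x1 \<in> S" "y1 \<in> S" "last xs \<in> S" using Cons.prems ys ys' xs by (auto simp: adj_def)
    have b1: "Bt x x1 (last xs)" using path_second_between[of x x1 xs1] Cons.prems xs by auto
    have b2: "Bt x y1 (last xs)"
      using path_second_between[of x y1 ys1] Cons.prems ys ys' \<open>last ys = last xs\<close> by auto
    have "adj x x1" "adj x y1" using Cons.prems xs ys ys' by auto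
    moreover from Bt_linear[OF S(1,2,4,3) b1 b2] have "Bt x x1 y1 \<or> Bt x y1 x1" .
    ultimately have "x1 = y1" using S by (auto simp: adj_def)
    hence "xs = ys'" using Cons.IH[of ys'] Cons.prems xs ys ys' S by auto
    thus ?thesis using ys by simp
  qed
qed simp

text \<open>The number of points of S between u and x replaces the distance: a minimiser on the
  segment towards v is a neighbour of u.\<close>

lemma first_step:
  assumes "u \<in> S" "v \<in> S" "u \<noteq> v"
  obtains x where "adj u x" "Bt u x v"
proof -
  define Q where "Q x \<longleftrightarrow> x \<in> S \<and> x \<noteq> u \<and> Bt u x v" for x
  have "Q v" using assms Bt_right by (auto simp: Q_def)
  then obtain x where x: "Q x" "\<And>y. Q y \<Longrightarrow> card {w\<in>S. Bt u w x} \<le> card {w\<in>S. Bt u w y}"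
    using ex_has_least_nat[of Q v "\<lambda>x. card {w\<in>S. Bt u w x}"] by blast
  have "adj u x" unfolding adj_def
  proof (intro conjI ballI impI)
    fix w assume w: "w \<in> S" "Bt u w x"
    show "w = u \<or> w = x"
    proof (rule ccontr)
      assume n: "\<not> (w = u \<or> w = x)"
      have xS: "x \<in> S" "Bt u x v" using x(1) by (auto simp: Q_def)
      have "Q w" using n w Bt_trans[OF assms(1) w(1) xS(1) assms(2) w(2) xS(2)] by (auto simp: Q_def)
      have "{y\<in>S. Bt u y w} \<subset> {y\<in>S. Bt u y x}"
      proof
        show "{y\<in>S. Bt u y w} \<subseteq> {y\<in>S. Bt u y x}" using Bt_trans assms w xS by blast
        have "\<not> Bt u x w" using Bt_antisym[of u w x] n w xS assms by blast
        thus "{y\<in>S. Bt u y w} \<noteq> {y\<in>S. Bt u y x}" using xS assms Bt_right by blast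
      qed
      hence "card {y\<in>S. Bt u y w} < card {y\<in>S. Bt u y x}" using fin by (intro psubset_card_mono) auto
      thus False using x(2)[OF \<open>Q w\<close>] by simp
    qed
  qed (use x(1) assms in \<open>auto simp: Q_def\<close>)
  thus thesis using that x(1) by (auto simp: Q_def)
qed

text \<open>The clause on \<open>set xs\<close> carries the induction: the rest of the path lies
  between x and v, where u does not occur again.\<close>

lemma path_exists:
  assumes "u \<in> S" "v \<in> S"
  shows "\<exists>xs. xs \<noteq> [] \<and> hd xs = u \<and> last xs = v \<and> distinct xs \<and> successively adj xs \<and>
    set xs \<subseteq> {w\<in>S. Bt u w v}"
  using assms
proof (induction "card {w\<in>S. Bt u w v}" arbitrary: u rule: less_induct)
  case less
  show ?case
  proof (cases "u = v")
    case True
    thus ?thesis using less.prems Bt_left by (intro exI[of _ "[u]"]) auto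
  next
    case False
    obtain x where x: "adj u x" "Bt u x v" using first_step[OF less.prems False] .
    have xS: "x \<in> S" "u \<noteq> x" using x by (auto simp: adj_def)
    have sub: "{w\<in>S. Bt x w v} \<subseteq> {w\<in>S. Bt u w v}"
      using Bt_trans[of v _ x u] Bt_sym x less.prems xS by blast
    have nu: "\<not> Bt x u v" using Bt_antisym[of v u x] Bt_sym x less.prems xS by blast
    hence "{w\<in>S. Bt x w v} \<subset> {w\<in>S. Bt u w v}" using sub less.prems Bt_left by blast
    hence "card {w\<in>S. Bt x w v} < card {w\<in>S. Bt u w v}" using fin by (intro psubset_card_mono) auto
    from less.hyps[OF this xS(1) less.prems(2)] obtain xs where xs: "xs \<noteq> []" "hd xs = x" "last xs = v"
      "distinct xs" "successively adj xs" "set xs \<subseteq> {w\<in>S. Bt x w v}" by blast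
    have "u \<notin> set xs" using xs nu by auto
    moreover have "successively adj (u # xs)" using xs x by (cases xs) auto
    moreover have "Bt u u v" using Bt_left less.prems by blast
    ultimately show ?thesis using xs sub less.prems by (intro exI[of _ "u # xs"]) auto
  qed
qed

lemma finite_tree_adj:
  assumes "verts T = S" "edges T = {{u, v} |u v. adj u v}"
  shows "finite_tree T"
proof -
  have e: "{x, y} \<in> edges T \<longleftrightarrow> adj x y" for x y
    using assms(2) adj_sym by (auto simp: doubleton_eq_iff)
  have sp: "simple_path_between T u v xs \<longleftrightarrow>
     xs \<noteq> [] \<and> hd xs = u \<and> last xs = v \<and> distinct xs \<and> set xs \<subseteq> S \<and> successively adj xs" for u v xs
    by (simp add: simple_path_between_def e assms(1))
  have "\<exists>!xs. simple_path_between T u v xs" if "u \<in> S" "v \<in> S" for u v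
    unfolding sp
  proof (intro ex_ex1I)
    fix xs ys
    assume "xs \<noteq> [] \<and> hd xs = u \<and> last xs = v \<and> distinct xs \<and> set xs \<subseteq> S \<and> successively adj xs"
      "ys \<noteq> [] \<and> hd ys = u \<and> last ys = v \<and> distinct ys \<and> set ys \<subseteq> S \<and> successively adj ys"
    thus "xs = ys" using that by (intro path_unique) simp_all
  qed (use path_exists[OF that] in blast)
  thus ?thesis unfolding finite_tree_def using fin ne assms by (auto simp: adj_def)
qed

end

section \<open>Nearest points and systems of representatives in the asymptotic tree\<close>

context asymptotic_tree
begin

lemma btw_trans2:
  assumes "btw x y z" "btw y u z" and pt: "x \<in> pts" "y \<in> pts" "z \<in> pts" "u \<in> pts"
  shows "btw x u z" "btw x y u"
  using btw_trans[OF btw_sym[OF assms(2)] btw_sym[OF assms(1)] pt(3,4,2,1)] btw_sym by blast+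

text \<open>A point that is no further from both ends than x is cannot branch off the segment, nor
  be displaced along it. One four-point inequality expresses this.\<close>

lemma near_by_dist:
  assumes "btw v x w" "bdd (\<lambda>n. dst y v n - dst x v n)" "bdd (\<lambda>n. dst y w n - dst x w n)"
    and pt: "v \<in> pts" "x \<in> pts" "w \<in> pts" "y \<in> pts"
  shows "near y x"
proof -
  from assms obtain A B C where "\<forall>\<^sub>F n in U. dst v x n + dst x w n - dst v w n \<le> A"
    "\<forall>\<^sub>F n in U. dst y v n - dst x v n \<le> B" "\<forall>\<^sub>F n in U. dst y w n - dst x w n \<le> C"
    by (auto simp: btw_def bdd_def)
  hence "\<forall>\<^sub>F n in U. dst y x n \<le> A + max B C + 6"
  proof eventually_elim
    case (elim n)
    thus ?case using four_point[OF pt(4,2,1,3), of n]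
      by (simp add: dst_commute[of v _ x] max_def split: if_splits)
  qed
  thus ?thesis by (auto simp: near_def bdd_def)
qed

text \<open>Finitely many classes of \<open>near\<close>. The representatives come from
  \<open>pts\<close> and may lie outside A, so the property passes to subsets;
  \<open>near_reps\<close> later moves them inside.\<close>

definition fin_near :: "(nat \<Rightarrow> complex) set \<Rightarrow> bool" where
  "fin_near A \<longleftrightarrow> (\<exists>B. finite B \<and> B \<subseteq> pts \<and> (\<forall>x\<in>A. \<exists>b\<in>B. near x b))"

definition near_closed :: "(nat \<Rightarrow> complex) set \<Rightarrow> bool" where
  "near_closed A \<longleftrightarrow> A \<subseteq> pts \<and> (\<forall>x\<in>A. \<forall>y\<in>pts. near x y \<longrightarrow> y \<in> A)"

text \<open>The last point of A before x on the way from p. The number of points of A still ahead is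
  minimised, since distances are meaningful only up to bounded errors. Points near x itself cannot
  be excluded.\<close>

lemma closest:
  assumes A: "finite A" "A \<subseteq> pts" and p: "p \<in> A" and x: "x \<in> pts"
  obtains p' where "p' \<in> A" "btw p p' x" "\<And>a. a \<in> A \<Longrightarrow> btw p' a x \<Longrightarrow> near a p' \<or> near a x"
proof -
  define Q where "Q y \<longleftrightarrow> y \<in> A \<and> btw p y x" for y
  have "Q p" using p by (simp add: Q_def)
  then obtain y where y: "Q y" "\<And>z. Q z \<Longrightarrow> card {a\<in>A. btw y a x} \<le> card {a\<in>A. btw z a x}"
    using ex_has_least_nat[of Q p "\<lambda>y. card {a\<in>A. btw y a x}"] by blast
  have yA: "y \<in> A" "btw p y x" using y by (auto simp: Q_def)
  have pt: "p \<in> pts" "y \<in> pts" using A p yA by auto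
  have "near a y \<or> near a x" if a: "a \<in> A" "btw y a x" for a
  proof (rule ccontr)
    assume n: "\<not> (near a y \<or> near a x)"
    have ap: "a \<in> pts" using a A by blast
    have "Q a" using btw_trans2(1)[OF yA(2) a(2) pt x ap] a by (simp add: Q_def)
    have "{b\<in>A. btw a b x} \<subset> {b\<in>A. btw y b x}"
    proof
      show "{b\<in>A. btw a b x} \<subseteq> {b\<in>A. btw y b x}"
        using btw_trans2(1)[OF a(2) _ pt(2) ap x] A(2) by blast
      have "\<not> btw a y x"
      proof
        assume "btw a y x"
        hence "near a y" using btw_antisym[of x a y] btw_sym a(2) ap pt by blast
        thus False using n by blast
      qed
      moreover have "y \<in> {b\<in>A. btw y b x}" using yA(1) by simp
      ultimately show "{b\<in>A. btw a b x} \<noteq> {b\<in>A. btw y b x}" by blast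
    qed
    hence "card {b\<in>A. btw a b x} < card {b\<in>A. btw y b x}" using A(1) by (intro psubset_card_mono) auto
    thus False using y(2)[OF \<open>Q a\<close>] by simp
  qed
  thus thesis using that yA by blast
qed

lemma gap_between:
  assumes "btw p x q" "btw p p' x" "btw q q' x"
    and pt: "p \<in> pts" "x \<in> pts" "q \<in> pts" "p' \<in> pts" "q' \<in> pts"
  shows "btw p' x q'"
proof -
  have "btw p' x q" using btw_trans(2)[OF assms(2,1) pt(1,4,2,3)] .
  hence "btw q x p'" by (rule btw_sym)
  hence "btw q' x p'" using btw_trans(2)[OF assms(3) _ pt(3,5,2,4)] by blast
  thus ?thesis by (rule btw_sym)
qed

text \<open>By linearity a lies either between p and x or between x and q, and each half contains
  nothing else by choice of the nearest points.\<close>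

lemma gap_empty:
  assumes "btw p x q" "a \<in> pts" "btw p a q"
    and "btw p a x \<Longrightarrow> near a p \<or> near a x" "btw q a x \<Longrightarrow> near a q \<or> near a x"
    and pt: "p \<in> pts" "x \<in> pts" "q \<in> pts"
  shows "near a p \<or> near a q \<or> near a x"
proof -
  from btw_linear[OF assms(3,1) pt(1) assms(2) pt(3,2)] show ?thesis
  proof
    assume "btw p x a"
    hence "btw x a q" using btw_trans(2)[OF _ assms(3) pt(1,2) assms(2) pt(3)] by blast
    thus ?thesis using assms(5) btw_sym by blast
  qed (use assms(4) in blast)
qed

text \<open>Two points of V are near each other exactly if they are near the same elements of the
  finite set B. There are finitely many such signatures, and one element of V is chosen for
  each.\<close>

lemma near_reps:
  assumes V: "near_closed V" "fin_near V"
  obtains R where "finite R" "R \<subseteq> V" "\<And>x. x \<in> V \<Longrightarrow> \<exists>r\<in>R. near x r"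
    "\<And>r s. r \<in> R \<Longrightarrow> s \<in> R \<Longrightarrow> near r s \<Longrightarrow> r = s"
proof -
  obtain B where B: "finite B" "B \<subseteq> pts" "\<And>x. x \<in> V \<Longrightarrow> \<exists>b\<in>B. near x b"
    using V(2) by (auto simp: fin_near_def)
  have Vp: "V \<subseteq> pts" using V(1) by (simp add: near_closed_def)
  define sig where "sig x = {b\<in>B. near x b}" for x
  have sn: "sig x = sig y \<longleftrightarrow> near x y" if xy: "x \<in> V" "y \<in> V" for x y
  proof
    assume s: "sig x = sig y"
    obtain b where b: "b \<in> B" "near x b" using B(3)[OF xy(1)] by blast
    hence "near y b" using s by (auto simp: sig_def)
    thus "near x y" using near_trans[OF b(2) near_sym, of y] xy Vp B(2) b(1) by blast
  next
    assume n: "near x y"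
    have pt: "x \<in> pts" "y \<in> pts" using xy Vp by auto
    have "near x b \<longleftrightarrow> near y b" if "b \<in> B" for b
      using near_trans[OF n, of b] near_trans[OF near_sym[OF n], of b] pt that B(2) by blast
    thus "sig x = sig y" unfolding sig_def by blast
  qed
  define g where "g I = (SOME x. x \<in> V \<and> sig x = I)" for I
  have g: "g (sig x) \<in> V \<and> sig (g (sig x)) = sig x" if "x \<in> V" for x
    unfolding g_def by (rule someI[of _ x]) (use that in simp)
  have "finite (sig ` V)" by (rule finite_subset[of _ "Pow B"]) (use B in \<open>auto simp: sig_def\<close>)
  show thesis
  proof (rule that[of "g ` sig ` V"])
    show "finite (g ` sig ` V)" using \<open>finite (sig ` V)\<close> by simp
    show "g ` sig ` V \<subseteq> V" using g by auto
    show "\<exists>r\<in>g ` sig ` V. near x r" if "x \<in> V" for x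
      using g[OF that] sn[OF that, of "g (sig x)"] that by auto
    show "r = s" if "r \<in> g ` sig ` V" "s \<in> g ` sig ` V" "near r s" for r s
    proof -
      obtain x y where "x \<in> V" "y \<in> V" "r = g (sig x)" "s = g (sig y)" using \<open>r \<in> _\<close> \<open>s \<in> _\<close> by blast
      thus ?thesis using g[of x] g[of y] sn[of r s] that by metis
    qed
  qed
qed

end

section \<open>The hull of the postcritical set and its finite invariant vertex set\<close>

text \<open>\<open>P\<close> consists of \<open>0\<close> and the orbits of the critical points.\<close>

locale pcf_sequence = blaschke_sequence +
  fixes P :: "(nat \<Rightarrow> complex) set"
  assumes finP: "finite P" and Ppts: "P \<subseteq> pts" and P0: "(\<lambda>_. 0) \<in> P"
    and Pinv: "\<And>x. x \<in> P \<Longrightarrow> \<exists>y\<in>P. near (ap x) y"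
    and Pcrit: "\<And>m. m \<in> pts \<Longrightarrow> (\<And>p. p \<in> P \<Longrightarrow> \<not> near m p) \<Longrightarrow> noncrit m"
begin

lemma isometric:
  assumes pt: "v \<in> pts" "w \<in> pts"
    and gap: "\<And>p. p \<in> P \<Longrightarrow> btw v p w \<Longrightarrow> near p v \<or> near p w"
  shows "bdd (\<lambda>n. dst v w n - dst (ap v) (ap w) n)"
proof (rule isometric_off_critical[OF pt], rule Pcrit)
  fix m p assume m: "m \<in> pts" "btw v m w" "\<not> near m v" "\<not> near m w" and p: "p \<in> P"
  have pp: "p \<in> pts" using p Ppts by blast
  show "\<not> near m p"
  proof
    assume mp: "near m p"
    hence "btw v p w" using btw_near[OF m(2) near_refl mp near_refl] pt m(1) pp by blast
    thus False using gap[OF p] near_trans[OF mp] m pt pp by blast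
  qed
qed

text \<open>Both halves are contracted, so the defect of the images is at most the old defect plus
  the loss of length on the whole segment.\<close>

lemma ap_btw:
  assumes "bdd (\<lambda>n. dst v w n - dst (ap v) (ap w) n)" "btw v x w" and pt: "v \<in> pts" "x \<in> pts" "w \<in> pts"
  shows "btw (ap v) (ap x) (ap w)"
  unfolding btw_def
  by (rule bdd_le2[OF assms(1) assms(2)[unfolded btw_def], of _ 0])
     (use ap_contract[OF pt(1,2)] ap_contract[OF pt(2,3)] in \<open>smt (verit)\<close>)

lemma funpow_pts: "x \<in> pts \<Longrightarrow> (ap ^^ k) x \<in> pts"
  by (induction k) (auto intro: ap_pts)

lemma funpow_near: "near x y \<Longrightarrow> x \<in> pts \<Longrightarrow> y \<in> pts \<Longrightarrow> near ((ap ^^ k) x) ((ap ^^ k) y)"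
  by (induction k) (auto intro: ap_near funpow_pts)

lemma funpow_contract: "x \<in> pts \<Longrightarrow> y \<in> pts \<Longrightarrow> dst ((ap ^^ k) x) ((ap ^^ k) y) n \<le> dst x y n"
proof (induction k)
  case (Suc k)
  thus ?case using ap_contract[OF funpow_pts[of x k] funpow_pts[of y k], of n] by simp
qed simp

text \<open>\<open>H\<close> is the convex hull of \<open>P\<close>, \<open>V0\<close> adds its branch points to \<open>P\<close>, and \<open>V\<close> adds all points of
  \<open>H\<close> that some iterate maps into \<open>V0\<close>, so that no edge between points of \<open>V\<close> has a point of \<open>V\<close>
  inside its image.\<close>

definition V0 :: "(nat \<Rightarrow> complex) set" where
  "V0 = {m. \<exists>a\<in>P. \<exists>b\<in>P. \<exists>c\<in>P. med a b c m}"

definition H :: "(nat \<Rightarrow> complex) set" where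
  "H = {x \<in> pts. \<exists>p\<in>P. \<exists>q\<in>P. btw p x q}"

definition V :: "(nat \<Rightarrow> complex) set" where
  "V = {x \<in> H. \<exists>k. (ap ^^ k) x \<in> V0}"

text \<open>A point of P is the median of itself taken three times.\<close>

lemma P_V0: "P \<subseteq> V0"
  using Ppts by (force simp: V0_def med_def)

lemma V0_pts: "V0 \<subseteq> pts"
  by (auto simp: V0_def med_def)

lemma V0_H: "V0 \<subseteq> H"
  by (auto simp: V0_def H_def med_def)

lemma H_pts: "H \<subseteq> pts"
  by (auto simp: H_def)

lemma V0_near_closed: "near_closed V0"
  unfolding near_closed_def
proof (intro conjI ballI impI V0_pts)
  fix x y assume x: "x \<in> V0" "y \<in> pts" "near x y"
  then obtain a b c where abc: "a \<in> P" "b \<in> P" "c \<in> P" "med a b c x" by (auto simp: V0_def)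
  moreover have "a \<in> pts" "b \<in> pts" "c \<in> pts" using abc Ppts by auto
  ultimately have "med a b c y" unfolding med_def using x btw_near[OF _ near_refl x(3) near_refl] by blast
  thus "y \<in> V0" using abc by (auto simp: V0_def)
qed

lemma H_near_closed: "near_closed H"
  unfolding near_closed_def
proof (intro conjI ballI impI H_pts)
  fix x y assume x: "x \<in> H" "y \<in> pts" "near x y"
  then obtain p q where "p \<in> P" "q \<in> P" "btw p x q" "x \<in> pts" by (auto simp: H_def)
  moreover have "btw p y q" using btw_near[OF _ near_refl x(3) near_refl] calculation Ppts x(2) by blast
  ultimately show "y \<in> H" using x by (auto simp: H_def)
qed

lemma V0_nearD: "x \<in> V0 \<Longrightarrow> near x y \<Longrightarrow> y \<in> pts \<Longrightarrow> y \<in> V0"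
  using V0_near_closed by (auto simp: near_closed_def)

lemma H_nearD: "x \<in> H \<Longrightarrow> near x y \<Longrightarrow> y \<in> pts \<Longrightarrow> y \<in> H"
  using H_near_closed by (auto simp: near_closed_def)

lemma ap_P_V0:
  assumes "p \<in> P" "near m p" "m \<in> pts"
  shows "ap m \<in> V0"
proof -
  obtain y where y: "y \<in> P" "near (ap p) y" using Pinv assms by blast
  have pt: "p \<in> pts" "y \<in> pts" using y assms Ppts by auto
  have "near (ap m) (ap p)" using ap_near assms pt by blast
  hence "near (ap m) y" using near_trans y pt ap_pts assms by blast
  thus ?thesis using V0_nearD[of y "ap m"] P_V0 y near_sym ap_pts assms by blast
qed

lemma V0_reps:
  "\<exists>M. finite M \<and> M \<subseteq> V0 \<and> (\<forall>x\<in>V0. \<exists>r\<in>M. near x r)"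
proof -
  define g where "g = (\<lambda>(a, b, c). SOME m. med a b c m)"
  have g: "med a b c (g (a, b, c))" if "a \<in> P" "b \<in> P" "c \<in> P" for a b c
  proof -
    have "\<exists>m. med a b c m" using med_exists[of a b c] that Ppts by blast
    hence "med a b c (SOME m. med a b c m)" by (rule someI_ex)
    thus ?thesis by (simp add: g_def)
  qed
  show ?thesis
  proof (intro exI[of _ "g ` (P \<times> P \<times> P)"] conjI ballI)
    show "finite (g ` (P \<times> P \<times> P))" using finP by simp
    show "g ` (P \<times> P \<times> P) \<subseteq> V0"
    proof
      fix m assume "m \<in> g ` (P \<times> P \<times> P)"
      then obtain a b c where "a \<in> P" "b \<in> P" "c \<in> P" "m = g (a, b, c)" by blast
      thus "m \<in> V0" unfolding V0_def using g by blast
    qed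
    fix x assume "x \<in> V0"
    then obtain a b c where "a \<in> P" "b \<in> P" "c \<in> P" "med a b c x" by (auto simp: V0_def)
    moreover have "near x (g (a, b, c))" using med_unique[OF _ g] calculation Ppts by blast
    ultimately show "\<exists>r\<in>g ` (P \<times> P \<times> P). near x r" by blast
  qed
qed

text \<open>\<open>p'\<close> and \<open>q'\<close> are the points of \<open>P\<close> next to \<open>x\<close> on either side.\<close>

lemma nearest_P_image:
  assumes "btw p' x q'" "p' \<in> P" "q' \<in> P" "x \<in> pts" "\<And>p. p \<in> P \<Longrightarrow> \<not> near x p"
    "\<And>a. a \<in> P \<Longrightarrow> btw p' a x \<Longrightarrow> near a p' \<or> near a x"
    "\<And>a. a \<in> P \<Longrightarrow> btw q' a x \<Longrightarrow> near a q' \<or> near a x"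
  shows "btw (ap p') (ap x) (ap q')"
proof (rule ap_btw)
  have pt: "p' \<in> pts" "q' \<in> pts" using assms Ppts by auto
  show "bdd (\<lambda>n. dst p' q' n - dst (ap p') (ap q') n)"
  proof (rule isometric[OF pt])
    fix p assume p: "p \<in> P" "btw p' p q'"
    have "near p p' \<or> near p q' \<or> near p x"
      by (rule gap_empty[OF assms(1)]) (use p pt assms Ppts in auto)
    thus "near p p' \<or> near p q'" using assms(5)[OF p(1)] near_sym by blast
  qed
qed (use assms Ppts in auto)

text \<open>Away from P, the ends of the tripod with centre m are replaced by the points of P next
  to m. No point of P then lies inside its three sides, so f is isometric on them and maps the
  tripod to one with centre f m whose ends are near P.\<close>

lemma ap_V0:
  assumes "m \<in> V0"
  shows "ap m \<in> V0"
proof (cases "\<exists>p\<in>P. near m p")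
  case True
  thus ?thesis using ap_P_V0 assms V0_pts by blast
next
  case False
  hence nP: "\<And>p. p \<in> P \<Longrightarrow> \<not> near m p" by blast
  obtain a b c where abc: "a \<in> P" "b \<in> P" "c \<in> P" and med: "btw a m b" "btw b m c" "btw a m c"
    and mp: "m \<in> pts" using assms by (auto simp: V0_def med_def)
  note cl = closest[OF finP Ppts _ mp]
  obtain a' where a': "a' \<in> P" "btw a a' m" "\<And>u. u \<in> P \<Longrightarrow> btw a' u m \<Longrightarrow> near u a' \<or> near u m"
    using cl[OF abc(1)] by blast
  obtain b' where b': "b' \<in> P" "btw b b' m" "\<And>u. u \<in> P \<Longrightarrow> btw b' u m \<Longrightarrow> near u b' \<or> near u m"
    using cl[OF abc(2)] by blast
  obtain c' where c': "c' \<in> P" "btw c c' m" "\<And>u. u \<in> P \<Longrightarrow> btw c' u m \<Longrightarrow> near u c' \<or> near u m"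
    using cl[OF abc(3)] by blast
  have pt: "a \<in> pts" "b \<in> pts" "c \<in> pts" "a' \<in> pts" "b' \<in> pts" "c' \<in> pts"
    using abc a' b' c' Ppts by auto
  have "btw a' m b'" "btw b' m c'" "btw a' m c'"
    using gap_between[OF med(1) a'(2) b'(2)] gap_between[OF med(2) b'(2) c'(2)]
      gap_between[OF med(3) a'(2) c'(2)] pt mp by blast+
  hence i: "btw (ap a') (ap m) (ap b')" "btw (ap b') (ap m) (ap c')" "btw (ap a') (ap m) (ap c')"
    using nearest_P_image a'(1,3) b'(1,3) c'(1,3) mp nP by blast+
  obtain y1 where y1: "y1 \<in> P" "near (ap a') y1" using Pinv[OF a'(1)] by blast
  obtain y2 where y2: "y2 \<in> P" "near (ap b') y2" using Pinv[OF b'(1)] by blast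
  obtain y3 where y3: "y3 \<in> P" "near (ap c') y3" using Pinv[OF c'(1)] by blast
  note y = y1 y2 y3
  have yp: "y1 \<in> pts" "y2 \<in> pts" "y3 \<in> pts" using y Ppts by auto
  have "med y1 y2 y3 (ap m)" unfolding med_def
    using btw_near[OF i(1) y(2) near_refl y(4)] btw_near[OF i(2) y(4) near_refl y(6)]
      btw_near[OF i(3) y(2) near_refl y(6)] yp pt mp by (simp add: ap_pts)
  thus ?thesis using y by (auto simp: V0_def)
qed

lemma ap_H:
  assumes "x \<in> H"
  shows "ap x \<in> H"
proof (cases "\<exists>p\<in>P. near x p")
  case True
  thus ?thesis using ap_P_V0 assms H_pts V0_H by blast
next
  case False
  hence nP: "\<And>p. p \<in> P \<Longrightarrow> \<not> near x p" by blast
  obtain a b where ab: "a \<in> P" "b \<in> P" "btw a x b" and xp: "x \<in> pts" using assms by (auto simp: H_def)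
  note cl = closest[OF finP Ppts _ xp]
  obtain a' where a': "a' \<in> P" "btw a a' x" "\<And>u. u \<in> P \<Longrightarrow> btw a' u x \<Longrightarrow> near u a' \<or> near u x"
    using cl[OF ab(1)] by blast
  obtain b' where b': "b' \<in> P" "btw b b' x" "\<And>u. u \<in> P \<Longrightarrow> btw b' u x \<Longrightarrow> near u b' \<or> near u x"
    using cl[OF ab(2)] by blast
  have pt: "a \<in> pts" "b \<in> pts" "a' \<in> pts" "b' \<in> pts" using ab a' b' Ppts by auto
  have "btw a' x b'" using gap_between[OF ab(3) a'(2) b'(2)] pt xp by blast
  hence i: "btw (ap a') (ap x) (ap b')" using nearest_P_image a'(1,3) b'(1,3) xp nP by blast
  obtain y1 where y1: "y1 \<in> P" "near (ap a') y1" using Pinv[OF a'(1)] by blast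
  obtain y2 where y2: "y2 \<in> P" "near (ap b') y2" using Pinv[OF b'(1)] by blast
  note y = y1 y2
  have yp: "y1 \<in> pts" "y2 \<in> pts" using y Ppts by auto
  have "btw y1 (ap x) y2" using btw_near[OF i y(2) near_refl y(4)] yp pt xp by (simp add: ap_pts)
  thus ?thesis using y ap_pts xp by (auto simp: H_def)
qed

text \<open>Two applications of \<open>btw_split\<close> push the ends x and y of the segment
  through z outwards to points of P.\<close>

lemma H_convex:
  assumes "x \<in> H" "y \<in> H" "btw x z y" "z \<in> pts"
  shows "z \<in> H"
proof -
  obtain p q where p: "p \<in> P" "q \<in> P" "btw p x q" using assms by (auto simp: H_def)
  obtain r s where r: "r \<in> P" "s \<in> P" "btw r y s" using assms by (auto simp: H_def)
  have pt: "x \<in> pts" "y \<in> pts" "p \<in> pts" "q \<in> pts" "r \<in> pts" "s \<in> pts" using assms p r Ppts H_pts by auto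
  from btw_split[OF assms(3) pt(1) assms(4) pt(2,3)] show ?thesis
  proof
    assume "btw x z p"
    hence "btw p z q" using btw_trans(1)[OF btw_sym p(3)] pt assms(4) by blast
    thus ?thesis using p assms(4) by (auto simp: H_def)
  next
    assume "btw p z y"
    from btw_split[OF this pt(3) assms(4) pt(2,5)] show ?thesis
    proof
      assume "btw p z r"
      thus ?thesis using p r assms(4) by (auto simp: H_def)
    next
      assume "btw r z y"
      hence "btw r z s" using btw_trans(1)[OF _ r(3)] pt assms(4) by blast
      thus ?thesis using r assms(4) by (auto simp: H_def)
    qed
  qed
qed

text \<open>Of the two ends in P of a segment through x, at least one lies beyond x as seen from
  y.\<close>

lemma H_extend:
  assumes "x \<in> H" "y \<in> pts"
  obtains p where "p \<in> P" "btw y x p"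
proof -
  obtain a b where ab: "a \<in> P" "b \<in> P" "btw a x b" "x \<in> pts" using assms by (auto simp: H_def)
  hence "btw a x y \<or> btw y x b" using btw_split[OF ab(3)] assms Ppts by blast
  thus thesis using that ab btw_sym by blast
qed

text \<open>The three legs leave m in different directions and are continued to points of P by
  \<open>H_extend\<close>; m is then the median of those points. A leg of bounded length would not
  determine a direction.\<close>

lemma med_H:
  assumes "x \<in> H" "y \<in> H" "z \<in> H" "med x y z m" "\<not> near m x" "\<not> near m y" "\<not> near m z"
  shows "m \<in> V0"
proof -
  have m: "m \<in> pts" "btw x m y" "btw y m z" "btw x m z" using assms(4) by (auto simp: med_def)
  obtain a where a: "a \<in> P" "btw m x a" using H_extend[OF assms(1) m(1)] .
  obtain b where b: "b \<in> P" "btw m y b" using H_extend[OF assms(2) m(1)] .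
  obtain c where c: "c \<in> P" "btw m z c" using H_extend[OF assms(3) m(1)] .
  have pt: "x \<in> pts" "y \<in> pts" "z \<in> pts" "a \<in> pts" "b \<in> pts" "c \<in> pts"
    using a b c Ppts assms H_pts by auto
  have ext: "btw a' m b'" if "btw u m v" "btw m u a'" "btw m v b'" "\<not> near m u" "\<not> near m v"
    "u \<in> pts" "v \<in> pts" "a' \<in> pts" "b' \<in> pts" for u v a' b'
  proof -
    have "btw u m b'" using btw_extend(1)[OF that(1,3,5)] that m(1) by blast
    hence "btw b' m a'" using btw_extend(1)[OF btw_sym that(2,4)] that m(1) by blast
    thus ?thesis by (rule btw_sym)
  qed
  have "med a b c m" unfolding med_def using m assms(5-7) ext a(2) b(2) c(2) pt by blast
  thus ?thesis using a b c by (auto simp: V0_def)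
qed

lemma P_V: "P \<subseteq> V"
proof
  fix x assume "x \<in> P"
  hence "x \<in> V0" "x \<in> H" using P_V0 V0_H by auto
  thus "x \<in> V" unfolding V_def by (auto intro!: exI[of _ 0])
qed

lemma V_near_closed: "near_closed V"
  unfolding near_closed_def
proof (intro conjI ballI impI)
  show "V \<subseteq> pts" using H_pts by (auto simp: V_def)
  fix x y assume x: "x \<in> V" "y \<in> pts" "near x y"
  then obtain k where k: "x \<in> H" "(ap ^^ k) x \<in> V0" by (auto simp: V_def)
  have "near ((ap ^^ k) x) ((ap ^^ k) y)" using funpow_near x k H_pts by blast
  hence "(ap ^^ k) y \<in> V0" using V0_nearD[OF k(2)] funpow_pts x by blast
  thus "y \<in> V" using H_nearD[OF k(1) x(3,2)] by (auto simp: V_def)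
qed

lemma V_pts: "V \<subseteq> pts" and V_nearD: "x \<in> V \<Longrightarrow> near x y \<Longrightarrow> y \<in> pts \<Longrightarrow> y \<in> V"
  using V_near_closed by (auto simp: near_closed_def)

lemma ap_V:
  assumes "x \<in> V"
  shows "ap x \<in> V"
proof -
  obtain k where k: "x \<in> H" "(ap ^^ k) x \<in> V0" using assms by (auto simp: V_def)
  \<comment> \<open>For k = 0 the truncated subtraction leaves the claim
    \<open>ap x \<in> V0\<close>, which is the invariance of \<open>V0\<close>.\<close>
  have "(ap ^^ (k - 1)) (ap x) \<in> V0"
  proof (cases k)
    case 0
    thus ?thesis using k ap_V0 by simp
  next
    case (Suc j)
    thus ?thesis using k by (simp add: funpow_swap1)
  qed
  thus ?thesis using ap_H[OF k(1)] by (auto simp: V_def)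
qed

lemma med_V:
  assumes "x \<in> V" "y \<in> V" "z \<in> V" "med x y z m"
  shows "m \<in> V"
proof (cases "near m x \<or> near m y \<or> near m z")
  case True
  have "m \<in> pts" using assms(4) by (simp add: med_def)
  thus ?thesis using True V_nearD near_sym assms by blast
next
  case False
  hence "m \<in> V0" using med_H assms by (auto simp: V_def)
  thus ?thesis using V0_H by (auto simp: V_def intro!: exI[of _ 0])
qed

lemma V_isometric:
  assumes "v \<in> V" "w \<in> V" "\<And>u. u \<in> V \<Longrightarrow> btw v u w \<Longrightarrow> near u v \<or> near u w"
  shows "bdd (\<lambda>n. dst v w n - dst (ap v) (ap w) n)"
  using isometric[of v w] assms P_V V_pts by blast

text \<open>The edge is mapped isometrically, so u has a preimage x on it, at the same distance from
  v as u from f v. Then x lies in the hull and some iterate maps it into \<open>V0\<close>, whence x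
  is in \<open>V\<close> and near an end.\<close>

lemma V_image_gap:
  assumes vw: "v \<in> V" "w \<in> V" and gap: "\<And>u. u \<in> V \<Longrightarrow> btw v u w \<Longrightarrow> near u v \<or> near u w"
    and u: "u \<in> V" "btw (ap v) u (ap w)"
  shows "near u (ap v) \<or> near u (ap w)"
proof -
  have pt: "v \<in> pts" "w \<in> pts" "u \<in> pts" using vw u V_pts by auto
  have iso: "bdd (\<lambda>n. dst v w n - dst (ap v) (ap w) n)" by (rule V_isometric[OF vw gap])
  \<comment> \<open>The minimum keeps the point on the segment for those n at which u is further
    from \<open>ap v\<close> than w is from v.\<close>
  have "\<exists>z. z \<in> hseg (v n) (w n) \<and> hyp_dist (v n) z = min (dst (ap v) u n) (dst v w n) \<and>
      hyp_dist z (w n) = dst v w n - min (dst (ap v) u n) (dst v w n)" for n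
    by (rule hseg_point_at[of "v n" "w n" "min (dst (ap v) u n) (dst v w n)"])
      (use pt dst_nonneg[OF ap_pts[OF pt(1)] pt(3), of n] dst_nonneg[OF pt(1,2), of n] in \<open>auto simp: pts_def\<close>)
  then obtain x where x: "\<And>n. x n \<in> hseg (v n) (w n)"
    "\<And>n. dst v x n = min (dst (ap v) u n) (dst v w n)"
    "\<And>n. dst x w n = dst v w n - min (dst (ap v) u n) (dst v w n)" by metis
  have xp: "x \<in> pts" using x(1) pt hseg_subset by (fastforce simp: pts_def)
  have vxw: "btw v x w" unfolding btw_def by (rule bdd_const[of _ 0]) (simp add: x)
  have apv: "ap v \<in> pts" "ap w \<in> pts" "ap x \<in> pts" using pt xp ap_pts by auto
  have "near (ap x) u"
  proof (rule near_by_dist[OF u(2) _ _ apv(1) pt(3) apv(2,3)])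
    show "bdd (\<lambda>n. dst (ap x) (ap v) n - dst u (ap v) n)"
    proof (rule bdd_const[of _ 0])
      fix n show "dst (ap x) (ap v) n - dst u (ap v) n \<le> 0"
        using ap_contract[OF pt(1) xp, of n] x(2)[of n]
        by (simp add: dst_commute[of "ap x" _ "ap v"] dst_commute[of u _ "ap v"])
    qed
    show "bdd (\<lambda>n. dst (ap x) (ap w) n - dst u (ap w) n)"
    proof (rule bdd_le2[OF iso bdd_const[of "\<lambda>_. 0" 0], of _ 0])
      fix n show "dst (ap x) (ap w) n - dst u (ap w) n \<le> dst v w n - dst (ap v) (ap w) n + 0 + 0"
        using ap_contract[OF xp pt(2), of n] x(3)[of n] dst_triangle[OF apv(1) pt(3) apv(2), of n]
          ap_contract[OF pt(1,2), of n] dst_nonneg[OF pt(3) apv(2), of n]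
        by (simp add: min_def split: if_splits)
    qed simp
  qed
  hence nx: "near (ap x) u" .
  have "x \<in> H" using H_convex[OF _ _ vxw xp] vw by (auto simp: V_def)
  moreover obtain k where "(ap ^^ k) u \<in> V0" using u by (auto simp: V_def)
  hence "(ap ^^ k) (ap x) \<in> V0"
    using V0_nearD[OF _ near_sym[OF funpow_near[OF nx]]] apv pt funpow_pts by blast
  hence "(ap ^^ Suc k) x \<in> V0" by (simp add: funpow_swap1)
  ultimately have "x \<in> V" unfolding V_def by blast
  hence "near x v \<or> near x w" using gap vxw by blast
  hence "near (ap x) (ap v) \<or> near (ap x) (ap w)" using ap_near xp pt by blast
  thus ?thesis using near_trans[OF near_sym[OF nx]] apv pt by blast
qed

lemma fin_near_preimage:
  assumes "fin_near A" "A \<subseteq> pts"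
  shows "fin_near {x \<in> pts. ap x \<in> A}"
proof -
  obtain B where B: "finite B" "B \<subseteq> pts" "\<And>x. x \<in> A \<Longrightarrow> \<exists>b\<in>B. near x b"
    using assms(1) by (auto simp: fin_near_def)
  have "\<exists>C. finite C \<and> C \<subseteq> pts \<and> (\<forall>x\<in>pts. near (ap x) b \<longrightarrow> (\<exists>c\<in>C. near x c))" if "b \<in> B" for b
    using finite_preimages that B(2) by blast
  then obtain C where C: "\<And>b. b \<in> B \<Longrightarrow> finite (C b)" "\<And>b. b \<in> B \<Longrightarrow> C b \<subseteq> pts"
    "\<And>b x. b \<in> B \<Longrightarrow> x \<in> pts \<Longrightarrow> near (ap x) b \<Longrightarrow> \<exists>c\<in>C b. near x c" by metis
  show ?thesis unfolding fin_near_def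
  proof (intro exI[of _ "\<Union>b\<in>B. C b"] conjI ballI)
    fix x assume "x \<in> {x \<in> pts. ap x \<in> A}"
    thus "\<exists>c\<in>\<Union>b\<in>B. C b. near x c" using B(3) C(3) by blast
  next
    show "(\<Union>b\<in>B. C b) \<subseteq> pts" using C(2) by blast
  qed (use B(1) C(1) in simp)
qed

lemma fin_near_iterates: "fin_near {x \<in> pts. (ap ^^ k) x \<in> V0}"
proof (induction k)
  case 0
  obtain M where "finite M" "M \<subseteq> V0" "\<forall>x\<in>V0. \<exists>r\<in>M. near x r" using V0_reps by blast
  thus ?case using V0_pts by (auto simp: fin_near_def intro!: exI[of _ M])
next
  case (Suc k)
  have "{x \<in> pts. (ap ^^ Suc k) x \<in> V0} = {x \<in> pts. ap x \<in> {x \<in> pts. (ap ^^ k) x \<in> V0}}"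
    using ap_pts by (auto simp: funpow_swap1)
  thus ?case using fin_near_preimage[OF Suc] by auto
qed

lemma funpow_H: "x \<in> H \<Longrightarrow> (ap ^^ k) x \<in> H"
  by (induction k) (auto intro: ap_H)

text \<open>As long as the orbit of \<open>x\<close> avoids \<open>V0\<close>, it moves through gaps of \<open>V0\<close> of nonincreasing length.
  If a gap repeats, the lengths are equal in between, so an iterate of \<open>f\<close> fixes the
  gap together with the point in it, and the orbit never enters \<open>V0\<close>.\<close>

lemma V0_entry_bound:
  obtains N where "\<And>x. x \<in> V \<Longrightarrow> \<exists>k\<le>N. (ap ^^ k) x \<in> V0"
proof -
  obtain M where M: "finite M" "M \<subseteq> V0" "\<forall>x\<in>V0. \<exists>r\<in>M. near x r"
    using V0_reps by blast
  have Mp: "M \<subseteq> pts" using M V0_pts by blast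
  \<comment> \<open>\<open>v\<close> and \<open>w\<close> are the representatives of
    \<open>V0\<close> next to x on either side. Only \<open>card (M \<times> M)\<close> pairs are
    available, which gives the bound on the entry time.\<close>
  define gap where "gap v w x \<longleftrightarrow> v \<in> M \<and> w \<in> M \<and> btw v x w \<and>
    (\<forall>u\<in>M. btw v u x \<longrightarrow> near u v \<or> near u x) \<and> (\<forall>u\<in>M. btw w u x \<longrightarrow> near u w \<or> near u x)" for v w x
  have gap_inside: "\<exists>v' w'. gap v' w' x \<and> btw v v' x \<and> btw w w' x"
    if vw: "v \<in> V0" "w \<in> V0" "btw v x w" "x \<in> pts" for v w x
  proof -
    obtain r s where r: "r \<in> M" "near v r" and s: "s \<in> M" "near w s" using M(3) vw by blast
    have pt: "v \<in> pts" "w \<in> pts" "r \<in> pts" "s \<in> pts" using vw r s V0_pts Mp by auto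
    obtain v' where v': "v' \<in> M" "btw r v' x" "\<And>a. a \<in> M \<Longrightarrow> btw v' a x \<Longrightarrow> near a v' \<or> near a x"
      using closest[OF M(1) Mp r(1) vw(4)] by blast
    obtain w' where w': "w' \<in> M" "btw s w' x" "\<And>a. a \<in> M \<Longrightarrow> btw w' a x \<Longrightarrow> near a w' \<or> near a x"
      using closest[OF M(1) Mp s(1) vw(4)] by blast
    have pt': "v' \<in> pts" "w' \<in> pts" using v' w' Mp by auto
    have b: "btw v v' x" "btw w w' x"
      using btw_near[OF v'(2) near_sym[OF r(2)] near_refl near_refl]
        btw_near[OF w'(2) near_sym[OF s(2)] near_refl near_refl] pt pt' vw(4) by blast+
    have "btw v' x w'" using gap_between[OF vw(3) b] pt pt' vw(4) by blast
    thus ?thesis using v' w' b unfolding gap_def by blast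
  qed
  have gap_iso: "bdd (\<lambda>n. dst v w n - dst (ap v) (ap w) n)" if g: "gap v w x" "x \<in> pts" "x \<notin> V0" for v w x
  proof -
    have pt: "v \<in> pts" "w \<in> pts" using g Mp by (auto simp: gap_def)
    show ?thesis
    proof (rule isometric[OF pt])
      fix p assume p: "p \<in> P" "btw v p w"
      obtain r where r: "r \<in> M" "near p r" using M(3) P_V0 p by blast
      have rp: "p \<in> pts" "r \<in> pts" using p r Ppts Mp by auto
      have vrw: "btw v r w" using btw_near[OF p(2) near_refl r(2) near_refl] pt rp by blast
      have "near r v \<or> near r w \<or> near r x"
        by (rule gap_empty[OF _ rp(2) vrw _ _ pt(1) g(2) pt(2)]) (use g r in \<open>auto simp: gap_def\<close>)
      moreover have "\<not> near r x" using V0_nearD[of r x] r M(2) g by blast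
      ultimately show "near p v \<or> near p w" using near_trans[OF r(2)] rp pt by blast
    qed
  qed
  have main: "\<exists>k\<le>card (M \<times> M). (ap ^^ k) x \<in> V0" if xV: "x \<in> V" for x
  proof (rule ccontr)
    assume neg: "\<not> ?thesis"
    define X where "X i = (ap ^^ i) x" for i
    obtain k0 where k0: "X k0 \<in> V0" using xV by (auto simp: V_def X_def)
    define k where "k = (LEAST k. X k \<in> V0)"
    have k: "X k \<in> V0" unfolding k_def using k0 by (rule LeastI)
    have kl: "X i \<notin> V0" if "i < k" for i using that not_less_Least unfolding k_def by blast
    have kN: "k > card (M \<times> M)" using neg k by (auto simp: X_def not_le)
    have XH: "X i \<in> H" for i using xV funpow_H by (auto simp: X_def V_def)
    have Xp: "X i \<in> pts" for i using XH H_pts by blast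
    have XS: "X (Suc i) = ap (X i)" for i by (simp add: X_def)
    \<comment> \<open>A gap is selected for each orbit point before the entry time k, each lying
      inside the image of the preceding one. From k on the conditions are void, so that dependent
      choice runs over all indices.\<close>
    define Q where "Q i z \<longleftrightarrow> (i < k \<longrightarrow> gap (fst z) (snd z) (X i))" for i z
    define S where "S i z z' \<longleftrightarrow> (Suc i < k \<longrightarrow> btw (ap (fst z)) (fst z') (X (Suc i)) \<and>
      btw (ap (snd z)) (snd z') (X (Suc i)))" for i z z'
    have "\<exists>g. \<forall>i. Q i (g i) \<and> S i (g i) (g (Suc i))"
    proof (rule dependent_nat_choice)
      obtain p q where pq: "p \<in> P" "q \<in> P" "btw p (X 0) q" using XH[of 0] by (auto simp: H_def)
      then obtain v w where "gap v w (X 0)" using gap_inside[of p q "X 0"] P_V0 Xp by blast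
      thus "\<exists>z. Q 0 z" by (intro exI[of _ "(v, w)"]) (simp add: Q_def)
    next
      fix z i assume z: "Q i z"
      show "\<exists>z'. Q (Suc i) z' \<and> S i z z'"
      proof (cases "Suc i < k")
        case True
        obtain v w where vw: "z = (v, w)" by force
        have g: "gap v w (X i)" using z True by (simp add: Q_def vw)
        have vM: "v \<in> M" "w \<in> M" "btw v (X i) w" using g by (auto simp: gap_def)
        have "btw (ap v) (X (Suc i)) (ap w)" unfolding XS
          using ap_btw[OF gap_iso[OF g Xp kl]] True vM Mp Xp by auto
        moreover have "ap v \<in> V0" "ap w \<in> V0" using ap_V0 vM M(2) by auto
        ultimately obtain v' w' where "gap v' w' (X (Suc i))" "btw (ap v) v' (X (Suc i))" "btw (ap w) w' (X (Suc i))"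
          using gap_inside Xp by blast
        thus ?thesis by (intro exI[of _ "(v', w')"]) (simp add: Q_def S_def vw)
      qed (auto simp: Q_def S_def)
    qed
    then obtain g where g: "\<And>i. Q i (g i)" "\<And>i. S i (g i) (g (Suc i))" by blast
    define v where "v i = fst (g i)" for i
    define w where "w i = snd (g i)" for i
    have gp: "gap (v i) (w i) (X i)" if "i < k" for i using g(1)[of i] that by (simp add: Q_def v_def w_def)
    have st: "btw (ap (v i)) (v (Suc i)) (X (Suc i))" "btw (ap (w i)) (w (Suc i)) (X (Suc i))" if "Suc i < k" for i
      using g(2)[of i] that by (auto simp: S_def v_def w_def)
    have vM: "v i \<in> M" "w i \<in> M" "btw (v i) (X i) (w i)" if "i < k" for i using gp[OF that] by (auto simp: gap_def)
    have vp: "v i \<in> pts" "w i \<in> pts" if "i < k" for i using vM[OF that] Mp by auto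
    have "\<not> inj_on g {..<k}"
    proof
      assume "inj_on g {..<k}"
      moreover have "g i \<in> M \<times> M" if "i < k" for i
        using vM(1,2)[OF that] by (simp add: v_def w_def mem_Times_iff)
      hence "g ` {..<k} \<subseteq> M \<times> M" by (intro image_subsetI) (simp only: lessThan_iff)
      ultimately have "card {..<k} \<le> card (M \<times> M)" using M(1) by (intro card_inj_on_le[of g]) auto
      thus False using kN by simp
    qed
    then obtain i j where ij: "i < j" "j < k" "g i = g j" unfolding inj_on_def by (metis lessThan_iff linorder_neqE_nat)
    define L where "L i = dst (v i) (w i)" for i
    \<comment> \<open>The total length by which the image of gap i sticks out beyond gap i + 1 at
      its two ends.\<close>
    define \<delta> where "\<delta> i n = dst (ap (v i)) (v (Suc i)) n + dst (ap (w i)) (w (Suc i)) n" for i n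
    have dec: "bdd (\<lambda>n. \<delta> i n + L (Suc i) n - L i n)" if i: "Suc i < k" for i
    proof -
      have ik: "i < k" using i by simp
      have vi: "v i \<in> pts" "w i \<in> pts" "v (Suc i) \<in> pts" "w (Suc i) \<in> pts" using vp[OF ik] vp[OF i] by auto
      have bX: "btw (ap (v i)) (X (Suc i)) (ap (w i))" unfolding XS
        using ap_btw[OF gap_iso[OF gp[OF ik] Xp kl[OF ik]] vM(3)[OF ik]] vi Xp by blast
      show ?thesis
      proof (rule bdd_le3[OF st(1)[OF i, unfolded btw_def] st(2)[OF i, unfolded btw_def] bX[unfolded btw_def], of _ 0])
        fix n
        show "\<delta> i n + L (Suc i) n - L i n
         \<le> dst (ap (v i)) (v (Suc i)) n + dst (v (Suc i)) (X (Suc i)) n - dst (ap (v i)) (X (Suc i)) n +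
           (dst (ap (w i)) (w (Suc i)) n + dst (w (Suc i)) (X (Suc i)) n - dst (ap (w i)) (X (Suc i)) n) +
           (dst (ap (v i)) (X (Suc i)) n + dst (X (Suc i)) (ap (w i)) n - dst (ap (v i)) (ap (w i)) n) + 0"
          using ap_contract[OF vi(1,2), of n] dst_triangle[OF vi(3) Xp[of "Suc i"] vi(4), of n]
          by (simp add: \<delta>_def L_def dst_commute[of "X (Suc i)" _ "w (Suc i)"] dst_commute[of "X (Suc i)" _ "ap (w i)"])
      qed
    qed
    have \<delta>0: "\<delta> l n \<ge> 0" if "Suc l < k" for l n
      using vp[of l] vp[of "Suc l"] that ap_pts unfolding \<delta>_def by (intro add_nonneg_nonneg dst_nonneg) auto
    have mono: "bdd (\<lambda>n. L b n - L a n)" if "a \<le> b" "b < k" for a b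
      using that
    proof (induction b)
      case 0 thus ?case by (simp add: bdd_const[of _ 0])
    next
      case (Suc b)
      show ?case
      proof (cases "a = Suc b")
        case False
        hence "bdd (\<lambda>n. L b n - L a n)" using Suc by simp
        from bdd_le2[OF this dec[OF Suc.prems(2)], of _ 0] show ?thesis
          using \<delta>0[OF Suc.prems(2)] by (simp add: algebra_simps)
      qed (simp add: bdd_const[of _ 0])
    qed
    have "v i = v j" "w i = w j" using ij(3) by (simp_all add: v_def w_def)
    hence Lij: "L i = L j" by (simp add: L_def)
    \<comment> \<open>Between two occurrences of the same gap the lengths cannot really decrease, so
      nothing can stick out by an unbounded amount.\<close>
    have db: "bdd (\<delta> l)" if "i \<le> l" "l < j" for l
      by (rule bdd_le3[OF dec[of l] mono[of i l] mono[of "Suc l" j], of _ 0]) (use that ij Lij in auto)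
    have nv: "near (ap (v l)) (v (Suc l))" "near (ap (w l)) (w (Suc l))" if l: "i \<le> l" "l < j" for l
    proof -
      have lk: "l < k" "Suc l < k" using l ij by auto
      have "dst (ap (v l)) (v (Suc l)) n \<ge> 0" "dst (ap (w l)) (w (Suc l)) n \<ge> 0" for n
        using vp[OF lk(1)] vp[OF lk(2)] ap_pts dst_nonneg by auto
      thus "near (ap (v l)) (v (Suc l))" "near (ap (w l)) (w (Suc l))"
        unfolding near_def by (auto intro!: bdd_le[OF db[OF l], of _ 0] simp: \<delta>_def)
    qed
    have it: "near ((ap ^^ q) (v i)) (v (i + q)) \<and> near ((ap ^^ q) (w i)) (w (i + q))" if "i + q \<le> j" for q
      using that
    proof (induction q)
      case (Suc q)
      have b: "i + q < k" "i + Suc q < k" "i < k" using Suc.prems ij by auto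
      note p = vp[OF b(1)] vp[OF b(2)] vp[OF b(3)]
      have "near (ap ((ap ^^ q) (v i))) (ap (v (i + q)))" "near (ap ((ap ^^ q) (w i))) (ap (w (i + q)))"
        using Suc p ap_near funpow_pts by auto
      moreover have "near (ap (v (i + q))) (v (i + Suc q))" "near (ap (w (i + q))) (w (i + Suc q))"
        using nv[of "i + q"] Suc.prems by auto
      ultimately show ?case using near_trans p ap_pts funpow_pts by simp
    qed simp
    define q where "q = j - i"
    have q: "i + q = j" using ij by (simp add: q_def)
    have ret: "near ((ap ^^ q) (v i)) (v i)" "near ((ap ^^ q) (w i)) (w i)"
      using it[of q] q \<open>v i = v j\<close> \<open>w i = w j\<close> by auto
    have ik: "i < k" using ij by simp
    \<comment> \<open>The iterate returns both ends of the gap to themselves and contracts the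
      distances of \<open>X i\<close> to them, so by \<open>near_by_dist\<close> it returns
      \<open>X i\<close> as well.\<close>
    have nX: "near ((ap ^^ q) (X i)) (X i)"
    proof (rule near_by_dist[OF vM(3)[OF ik] _ _ vp(1)[OF ik] Xp vp(2)[OF ik] funpow_pts[OF Xp]])
      show "bdd (\<lambda>n. dst ((ap ^^ q) (X i)) (v i) n - dst (X i) (v i) n)"
        using ret(1) unfolding near_def
      proof (rule bdd_le[of _ _ 0])
        fix n show "dst ((ap ^^ q) (X i)) (v i) n - dst (X i) (v i) n \<le> dst ((ap ^^ q) (v i)) (v i) n + 0"
          using funpow_contract[OF Xp[of i] vp(1)[OF ik], of q n]
            dst_triangle[OF funpow_pts[OF Xp[of i], of q] funpow_pts[OF vp(1)[OF ik], of q] vp(1)[OF ik], of n] by simp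
      qed
      show "bdd (\<lambda>n. dst ((ap ^^ q) (X i)) (w i) n - dst (X i) (w i) n)"
        using ret(2) unfolding near_def
      proof (rule bdd_le[of _ _ 0])
        fix n show "dst ((ap ^^ q) (X i)) (w i) n - dst (X i) (w i) n \<le> dst ((ap ^^ q) (w i)) (w i) n + 0"
          using funpow_contract[OF Xp[of i] vp(2)[OF ik], of q n]
            dst_triangle[OF funpow_pts[OF Xp[of i], of q] funpow_pts[OF vp(2)[OF ik], of q] vp(2)[OF ik], of n] by simp
      qed
    qed
    have Xadd: "(ap ^^ a) (X b) = X (a + b)" for a b by (simp add: X_def funpow_add)
    have "near (X (q + i)) (X i)" using nX by (simp add: Xadd)
    \<comment> \<open>Applying the remaining k - j iterates identifies the orbit point at time k
      with the one at time k - (j - i), which contradicts the choice of k as the first entry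
      time.\<close>
    hence "near ((ap ^^ (k - j)) (X (q + i))) ((ap ^^ (k - j)) (X i))" using funpow_near Xp by blast
    moreover have "k - j + (q + i) = k" "k - j + i < k" using q ij by auto
    ultimately have "near (X k) (X (k - j + i))" by (simp only: Xadd)
    hence "X (k - j + i) \<in> V0" using V0_nearD k Xp by blast
    thus False using kl \<open>k - j + i < k\<close> by blast
  qed
  show thesis using that[of "card (M \<times> M)"] main by blast
qed

lemma fin_near_V: "fin_near V"
proof -
  obtain N where N: "\<And>x. x \<in> V \<Longrightarrow> \<exists>k\<le>N. (ap ^^ k) x \<in> V0" using V0_entry_bound by metis
  have "\<exists>B. finite B \<and> B \<subseteq> pts \<and> (\<forall>x\<in>pts. (ap ^^ k) x \<in> V0 \<longrightarrow> (\<exists>b\<in>B. near x b))" for k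
  proof -
    obtain B where B: "finite B" "B \<subseteq> pts" "\<forall>x\<in>{x \<in> pts. (ap ^^ k) x \<in> V0}. \<exists>b\<in>B. near x b"
      using fin_near_iterates[of k] unfolding fin_near_def by blast
    thus ?thesis by (intro exI[of _ B]) simp
  qed
  then obtain B where B: "\<And>k. finite (B k)" "\<And>k. B k \<subseteq> pts"
    "\<And>k x. x \<in> pts \<Longrightarrow> (ap ^^ k) x \<in> V0 \<Longrightarrow> \<exists>b\<in>B k. near x b" by metis
  show ?thesis unfolding fin_near_def
  proof (intro exI[of _ "\<Union>k\<le>N. B k"] conjI ballI)
    fix x assume x: "x \<in> V"
    then obtain k where "k \<le> N" "(ap ^^ k) x \<in> V0" using N by blast
    thus "\<exists>b\<in>\<Union>k\<le>N. B k. near x b" using B(3)[of x k] x V_pts by blast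
  next
    show "(\<Union>k\<le>N. B k) \<subseteq> pts" using B(2) by blast
  qed (use B(1) in simp)
qed

end

subsection \<open>Embedded ribbon trees\<close>

text \<open>g picks the other element at the smallest counterclockwise angle. In the order of the
  arguments in [0, 2 pi) this is the next element, and the last is followed by the first; hence
  everything lies on the orbit of the first.\<close>

lemma cyclic_successor_by_angle:
  fixes z :: "'a \<Rightarrow> complex"
  assumes fin: "finite A" and ne: "A \<noteq> {}"
    and z: "\<And>a. a \<in> A \<Longrightarrow> z a \<noteq> 0"
    and dir: "\<And>a b. a \<in> A \<Longrightarrow> b \<in> A \<Longrightarrow> a \<noteq> b \<Longrightarrow> Arg2pi (z a) \<noteq> Arg2pi (z b)"
  obtains g where "cyclic_on g A"
    "\<And>a b. a \<in> A \<Longrightarrow> b \<in> A \<Longrightarrow> a \<noteq> b \<Longrightarrow> g a \<noteq> a \<and> Arg2pi (z (g a) / z a) \<le> Arg2pi (z b / z a)"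
proof -
  define \<theta> where "\<theta> a = Arg2pi (z a)" for a
  have \<theta>: "0 \<le> \<theta> a" "\<theta> a < 2 * pi" for a using Arg2pi[of "z a"] by (auto simp: \<theta>_def)
  have div: "Arg2pi (z b / z a) = (if \<theta> a < \<theta> b then \<theta> b - \<theta> a else \<theta> b + (2 * pi - \<theta> a))"
    if "a \<in> A" "b \<in> A" "a \<noteq> b" for a b
  proof (cases "\<theta> a < \<theta> b")
    case True
    thus ?thesis using Arg2pi_diff[of "z b" "z a"] Arg2pi_divide[of "z a" "z b"] z that
      by (simp add: \<theta>_def)
  next
    case False
    hence lt: "\<theta> b < \<theta> a" using dir[OF that] by (simp add: \<theta>_def)
    have "Arg2pi (z b / z a) = 2 * pi - Arg2pi (z a / z b)"
    proof -
      have "Arg2pi (z a / z b) = \<theta> a - \<theta> b"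
        using Arg2pi_divide[of "z b" "z a"] lt z that by (simp add: \<theta>_def)
      hence "Arg2pi (z a / z b) \<noteq> 0" using lt by simp
      hence nr: "\<not> (z a / z b \<in> \<real> \<and> 0 \<le> Re (z a / z b))" by (simp add: Arg2pi_eq_0)
      have inv: "z b / z a = inverse (z a / z b)" by simp
      show ?thesis
      proof (cases "z a / z b \<in> \<real>")
        case True
        have "Arg2pi (z a / z b) = pi" using Arg2pi_real[OF True] nr True by auto
        thus ?thesis unfolding inv Arg2pi_inverse using True by simp
      next
        case False
        thus ?thesis unfolding inv Arg2pi_inverse by simp
      qed
    qed
    thus ?thesis using Arg2pi_divide[of "z b" "z a"] lt z that by (simp add: \<theta>_def)
  qed
  define \<alpha> where "\<alpha> a b = Arg2pi (z b / z a)" for a b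
  \<comment> \<open>A single element is its own successor, as \<open>cyclic_on\<close>
    demands.\<close>
  define g where "g a = (if A = {a} then a else arg_min_on (\<alpha> a) (A - {a}))" for a
  have g: "g a \<in> A - {a}" "\<And>b. b \<in> A - {a} \<Longrightarrow> \<alpha> a (g a) \<le> \<alpha> a b" if "a \<in> A" "A \<noteq> {a}" for a
  proof -
    have f: "finite (A - {a})" "A - {a} \<noteq> {}" using fin that by auto
    show "g a \<in> A - {a}" using arg_min_if_finite(1)[OF f, of "\<alpha> a"] that by (simp add: g_def)
    show "\<alpha> a (g a) \<le> \<alpha> a b" if "b \<in> A - {a}" for b
      using arg_min_least[OF f that, of "\<alpha> a"] \<open>A \<noteq> {a}\<close> by (simp add: g_def)
  qed
  have gA: "g a \<in> A" if "a \<in> A" for a using g(1)[of a] that by (cases "A = {a}") (auto simp: g_def)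
  have inj: "\<theta> a \<noteq> \<theta> b" if "a \<in> A" "b \<in> A" "a \<noteq> b" for a b using dir[OF that] by (simp add: \<theta>_def)
  have pred: "g a = b" if ab: "a \<in> A" "b \<in> A" "\<theta> a < \<theta> b" and no: "\<And>c. c \<in> A \<Longrightarrow> \<theta> a < \<theta> c \<Longrightarrow> \<theta> b \<le> \<theta> c" for a b
  proof (rule ccontr)
    assume n: "g a \<noteq> b"
    have "A \<noteq> {a}" "b \<in> A - {a}" using ab by auto
    note ga = g(1)[OF ab(1) this(1)] g(2)[OF ab(1) this]
    have c: "g a \<in> A" "a \<noteq> g a" "a \<noteq> b" using ga ab by auto
    have "\<theta> (g a) \<noteq> \<theta> b" using inj c(1) ab(2) n by blast
    thus False using ga(2) \<theta>[of "g a"] \<theta>[of b] \<theta>[of a] no[OF c(1)] ab(3)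
      unfolding \<alpha>_def div[OF ab(1) c(1,2)] div[OF ab(1,2) c(3)] by (auto split: if_splits)
  qed
  define lo where "lo = arg_min_on \<theta> A"
  have lo: "lo \<in> A" "\<And>b. b \<in> A \<Longrightarrow> \<theta> lo \<le> \<theta> b"
    using arg_min_if_finite(1)[OF fin ne, of \<theta>] arg_min_least[OF fin ne, of _ \<theta>] by (auto simp: lo_def)
  have step: "a \<in> orbit g lo" if "a \<in> A" "a \<noteq> lo" for a
    using that
  proof (induction "card {b\<in>A. \<theta> b < \<theta> a}" arbitrary: a rule: less_induct)
    case less
    have lt: "\<theta> lo < \<theta> a" using lo(2)[OF less.prems(1)] inj[OF less.prems(1) lo(1)] less.prems by force
    define B where "B = {b\<in>A. \<theta> b < \<theta> a}"
    have B: "finite B" "B \<noteq> {}" using fin lt lo by (auto simp: B_def)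
    have "Max (\<theta> ` B) \<in> \<theta> ` B" using B by (intro Max_in) auto
    then obtain b where b: "b \<in> B" "\<theta> b = Max (\<theta> ` B)" by auto
    have bA: "b \<in> A" "\<theta> b < \<theta> a" using b by (auto simp: B_def)
    have "g b = a"
    proof (rule pred[OF bA(1) less.prems(1) bA(2)])
      fix c assume c: "c \<in> A" "\<theta> b < \<theta> c"
      show "\<theta> a \<le> \<theta> c"
      proof (rule ccontr)
        assume "\<not> \<theta> a \<le> \<theta> c"
        hence "c \<in> B" using c by (simp add: B_def)
        hence "\<theta> c \<le> \<theta> b" using b(2) B by simp
        thus False using c by simp
      qed
    qed
    show ?case
    proof (cases "b = lo")
      case True
      thus ?thesis using \<open>g b = a\<close> orbit.base[of g lo] by simp
    next
      case False
      have "{c\<in>A. \<theta> c < \<theta> b} \<subset> {c\<in>A. \<theta> c < \<theta> a}" using bA by force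
      hence "card {c\<in>A. \<theta> c < \<theta> b} < card {c\<in>A. \<theta> c < \<theta> a}" using fin by (intro psubset_card_mono) auto
      hence "b \<in> orbit g lo" using less.hyps bA(1) False by blast
      thus ?thesis using \<open>g b = a\<close> orbit.step[of b g lo] by simp
    qed
  qed
  have "lo \<in> orbit g lo"
  proof (cases "A = {lo}")
    case True
    hence "g lo = lo" by (simp add: g_def)
    thus ?thesis using orbit.base[of g lo] by simp
  next
    case False
    have "Max (\<theta> ` A) \<in> \<theta> ` A" using fin ne by (intro Max_in) auto
    then obtain hi where hi: "hi \<in> A" "\<theta> hi = Max (\<theta> ` A)" by auto
    have hi2: "\<theta> b \<le> \<theta> hi" if "b \<in> A" for b using hi fin that by simp
    have hl: "hi \<noteq> lo"
    proof
      assume "hi = lo"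
      hence "\<theta> b = \<theta> lo" if "b \<in> A" for b using hi2[OF that] lo(2)[OF that] by simp
      hence "A = {lo}" using inj lo(1) by blast
      thus False using False by blast
    qed
    have "A \<noteq> {hi}" "lo \<in> A - {hi}" using lo(1) hl by auto
    note gh = g(1)[OF hi(1) this(1)] g(2)[OF hi(1) this]
    have c: "g hi \<in> A" "hi \<noteq> g hi" using gh by auto
    have "g hi = lo"
    proof (rule ccontr)
      assume n: "g hi \<noteq> lo"
      have "\<theta> (g hi) \<noteq> \<theta> lo" using inj c(1) lo(1) n by blast
      thus False using gh(2) lo(2)[OF c(1)] hi2[OF c(1)] hi2[OF lo(1)]
        unfolding \<alpha>_def div[OF hi(1) c] div[OF hi(1) lo(1) hl] by (auto split: if_splits)
    qed
    thus ?thesis using orbit.step[OF step[OF hi(1) hl]] by simp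
  qed
  hence "A \<subseteq> orbit g lo" using step by blast
  moreover have "b \<in> A" if "b \<in> orbit g lo" for b
    using that by induction (use gA lo in auto)
  ultimately have "A = orbit g lo" by blast
  hence "cyclic_on g A" using lo(1) by (auto simp: cyclic_on_def)
  moreover have "g a \<noteq> a \<and> Arg2pi (z (g a) / z a) \<le> Arg2pi (z b / z a)" if "a \<in> A" "b \<in> A" "a \<noteq> b" for a b
    using g[of a] that by (auto simp: \<alpha>_def)
  ultimately show thesis using that by blast
qed

lemma finite_tree_image:
  assumes T: "finite_tree T" and inj: "inj_on \<phi> (verts T)"
    and v: "verts T' = \<phi> ` verts T" and e: "edges T' = (\<lambda>e. \<phi> ` e) ` edges T"
  shows "finite_tree T'"
proof -
  define \<psi> where "\<psi> = the_inv_into (verts T) \<phi>"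
  have \<psi>: "\<psi> (\<phi> x) = x" if "x \<in> verts T" for x using inj that by (simp add: \<psi>_def the_inv_into_f_f)
  have sub: "e \<subseteq> verts T" "card e = 2" if "e \<in> edges T" for e using T that by (auto simp: finite_tree_def)
  have uniq: "\<exists>!xs. simple_path_between T' u v xs" if u: "u \<in> verts T'" "v \<in> verts T'" for u v
  proof -
    obtain a b where ab: "a \<in> verts T" "b \<in> verts T" "u = \<phi> a" "v = \<phi> b" using u v by auto
    obtain xs where xs: "simple_path_between T a b xs" "\<And>ys. simple_path_between T a b ys \<Longrightarrow> ys = xs"
    proof -
      have "\<exists>!xs. simple_path_between T a b xs" using T ab by (simp add: finite_tree_def)
      thus ?thesis using that by (elim ex1E) blast
    qed
    show ?thesis
    proof (rule ex1I[of _ "map \<phi> xs"])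
      have "successively (\<lambda>x y. {\<phi> x, \<phi> y} \<in> edges T') xs"
      proof (rule successively_mono[of "\<lambda>x y. {x, y} \<in> edges T"])
        show "successively (\<lambda>x y. {x, y} \<in> edges T) xs" using xs(1) by (simp add: simple_path_between_def)
        fix x y assume "{x, y} \<in> edges T"
        hence "\<phi> ` {x, y} \<in> edges T'" using e by blast
        thus "{\<phi> x, \<phi> y} \<in> edges T'" by simp
      qed
      moreover have "inj_on \<phi> (set xs)" using xs(1) inj inj_on_subset by (auto simp: simple_path_between_def)
      ultimately show "simple_path_between T' u v (map \<phi> xs)"
        using xs(1) ab v by (auto simp: simple_path_between_def hd_map last_map successively_map distinct_map)
    next
      fix ys assume ys: "simple_path_between T' u v ys"
      have ysv: "set ys \<subseteq> \<phi> ` verts T" using ys v by (simp add: simple_path_between_def)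
      have "successively (\<lambda>x y. {\<psi> x, \<psi> y} \<in> edges T) ys"
      proof (rule successively_mono[of "\<lambda>x y. {x, y} \<in> edges T'"])
        show "successively (\<lambda>x y. {x, y} \<in> edges T') ys" using ys by (simp add: simple_path_between_def)
        fix x y assume "{x, y} \<in> edges T'"
        then obtain e' where e': "e' \<in> edges T" "{x, y} = \<phi> ` e'" using e by auto
        have "\<psi> ` {x, y} = (\<lambda>x. \<psi> (\<phi> x)) ` e'" unfolding e'(2) by (rule image_image)
        also have "\<dots> = (\<lambda>x. x) ` e'" by (rule image_cong[OF refl]) (use \<psi> sub(1)[OF e'(1)] in auto)
        finally have "{\<psi> x, \<psi> y} = e'" by simp
        thus "{\<psi> x, \<psi> y} \<in> edges T" using e'(1) by simp
      qed
      moreover have "inj_on \<psi> (\<phi> ` verts T)" by (rule inj_on_inverseI[of _ \<phi>]) (auto simp: \<psi>)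
      hence "inj_on \<psi> (set ys)" using ysv inj_on_subset by blast
      ultimately have "simple_path_between T a b (map \<psi> ys)"
        using ys ab ysv by (auto simp: simple_path_between_def hd_map last_map successively_map distinct_map \<psi>)
      hence "map \<psi> ys = xs" by (rule xs(2))
      moreover have "map \<phi> (map \<psi> ys) = ys" unfolding map_map
        by (rule map_idI) (use ysv \<psi> in auto)
      ultimately show "ys = map \<phi> xs" by simp
    qed
  qed
  have "e \<subseteq> verts T' \<and> card e = 2" if eT: "e \<in> edges T'" for e
  proof -
    obtain e' where e': "e' \<in> edges T" "e = \<phi> ` e'" using eT assms(4) by auto
    have "card e = card e'" unfolding e'(2) using inj inj_on_subset sub(1)[OF e'(1)] by (intro card_image) blast
    thus ?thesis using e' sub[OF e'(1)] v by auto
  qed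
  thus ?thesis using T uniq v unfolding finite_tree_def by auto
qed

text \<open>Solving \<open>mob v x = t * mob v w\<close> for \<open>x - v\<close>. The ribbon
  structure is tested on Euclidean circles about v, so Euclidean distance and direction of x from v
  have to be explicit.\<close>

lemma hseg_diff:
  assumes "cmod v < 1" "cmod w < 1" "x \<in> hseg v w"
  obtains t where "0 \<le> t" "t \<le> 1" "mob v x = of_real t * mob v w"
    "x - v = of_real (t * (1 - (cmod v)\<^sup>2)) * mob v w / (1 + cnj v * (of_real t * mob v w))"
proof -
  have x: "cmod x < 1" "mob v x \<in> closed_segment 0 (mob v w)" using assms mem_hseg_iff_mob by blast+
  then obtain t where t: "0 \<le> t" "t \<le> 1" "mob v x = of_real t * mob v w"
    unfolding closed_segment_0_iff by auto
  define a where "a = of_real t * mob v w"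
  have a1: "cmod a < 1" using cmod_mob_less_1[OF assms(1) x(1)] t(3) by (simp only: a_def)
  have nz: "1 + cnj v * a \<noteq> 0" using one_minus_cnj_mult_nonzero[of "-v" a] assms(1) a1 by simp
  have "x = mob (- v) (mob v x)" using mob_inverse(1)[OF assms(1) x(1)] by (simp only:)
  also have "\<dots> = (a + v) / (1 + cnj v * a)" unfolding t(3) a_def by simp
  finally have "x - v = (a + v - v * (1 + cnj v * a)) / (1 + cnj v * a)"
    using nz by (simp add: divide_diff_eq_iff)
  also have "a + v - v * (1 + cnj v * a) = a * (1 - v * cnj v)" by (simp add: algebra_simps)
  also have "1 - v * cnj v = of_real (1 - (cmod v)\<^sup>2)" using complex_norm_square[of v] by simp
  finally show thesis using t that by (simp add: a_def mult_ac)
qed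

text \<open>A geodesic meets each Euclidean circle about its end v at most once: with c =
  \<open>cnj v * mob v w\<close>, the distance from v is proportional to t / |1 + t c|, which is
  injective on [0, 1] because Re c > -1.\<close>

lemma hseg_eq_of_dist_eq:
  assumes vw: "cmod v < 1" "cmod w < 1" and x: "x \<in> hseg v w" "y \<in> hseg v w" "cmod (x - v) = cmod (y - v)"
  shows "x = y"
proof -
  obtain t where t: "0 \<le> t" "t \<le> 1" "mob v x = of_real t * mob v w"
    "x - v = of_real (t * (1 - (cmod v)\<^sup>2)) * mob v w / (1 + cnj v * (of_real t * mob v w))"
    using hseg_diff[OF vw x(1)] .
  obtain s where s: "0 \<le> s" "s \<le> 1" "mob v y = of_real s * mob v w"
    "y - v = of_real (s * (1 - (cmod v)\<^sup>2)) * mob v w / (1 + cnj v * (of_real s * mob v w))"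
    using hseg_diff[OF vw x(2)] .
  define a where "a = mob v w"
  have xy: "cmod x < 1" "cmod y < 1" using x hseg_subset[OF vw] by auto
  have a1: "cmod a < 1" using cmod_mob_less_1[OF vw] by (simp only: a_def)
  define c where "c = cnj v * a"
  have "cmod v * cmod a \<le> 1 * cmod a" using vw by (intro mult_right_mono) auto
  hence "cmod c < 1" using a1 by (simp add: c_def norm_mult)
  hence c1: "Re c > -1" using abs_Re_le_cmod[of c] by linarith
  \<comment> \<open>Squaring and subtracting leaves (s - t) (s + t + 2 s t Re c) = 0, whose second
    factor exceeds its value at Re c = -1 unless s t = 0, and is positive in either case.\<close>
  have key: "\<not> (t < s)" if e: "t * cmod (1 + of_real s * c) = s * cmod (1 + of_real t * c)" "0 \<le> t" "s \<le> 1" for t s :: real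
  proof
    assume ts: "t < s"
    have n: "(cmod (1 + of_real r * c))\<^sup>2 = 1 + 2 * r * Re c + r\<^sup>2 * (cmod c)\<^sup>2" for r
      unfolding cmod_power2 by (simp add: power2_eq_square algebra_simps)
    have "t\<^sup>2 * (cmod (1 + of_real s * c))\<^sup>2 = s\<^sup>2 * (cmod (1 + of_real t * c))\<^sup>2"
      using e(1) by (metis power_mult_distrib)
    hence "(s - t) * (s + t + 2 * s * t * Re c) = 0" unfolding n by (simp add: power2_eq_square algebra_simps)
    hence "s + t + 2 * s * t * Re c = 0" using ts by simp
    moreover have "2 * s * t * Re c \<ge> - (2 * s * t)"
      using c1 e(2) ts mult_left_mono[of "-1" "Re c" "2 * s * t"] by simp
    moreover have "s * t \<le> t" "s * t \<le> s" using e(2,3) ts by (auto intro: mult_left_le_one_le mult_right_le_one_le)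
    ultimately have "s + t \<le> 2 * (s * t)" "s * t \<le> t" by linarith+
    thus False using ts by linarith
  qed
  show ?thesis
  proof (cases "a = 0")
    case True
    hence "mob v x = 0" "mob v y = 0" using t(3) s(3) by (simp_all only: a_def[symmetric] mult_zero_right)
    thus ?thesis using mob_inverse(1)[OF vw(1) xy(1)] mob_inverse(1)[OF vw(1) xy(2)] by metis
  next
    case False
    define \<rho> where "\<rho> = 1 - (cmod v)\<^sup>2"
    have \<rho>: "\<rho> > 0" using vw by (simp add: \<rho>_def abs_square_less_1)
    have nz: "1 + of_real r * c \<noteq> 0" if "0 \<le> r" "r \<le> 1" for r :: real
    proof -
      have "cmod (of_real r * a) < 1" using a1 that mult_left_le_one_le[of "cmod a" r] by (simp add: norm_mult)
      thus ?thesis using one_minus_cnj_mult_nonzero[of "-v" "of_real r * a"] vw by (simp add: c_def mult_ac)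
    qed
    have "x - v = of_real (t * \<rho>) * a / (1 + of_real t * c)" "y - v = of_real (s * \<rho>) * a / (1 + of_real s * c)"
      using t(4)[folded a_def \<rho>_def] s(4)[folded a_def \<rho>_def]
      by (simp_all only: c_def mult.left_commute[of "cnj v"])
    hence "cmod (x - v) = t * \<rho> * cmod a / cmod (1 + of_real t * c)" "cmod (y - v) = s * \<rho> * cmod a / cmod (1 + of_real s * c)"
      using t(1) s(1) \<rho> by (simp_all add: norm_mult norm_divide)
    hence "t * \<rho> * cmod a / cmod (1 + of_real t * c) = s * \<rho> * cmod a / cmod (1 + of_real s * c)" using x(3) by simp
    hence "t * cmod (1 + of_real s * c) = s * cmod (1 + of_real t * c)"
      using nz[of t] nz[of s] t(1,2) s(1,2) \<rho> False by (simp add: field_simps)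
    hence "t = s" using key[of t s] key[of s t] t(1,2) s(1,2) by fastforce
    hence "mob v x = mob v y" using t(3) s(3) by (simp only:)
    thus ?thesis using mob_inverse(1)[OF vw(1) xy(1)] mob_inverse(1)[OF vw(1) xy(2)] by metis
  qed
qed

text \<open>The direction at \<open>v\<close> of the geodesic from \<open>v\<close> to \<open>w\<close> is that of \<open>mob v w\<close>, because the
  derivative of \<open>mob v\<close> at \<open>v\<close> is positive.\<close>

lemma ccw_angle_hseg_tendsto:
  assumes D: "cmod v < 1" "cmod w < 1" "cmod u < 1"
    and pos: "0 < Arg2pi (mob v u / mob v w)" and \<epsilon>: "\<epsilon> > 0"
  shows "\<exists>r0>0. \<forall>r x y. 0 < r \<longrightarrow> r < r0 \<longrightarrow> x \<in> hseg v w \<longrightarrow> y \<in> hseg v u \<longrightarrow> cmod (x - v) = r \<longrightarrow> cmod (y - v) = r \<longrightarrow>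
     \<bar>ccw_angle v x y - Arg2pi (mob v u / mob v w)\<bar> < \<epsilon>"
proof -
  define a where "a = mob v w"
  define b where "b = mob v u"
  define q where "q = b / a"
  \<comment> \<open>\<open>Arg2pi\<close> jumps along the positive real axis, so it is continuous at
    q only because the limiting angle is not 0.\<close>
  have Aq: "Arg2pi q > 0" using pos by (simp only: q_def a_def b_def)
  hence "q \<notin> \<real>\<^sub>\<ge>\<^sub>0" using Arg2pi_eq_0[of q] by (auto simp: complex_nonneg_Reals_iff complex_is_Real_iff)
  hence "isCont Arg2pi q" by (rule continuous_at_Arg2pi)
  then obtain \<eta> where \<eta>: "\<eta> > 0" "\<And>q'. cmod (q' - q) < \<eta> \<Longrightarrow> \<bar>Arg2pi q' - Arg2pi q\<bar> < \<epsilon>"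
    using \<epsilon> unfolding continuous_at_eps_delta dist_norm real_norm_def by metis
  \<comment> \<open>The 1/2 keeps the denominator \<open>1 + cnj v * z'\<close> away from 0; the
    second bound makes the final error \<open>4 * \<delta> * cmod q\<close> smaller than
    \<open>\<eta>\<close>.\<close>
  define \<delta> where "\<delta> = min (1/2) (\<eta> / (8 * (1 + cmod q)))"
  have cq: "1 + cmod q > 0" by (simp add: add_pos_nonneg)
  have \<delta>: "\<delta> > 0" "\<delta> \<le> 1/2" unfolding \<delta>_def using \<eta>(1) cq by (simp, intro min.cobounded1)
  have \<delta>q: "4 * \<delta> * cmod q < \<eta>"
  proof -
    have "\<delta> \<le> \<eta> / (8 * (1 + cmod q))" unfolding \<delta>_def by (rule min.cobounded2)
    moreover have "8 * (1 + cmod q) > 0" using cq by simp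
    ultimately have "\<delta> * (8 * (1 + cmod q)) \<le> \<eta>" by (metis pos_le_divide_eq)
    moreover have "4 * \<delta> * cmod q < \<delta> * (8 * (1 + cmod q))" using \<delta>(1) by (simp add: algebra_simps add_pos_nonneg)
    ultimately show ?thesis by linarith
  qed
  define \<rho> where "\<rho> = 1 - (cmod v)\<^sup>2"
  have \<rho>: "\<rho> > 0" using D(1) by (simp add: \<rho>_def abs_square_less_1)
  have near: "\<exists>t>0. cmod (of_real t * mob v w') < \<delta> \<and> cmod (of_real t * mob v w') < 1 \<and>
      x - v = of_real (t * \<rho>) * mob v w' / (1 + cnj v * (of_real t * mob v w'))"
    if x: "x \<in> hseg v w'" "0 < cmod (x - v)" "cmod (x - v) < \<rho> * \<delta> / 2" and w': "cmod w' < 1" for x w'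
  proof -
    obtain t where t: "0 \<le> t" "t \<le> 1" "mob v x = of_real t * mob v w'"
      "x - v = of_real (t * \<rho>) * mob v w' / (1 + cnj v * (of_real t * mob v w'))"
      using hseg_diff[OF D(1) w' x(1)] unfolding \<rho>_def by blast
    define z where "z = of_real t * mob v w'"
    have x1: "cmod x < 1" using x(1) hseg_subset[OF D(1) w'] by auto
    have z1: "cmod z < 1" using cmod_mob_less_1[OF D(1) x1] t(3) by (simp only: z_def)
    have n2: "cmod (1 + cnj v * z) \<le> 2"
    proof -
      have "cmod v * cmod z \<le> 1 * 1" using D(1) z1 by (intro mult_mono) auto
      thus ?thesis using norm_triangle_ineq[of 1 "cnj v * z"] by (simp add: norm_mult)
    qed
    have nz: "1 + cnj v * z \<noteq> 0" using one_minus_cnj_mult_nonzero[of "-v" z] D(1) z1 by simp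
    have "x - v = of_real \<rho> * z / (1 + cnj v * z)" using t(4) by (simp add: z_def mult_ac)
    hence e: "cmod (x - v) = \<rho> * cmod z / cmod (1 + cnj v * z)" using \<rho> by (simp add: norm_mult norm_divide)
    have "\<rho> * cmod z / 2 \<le> cmod (x - v)" unfolding e using \<rho> n2 nz by (intro divide_left_mono) auto
    hence "\<rho> * cmod z < \<rho> * \<delta>" using x(3) by linarith
    hence "cmod z < \<delta>" using \<rho> by simp
    moreover have "t > 0" using t(1,4) x(2) by (cases "t = 0") auto
    ultimately show ?thesis using t(4) z1 by (auto simp: z_def)
  qed
  show ?thesis
  proof (intro exI[of _ "\<rho> * \<delta> / 2"] conjI allI impI)
    show "0 < \<rho> * \<delta> / 2" using \<rho> \<delta> by simp
    fix r x y assume r: "0 < r" "r < \<rho> * \<delta> / 2" and x: "x \<in> hseg v w" "y \<in> hseg v u" "cmod (x - v) = r" "cmod (y - v) = r"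
    obtain t where t: "t > 0" "cmod (of_real t * a) < \<delta>" "cmod (of_real t * a) < 1"
      "x - v = of_real (t * \<rho>) * a / (1 + cnj v * (of_real t * a))"
      using near[OF x(1) _ _ D(2)] r x(3) unfolding a_def by auto
    obtain s where s: "s > 0" "cmod (of_real s * b) < \<delta>" "cmod (of_real s * b) < 1"
      "y - v = of_real (s * \<rho>) * b / (1 + cnj v * (of_real s * b))"
      using near[OF x(2) _ _ D(3)] r x(4) unfolding b_def by auto
    define z where "z = of_real t * a"
    define z' where "z' = of_real s * b"
    have zz: "cmod z < \<delta>" "cmod z' < \<delta>" "cmod z < 1" "cmod z' < 1" using t s by (auto simp: z_def z'_def)
    have nz: "1 + cnj v * z \<noteq> 0" "1 + cnj v * z' \<noteq> 0"
      using one_minus_cnj_mult_nonzero[of "-v" z] one_minus_cnj_mult_nonzero[of "-v" z'] D(1) zz by auto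
    define q' where "q' = q * ((1 + cnj v * z) / (1 + cnj v * z'))"
    have "(y - v) / (x - v) = of_real (s / t) * q'"
    proof -
      have "q \<noteq> 0" using Aq by auto
      hence a0: "a \<noteq> 0" by (auto simp: q_def)
      have alg: "(S * R * b / B) / (T * R * a / A) = (S / T) * ((b / a) * (A / B))"
        if "R \<noteq> 0" "T \<noteq> 0" "A \<noteq> 0" "B \<noteq> 0" for R S T A B :: complex
        using that a0 by (simp add: divide_simps)
      show ?thesis
        unfolding t(4) s(4) z_def[symmetric] z'_def[symmetric] q'_def q_def of_real_mult of_real_divide
        by (rule alg) (use nz t(1) \<rho> in auto)
    qed
    hence cc: "ccw_angle v x y = Arg2pi q'" unfolding ccw_angle_def using s(1) t(1)
      by (simp only: Arg2pi_times_of_real divide_pos_pos)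
    have le: "cmod (cnj v * z') \<le> 1/2"
    proof -
      have "cmod v * cmod z' \<le> 1 * (1/2)" using D(1) zz(2) \<delta>(2) by (intro mult_mono) auto
      thus ?thesis by (simp add: norm_mult)
    qed
    have lo: "1/2 \<le> cmod (1 + cnj v * z')" using norm_diff_ineq[of 1 "cnj v * z'"] le by simp
    have "q' - q = q * (cnj v * (z - z')) / (1 + cnj v * z')" using nz(2) by (simp add: q'_def field_simps)
    hence "cmod (q' - q) = cmod q * (cmod v * cmod (z - z')) / cmod (1 + cnj v * z')"
      by (simp add: norm_mult norm_divide)
    also have "\<dots> \<le> cmod q * (1 * (2 * \<delta>)) / (1/2)"
    proof (intro frac_le mult_left_mono mult_mono lo)
      show "cmod (z - z') \<le> 2 * \<delta>" using norm_triangle_ineq4[of z z'] zz by linarith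
    qed (use D(1) \<delta> in auto)
    also have "\<dots> = 4 * \<delta> * cmod q" by simp
    finally have "cmod (q' - q) < \<eta>" using \<delta>q by linarith
    thus "\<bar>ccw_angle v x y - Arg2pi (mob v u / mob v w)\<bar> < \<epsilon>"
      unfolding cc using \<eta>(2) by (simp only: q_def a_def b_def)
  qed
qed

text \<open>An edge is an unordered pair, so its arc is written as a union over both orders of the
  ends; these agree by \<open>hseg_commute\<close>. The cyclic order is transported along
  \<open>\<phi>\<close>.\<close>

definition realize :: "nat ribbon_graph \<Rightarrow> (nat \<Rightarrow> complex) \<Rightarrow> plane_ribbon_graph" where
  "realize T \<phi> = \<lparr>verts = \<phi> ` verts T, edges = (\<lambda>e. \<phi> ` e) ` edges T,
     nxt = (\<lambda>v e. \<phi> ` nxt T (the_inv_into (verts T) \<phi> v) (the_inv_into (verts T) \<phi> ` e)),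
     edge_arc = (\<lambda>e. \<Union>{hseg v w |v w. e = {v, w}})\<rparr>"

lemma edge_arc_realize:
  assumes "cmod v < 1" "cmod w < 1"
  shows "edge_arc (realize T \<phi>) {v, w} = hseg v w"
  using hseg_commute[OF assms] by (auto simp: realize_def doubleton_eq_iff)

lemma the_inv_into_image:
  assumes "inj_on \<phi> A" "e \<subseteq> A"
  shows "the_inv_into A \<phi> ` \<phi> ` e = e"
proof -
  have "the_inv_into A \<phi> ` \<phi> ` e = (\<lambda>x. x) ` e"
    unfolding image_image by (rule image_cong[OF refl]) (use assms in \<open>auto simp: the_inv_into_f_f\<close>)
  thus ?thesis by simp
qed

lemma pointed_ribbon_iso_realize:
  assumes "inj_on \<phi> (verts T)" "\<And>e. e \<in> edges T \<Longrightarrow> e \<subseteq> verts T"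
  shows "pointed_ribbon_iso T p (realize T \<phi>) (\<phi> p) \<phi>"
  using assms unfolding pointed_ribbon_iso_def
  by (auto simp: realize_def bij_betw_def edges_at_def the_inv_into_f_f the_inv_into_image)

lemma edges_at_realize:
  assumes "inj_on \<phi> (verts T)" "\<And>e. e \<in> edges T \<Longrightarrow> e \<subseteq> verts T" "i \<in> verts T"
  shows "edges_at (realize T \<phi>) (\<phi> i) = (\<lambda>e. \<phi> ` e) ` edges_at T i"
  using assms by (auto simp: edges_at_def realize_def dest: inj_onD)

text \<open>\<open>ord\<close> compares directions at a vertex, whereas
  \<open>ribbon_from_plane\<close> compares exit points on small circles. Strict inequalities
  between the limiting angles persist on small circles; if the successor is e' itself, both exit
  points coincide by \<open>hseg_eq_of_dist_eq\<close>.\<close>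

lemma pointed_ribbon_tree_in_disk_realize:
  assumes T: "pointed_ribbon_tree T p"
    and inj: "inj_on \<phi> (verts T)" and disk: "\<And>i. i \<in> verts T \<Longrightarrow> cmod (\<phi> i) < 1"
    and vert: "\<And>i j k. {i, j} \<in> edges T \<Longrightarrow> k \<in> verts T \<Longrightarrow> \<phi> k \<in> hseg (\<phi> i) (\<phi> j) \<Longrightarrow> k = i \<or> k = j"
    and cross: "\<And>i j k l z. {i, j} \<in> edges T \<Longrightarrow> {k, l} \<in> edges T \<Longrightarrow> {i, j} \<noteq> {k, l} \<Longrightarrow>
      z \<in> hseg (\<phi> i) (\<phi> j) \<Longrightarrow> z \<in> hseg (\<phi> k) (\<phi> l) \<Longrightarrow> z \<in> \<phi> ` ({i, j} \<inter> {k, l})"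
    and ord: "\<And>i j k m. {i, j} \<in> edges T \<Longrightarrow> {i, k} \<in> edges T \<Longrightarrow> j \<noteq> k \<Longrightarrow> nxt T i {i, j} = {i, m} \<Longrightarrow> m \<noteq> k \<Longrightarrow>
      {i, m} \<in> edges T \<Longrightarrow>
      0 < Arg2pi (mob (\<phi> i) (\<phi> m) / mob (\<phi> i) (\<phi> j)) \<and>
      Arg2pi (mob (\<phi> i) (\<phi> m) / mob (\<phi> i) (\<phi> j)) < Arg2pi (mob (\<phi> i) (\<phi> k) / mob (\<phi> i) (\<phi> j))"
  shows "pointed_ribbon_tree_in_disk (realize T \<phi>) (\<phi> p)"
proof -
  let ?R = "realize T \<phi>"
  have ft: "finite_tree T" and cyc: "\<And>v. v \<in> verts T \<Longrightarrow> edges_at T v \<noteq> {} \<Longrightarrow> cyclic_on (nxt T v) (edges_at T v)"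
    and pT: "p \<in> verts T" using T by (auto simp: pointed_ribbon_tree_def finite_ribbon_tree_def)
  have sub: "e \<subseteq> verts T" "card e = 2" if "e \<in> edges T" for e using ft that by (auto simp: finite_tree_def)
  have vR: "verts ?R = \<phi> ` verts T" and eR: "edges ?R = (\<lambda>e. \<phi> ` e) ` edges T" by (simp_all add: realize_def)
  have nR: "nxt ?R (\<phi> i) (\<phi> ` e) = \<phi> ` nxt T i e" if "i \<in> verts T" "e \<subseteq> verts T" for i e
    using that inj by (simp add: realize_def the_inv_into_f_f the_inv_into_image)
  have ear: "edges_at ?R (\<phi> i) = (\<lambda>e. \<phi> ` e) ` edges_at T i" if "i \<in> verts T" for i
    by (rule edges_at_realize[OF inj _ that]) (use sub in blast)
  have ends: "\<exists>i j. e = {i, j} \<and> i \<noteq> j \<and> i \<in> verts T \<and> j \<in> verts T" if "e \<in> edges T" for e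
    using sub[OF that] by (auto simp: card_2_iff)
  have arcR: "edge_arc ?R (\<phi> ` {i, j}) = hseg (\<phi> i) (\<phi> j)" if "{i, j} \<in> edges T" for i j
    using edge_arc_realize[of "\<phi> i" "\<phi> j"] disk sub(1)[OF that] by simp
  have other: "\<exists>j. e = {i, j} \<and> i \<noteq> j" if "e \<in> edges_at T i" for e i
    using ends[of e] that by (auto simp: edges_at_def doubleton_eq_iff)
  have edgeR: "\<exists>i j. {i, j} \<in> edges T \<and> i \<noteq> j \<and> e = \<phi> ` {i, j}" if "e \<in> edges ?R" for e
  proof -
    obtain e' where e': "e' \<in> edges T" "e = \<phi> ` e'" using \<open>e \<in> edges ?R\<close> unfolding eR by blast
    then obtain i j where "e' = {i, j}" "i \<noteq> j" using ends by metis
    thus ?thesis using e' by metis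
  qed
  have "finite_tree ?R" by (rule finite_tree_image[OF ft inj vR eR])
  moreover have "cyclic_on (nxt ?R v) (edges_at ?R v)" if v: "v \<in> verts ?R" "edges_at ?R v \<noteq> {}" for v
  proof -
    obtain i where i: "i \<in> verts T" "v = \<phi> i" using v vR by auto
    have "edges_at T i \<noteq> {}" using v(2) ear[OF i(1)] i(2) by auto
    hence "cyclic_on (nxt T i) (edges_at T i)" by (rule cyc[OF i(1)])
    thus ?thesis unfolding i(2) ear[OF i(1)]
      by (rule cyclic_on_image) (use nR[OF i(1)] sub(1) in \<open>auto simp: edges_at_def\<close>)
  qed
  ultimately have prt: "pointed_ribbon_tree ?R (\<phi> p)"
    using pT vR by (auto simp: pointed_ribbon_tree_def finite_ribbon_tree_def)
  have arcs: "\<exists>\<gamma>. arc \<gamma> \<and> path_image \<gamma> = edge_arc ?R e \<and> {pathstart \<gamma>, pathfinish \<gamma>} = e" if e: "e \<in> edges ?R" for e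
  proof -
    obtain i j where ij: "{i, j} \<in> edges T" "i \<noteq> j" "e = \<phi> ` {i, j}"
      using edgeR[OF e] by metis
    have v: "i \<in> verts T" "j \<in> verts T" using sub(1)[OF ij(1)] by auto
    hence "\<phi> i \<noteq> \<phi> j" using inj ij(2) by (auto dest: inj_onD)
    then obtain \<gamma> where "arc \<gamma>" "path_image \<gamma> = hseg (\<phi> i) (\<phi> j)" "pathstart \<gamma> = \<phi> i" "pathfinish \<gamma> = \<phi> j"
      using arc_hseg[OF disk[OF v(1)] disk[OF v(2)]] by blast
    thus ?thesis using arcR[OF ij(1)] ij(3) by auto
  qed
  have inD: "edge_arc ?R e \<subseteq> unit_disk \<and> edge_arc ?R e \<inter> verts ?R = e" if e: "e \<in> edges ?R" for e
  proof -
    obtain i j where ij: "{i, j} \<in> edges T" "e = \<phi> ` {i, j}"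
      using edgeR[OF e] by metis
    have v: "i \<in> verts T" "j \<in> verts T" using sub(1)[OF ij(1)] by auto
    note d = disk[OF v(1)] disk[OF v(2)]
    have "edge_arc ?R e = hseg (\<phi> i) (\<phi> j)" using arcR[OF ij(1)] ij(2) by simp
    thus ?thesis using hseg_subset[OF d] hseg_endpoints[OF d] vert[OF ij(1)] vR ij(2) v by auto
  qed
  have crossR: "edge_arc ?R e \<inter> edge_arc ?R e' \<subseteq> e \<inter> e'" if e: "e \<in> edges ?R" "e' \<in> edges ?R" "e \<noteq> e'" for e e'
  proof
    fix z assume z: "z \<in> edge_arc ?R e \<inter> edge_arc ?R e'"
    obtain i j where ij: "{i, j} \<in> edges T" "e = \<phi> ` {i, j}"
      using edgeR[OF e(1)] by metis
    obtain k l where kl: "{k, l} \<in> edges T" "e' = \<phi> ` {k, l}"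
      using edgeR[OF e(2)] by metis
    have "{i, j} \<noteq> {k, l}" using e(3) ij(2) kl(2) by auto
    hence "z \<in> \<phi> ` ({i, j} \<inter> {k, l})"
      using cross[OF ij(1) kl(1)] z arcR[OF ij(1)] arcR[OF kl(1)] ij(2) kl(2) by auto
    thus "z \<in> e \<inter> e'" using ij(2) kl(2) by blast
  qed
  have "ribbon_from_plane ?R" unfolding ribbon_from_plane_def
  proof
    fix v assume "v \<in> verts ?R"
    then obtain i where i: "i \<in> verts T" "v = \<phi> i" using vR by auto
    note di = disk[OF i(1)]
    have fe: "finite (edges_at T i)"
    proof (rule finite_subset)
      show "edges_at T i \<subseteq> Pow (verts T)" using sub(1) by (auto simp: edges_at_def)
      show "finite (Pow (verts T))" using ft by (simp add: finite_tree_def)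
    qed
    have fx: "x \<in> edge_arc ?R e \<and> cmod (x - v) = r" if ex: "first_exit (edge_arc ?R e) v r x" for e r x
    proof -
      obtain \<gamma> where "path_image \<gamma> \<subseteq> edge_arc ?R e" "pathfinish \<gamma> = x" "dist v x = r"
        using ex unfolding first_exit_def by blast
      thus ?thesis using pathfinish_in_path_image[of \<gamma>] by (auto simp: dist_norm norm_minus_commute)
    qed
    have one: "\<forall>\<^sub>F r in at_right 0. \<forall>x y z.
          first_exit (edge_arc ?R (\<phi> ` e)) v r x \<and> first_exit (edge_arc ?R (nxt ?R v (\<phi> ` e))) v r y \<and>
          first_exit (edge_arc ?R (\<phi> ` e')) v r z \<longrightarrow> ccw_angle v x y \<le> ccw_angle v x z"
      if e: "e \<in> edges_at T i" "e' \<in> edges_at T i - {e}" for e e'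
    proof -
      obtain j where j: "e = {i, j}" "i \<noteq> j" using other[OF e(1)] by blast
      obtain k where k: "e' = {i, k}" "i \<noteq> k" using other e(2) by blast
      have eE: "{i, j} \<in> edges T" "{i, k} \<in> edges T" using e j k by (auto simp: edges_at_def)
      have "nxt T i e \<in> edges_at T i" using cyc[OF i(1)] e(1) cyclic_on_inI by fastforce
      then obtain m where m: "nxt T i e = {i, m}" "i \<noteq> m" "{i, m} \<in> edges T" using other[of "nxt T i e" i] by (auto simp: edges_at_def)
      have jk: "j \<noteq> k" using e(2) j k by auto
      have dd: "cmod (\<phi> j) < 1" "cmod (\<phi> k) < 1" "cmod (\<phi> m) < 1"
        using disk sub(1)[OF eE(1)] sub(1)[OF eE(2)] sub(1)[OF m(3)] by auto
      have A: "edge_arc ?R (\<phi> ` e) = hseg v (\<phi> j)" "edge_arc ?R (\<phi> ` e') = hseg v (\<phi> k)"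
        "edge_arc ?R (nxt ?R v (\<phi> ` e)) = hseg v (\<phi> m)"
        using arcR[OF eE(1)] arcR[OF eE(2)] arcR[OF m(3)] nR[OF i(1), of e] sub(1)[OF eE(1)] j k m i(2) by auto
      show ?thesis
      proof (cases "m = k")
        case True
        show ?thesis
        proof (intro always_eventually allI impI)
          fix r x y z
          assume a: "first_exit (edge_arc ?R (\<phi> ` e)) v r x \<and> first_exit (edge_arc ?R (nxt ?R v (\<phi> ` e))) v r y \<and>
            first_exit (edge_arc ?R (\<phi> ` e')) v r z"
          have "y \<in> hseg v (\<phi> k)" "z \<in> hseg v (\<phi> k)" "cmod (y - v) = cmod (z - v)"
            using fx[OF conjunct1[OF conjunct2[OF a]]] fx[OF conjunct2[OF conjunct2[OF a]]]
            unfolding A True by auto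
          hence "y = z" using hseg_eq_of_dist_eq[of v "\<phi> k"] di i(2) dd by blast
          thus "ccw_angle v x y \<le> ccw_angle v x z" by simp
        qed
      next
        case False
        define \<alpha> where "\<alpha> = Arg2pi (mob (\<phi> i) (\<phi> m) / mob (\<phi> i) (\<phi> j))"
        define \<beta> where "\<beta> = Arg2pi (mob (\<phi> i) (\<phi> k) / mob (\<phi> i) (\<phi> j))"
        have ab: "0 < \<alpha>" "\<alpha> < \<beta>" using ord[OF eE jk _ False m(3)] m(1) j(1) by (auto simp: \<alpha>_def \<beta>_def)
        obtain r1 where r1: "r1 > 0" "\<And>r x y. 0 < r \<Longrightarrow> r < r1 \<Longrightarrow> x \<in> hseg v (\<phi> j) \<Longrightarrow> y \<in> hseg v (\<phi> m) \<Longrightarrow>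
            cmod (x - v) = r \<Longrightarrow> cmod (y - v) = r \<Longrightarrow> \<bar>ccw_angle v x y - \<alpha>\<bar> < (\<beta> - \<alpha>) / 2"
          using ccw_angle_hseg_tendsto[OF di dd(1,3), of "(\<beta> - \<alpha>) / 2"] ab unfolding \<alpha>_def[symmetric] i(2) by auto
        obtain r2 where r2: "r2 > 0" "\<And>r x y. 0 < r \<Longrightarrow> r < r2 \<Longrightarrow> x \<in> hseg v (\<phi> j) \<Longrightarrow> y \<in> hseg v (\<phi> k) \<Longrightarrow>
            cmod (x - v) = r \<Longrightarrow> cmod (y - v) = r \<Longrightarrow> \<bar>ccw_angle v x y - \<beta>\<bar> < (\<beta> - \<alpha>) / 2"
          using ccw_angle_hseg_tendsto[OF di dd(1,2), of "(\<beta> - \<alpha>) / 2"] ab unfolding \<beta>_def[symmetric] i(2) by auto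
        have "\<forall>\<^sub>F r in at_right (0::real). 0 < r \<and> r < min r1 r2"
          unfolding eventually_at_right_field using r1(1) r2(1) by (intro exI[of _ "min r1 r2"]) auto
        thus ?thesis
        proof eventually_elim
          case (elim r)
          show ?case
          proof (intro allI impI)
            fix x y z
            assume a: "first_exit (edge_arc ?R (\<phi> ` e)) v r x \<and> first_exit (edge_arc ?R (nxt ?R v (\<phi> ` e))) v r y \<and>
              first_exit (edge_arc ?R (\<phi> ` e')) v r z"
            have h: "x \<in> hseg v (\<phi> j)" "y \<in> hseg v (\<phi> m)" "z \<in> hseg v (\<phi> k)"
              "cmod (x - v) = r" "cmod (y - v) = r" "cmod (z - v) = r"
              using fx[OF conjunct1[OF a]] fx[OF conjunct1[OF conjunct2[OF a]]] fx[OF conjunct2[OF conjunct2[OF a]]]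
              unfolding A by auto
            have "\<bar>ccw_angle v x y - \<alpha>\<bar> < (\<beta> - \<alpha>) / 2" "\<bar>ccw_angle v x z - \<beta>\<bar> < (\<beta> - \<alpha>) / 2"
              using r1(2)[of r x y] r2(2)[of r x z] h elim by auto
            thus "ccw_angle v x y \<le> ccw_angle v x z" 
              using abs_ge_self[of "ccw_angle v x y - \<alpha>"] abs_ge_minus_self[of "ccw_angle v x z - \<beta>"] by argo
          qed
        qed
      qed
    qed
    have "\<forall>\<^sub>F r in at_right 0. \<forall>e\<in>edges_at T i. \<forall>e'\<in>edges_at T i - {e}. \<forall>x y z.
          first_exit (edge_arc ?R (\<phi> ` e)) v r x \<and> first_exit (edge_arc ?R (nxt ?R v (\<phi> ` e))) v r y \<and>
          first_exit (edge_arc ?R (\<phi> ` e')) v r z \<longrightarrow> ccw_angle v x y \<le> ccw_angle v x z"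
      using fe one by (intro eventually_ball_finite ballI) auto
    thus "\<forall>\<^sub>F r in at_right 0. \<forall>e\<in>edges_at ?R v. \<forall>e'\<in>edges_at ?R v - {e}. \<forall>x y z.
          first_exit (edge_arc ?R e) v r x \<and> first_exit (edge_arc ?R (nxt ?R v e)) v r y \<and>
          first_exit (edge_arc ?R e') v r z \<longrightarrow> ccw_angle v x y \<le> ccw_angle v x z"
    proof eventually_elim
      case (elim r)
      show ?case
      proof (intro ballI)
        fix E E' assume E: "E \<in> edges_at ?R v" "E' \<in> edges_at ?R v - {E}"
        obtain e where e: "e \<in> edges_at T i" "E = \<phi> ` e" using E(1) ear[OF i(1)] i(2) by auto
        obtain e' where e': "e' \<in> edges_at T i" "E' = \<phi> ` e'" using E(2) ear[OF i(1)] i(2) by auto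
        have "e' \<in> edges_at T i - {e}" using e e' E(2) by auto
        thus "\<forall>x y z. first_exit (edge_arc ?R E) v r x \<and> first_exit (edge_arc ?R (nxt ?R v E)) v r y \<and>
          first_exit (edge_arc ?R E') v r z \<longrightarrow> ccw_angle v x y \<le> ccw_angle v x z"
          using elim e e' by blast
      qed
    qed
  qed
  thus ?thesis unfolding pointed_ribbon_tree_in_disk_def
    using prt arcs inD crossR vR disk by auto
qed

subsection \<open>The limiting tree map\<close>

text \<open>With equal arguments the two radii are positive multiples of each other, and the shorter
  one is contained in the longer.\<close>

lemma Arg2pi_mob_eq_hseg:
  assumes D: "cmod v < 1" "cmod w < 1" "cmod u < 1" and nz: "mob v w \<noteq> 0" "mob v u \<noteq> 0"
    and eq: "Arg2pi (mob v w) = Arg2pi (mob v u)"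
  shows "w \<in> hseg v u \<or> u \<in> hseg v w"
proof -
  obtain x where x: "0 < x" "mob v w = of_real x * mob v u" using Arg2pi_eq_iff[OF nz] eq by blast
  show ?thesis
  proof (cases "x \<le> 1")
    case True
    hence "mob v w \<in> closed_segment 0 (mob v u)" unfolding closed_segment_0_iff using x by (intro bexI[of _ x]) auto
    hence "w \<in> hseg v u" using mem_hseg_iff_mob[OF D(1,3)] D(2) by blast
    thus ?thesis ..
  next
    case False
    have "mob v u = of_real (1 / x) * mob v w" unfolding x(2) using x(1) by simp
    moreover have "1 / x \<in> {0..1}" using x(1) False by simp
    ultimately have "mob v u \<in> closed_segment 0 (mob v w)" unfolding closed_segment_0_iff by blast
    hence "u \<in> hseg v w" using mem_hseg_iff_mob[OF D(1,2)] D(3) by blast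
    thus ?thesis ..
  qed
qed

lemma hseg_same_direction:
  assumes D: "cmod v < 1" "cmod w < 1" "cmod u < 1"
    and z: "z \<in> hseg v w" "z \<in> hseg v u" "z \<noteq> v"
  shows "Arg2pi (mob v w) = Arg2pi (mob v u)"
proof -
  have z1: "cmod z < 1" using z(1) hseg_subset[OF D(1,2)] by auto
  obtain t where t: "0 \<le> t" "mob v z = of_real t * mob v w" by (rule hseg_diff[OF D(1,2) z(1)])
  obtain s where s: "0 \<le> s" "mob v z = of_real s * mob v u" by (rule hseg_diff[OF D(1,3) z(2)])
  have nz: "mob v z \<noteq> 0"
  proof
    assume "mob v z = 0"
    hence "z = mob (- v) 0" using mob_inverse(1)[OF D(1) z1] by (simp only:)
    thus False using z(3) by simp
  qed
  have "t \<noteq> 0" "s \<noteq> 0" using nz t(2) s(2) by auto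
  hence "0 < t" "0 < s" using t(1) s(1) by auto
  hence "Arg2pi (of_real t * mob v w) = Arg2pi (mob v w)" "Arg2pi (of_real s * mob v u) = Arg2pi (mob v u)"
    by (simp_all only: Arg2pi_times_of_real)
  thus ?thesis using t(2) s(2) by (simp only:)
qed

lemma Arg2pi_divide_eq:
  assumes "a \<noteq> 0" "b \<noteq> 0" "c \<noteq> 0" "Arg2pi (b / a) = Arg2pi (c / a)"
  shows "Arg2pi b = Arg2pi c"
proof -
  obtain x where "0 < x" "b / a = of_real x * (c / a)" using Arg2pi_eq_iff[of "b / a" "c / a"] assms by auto
  hence "b = of_real x * c" using assms(1) by (simp add: field_simps)
  thus ?thesis using Arg2pi_eq_iff[OF assms(2,3)] \<open>0 < x\<close> by blast
qed

context asymptotic_tree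
begin

text \<open>Every set of the filter is infinite because of \<open>U \<le> sequentially\<close>, so s
  k can be chosen in the k-th set beyond the preceding index. Letting \<open>Q\<close> depend on k
  allows distances to exceed every bound while other constants stay fixed.\<close>

lemma extract_subsequence:
  assumes "U \<le> sequentially" "\<And>k :: nat. \<forall>\<^sub>F n in U. Q k n"
  obtains s where "strict_mono s" "\<And>k. Q k (s k)"
proof -
  have ex: "\<exists>n>m. Q k n" for m k
  proof -
    have "\<forall>\<^sub>F n in U. n > m" using assms(1) eventually_gt_at_top[of m] by (auto simp: le_filter_def)
    hence "\<forall>\<^sub>F n in U. n > m \<and> Q k n" using assms(2)[of k] by (rule eventually_conj)
    thus ?thesis using eventually_happens'[OF proper] by blast
  qed
  have "\<exists>s. \<forall>k. Q k (s k) \<and> s k < s (Suc k)"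
  proof (rule dependent_nat_choice)
    show "\<exists>x. Q 0 x" using ex by blast
    show "\<exists>y. Q (Suc n) y \<and> x < y" for x n using ex[of x "Suc n"] by blast
  qed
  then obtain s where "\<forall>k. Q k (s k) \<and> s k < s (Suc k)" by blast
  thus thesis using that by (auto simp: strict_mono_Suc_iff)
qed

lemma btw_of_hseg:
  assumes "x \<in> pts" "z \<in> pts" "\<forall>\<^sub>F n in U. y n \<in> hseg (x n) (z n)"
  shows "btw x y z"
  unfolding btw_def bdd_def
proof (intro exI[of _ 0])
  show "\<forall>\<^sub>F n in U. dst x y n + dst y z n - dst x z n \<le> 0"
    using assms(3) by eventually_elim (use assms(1,2) in \<open>simp add: mem_hseg_iff pts_def\<close>)
qed

lemma common_bound:
  assumes "finite I" "\<And>i. i \<in> I \<Longrightarrow> bdd (a i)"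
  obtains C where "C \<ge> 0" "\<forall>\<^sub>F n in U. \<forall>i\<in>I. a i n \<le> C"
proof -
  obtain c where c: "\<And>i. i \<in> I \<Longrightarrow> \<forall>\<^sub>F n in U. a i n \<le> c i" using assms(2) unfolding bdd_def by metis
  define C where "C = Max (insert 0 (c ` I))"
  have C: "0 \<le> C" "\<And>i. i \<in> I \<Longrightarrow> c i \<le> C" using assms(1) by (auto simp: C_def)
  have "\<forall>\<^sub>F n in U. \<forall>i\<in>I. a i n \<le> c i" using c assms(1) by (intro eventually_ball_finite) auto
  hence "\<forall>\<^sub>F n in U. \<forall>i\<in>I. a i n \<le> C"
  proof eventually_elim
    case (elim n) thus ?case using C(2) order_trans by blast
  qed
  thus thesis using that C(1) by blast
qed

end

context pcf_sequence
begin

text \<open>The tree lives on indices of representatives of \<open>V\<close>, hence does not depend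
  on n, and the sequences \<open>X i\<close> realise it. All statements still hold only along
  \<open>U\<close>; the isometry on edges and the return of the ends of a fixed edge are the data
  from which the bounds on edges are computed.\<close>

theorem tree_model:
  obtains T :: "nat ribbon_graph" and p F X where
    "pointed_ribbon_tree T p" "pointed_simplicial_map T p F"
    "\<And>i. i \<in> verts T \<Longrightarrow> X i \<in> pts"
    "\<forall>\<^sub>F n in U. pointed_ribbon_tree_in_disk (realize T (\<lambda>i. X i n)) (X p n)"
    "\<forall>\<^sub>F n in U. inj_on (\<lambda>i. X i n) (verts T)"
    "\<And>i j. i \<in> verts T \<Longrightarrow> j \<in> verts T \<Longrightarrow> i \<noteq> j \<Longrightarrow> \<not> near (X i) (X j)"
    "\<And>x. x \<in> P \<Longrightarrow> \<exists>i\<in>verts T. near x (X i)"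
    "\<And>i. i \<in> verts T \<Longrightarrow> near (ap (X i)) (X (F i))"
    "\<And>i j. {i, j} \<in> edges T \<Longrightarrow> bdd (\<lambda>n. dst (X i) (X j) n - dst (ap (X i)) (ap (X j)) n)"
    "\<And>e i q. e \<in> edges T \<Longrightarrow> (F ^^ q) ` e = e \<Longrightarrow> i \<in> e \<Longrightarrow> near ((ap ^^ q) (X i)) (X i)"
proof -
  obtain R where R: "finite R" "R \<subseteq> V" "\<And>x. x \<in> V \<Longrightarrow> \<exists>r\<in>R. near x r"
    "\<And>r s. r \<in> R \<Longrightarrow> s \<in> R \<Longrightarrow> near r s \<Longrightarrow> r = s"
    using near_reps[OF V_near_closed fin_near_V] by metis
  obtain h where h: "bij_betw h {0..<card R} R" using ex_bij_betw_nat_finite[OF R(1)] by blast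
  define S where "S = {0..<card R}"
  have hR: "h i \<in> R" if "i \<in> S" for i using h that by (auto simp: S_def bij_betw_def)
  have hV: "h i \<in> V" if "i \<in> S" for i using hR[OF that] R(2) by blast
  have hp: "h i \<in> pts" if "i \<in> S" for i using hV[OF that] V_pts by blast
  have rep: "\<exists>i\<in>S. near x (h i)" if x: "x \<in> V" for x
  proof -
    obtain r where r: "r \<in> R" "near x r" using R(3)[OF x] by blast
    have "r \<in> h ` S" using h r(1) by (simp add: S_def bij_betw_def)
    thus ?thesis using r(2) by blast
  qed
  have hinj: "i = j" if "i \<in> S" "j \<in> S" "near (h i) (h j)" for i j
  proof -
    have "h i = h j" using R(4)[OF hR[OF that(1)] hR[OF that(2)] that(3)] .
    thus ?thesis using h that(1,2) by (auto simp: S_def bij_betw_def dest: inj_onD)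
  qed
  \<comment> \<open>The fixed point 0 gives the base point of the tree; its representative
    \<open>h p\<close> is only near 0.\<close>
  define zz :: "nat \<Rightarrow> complex" where "zz = (\<lambda>_. 0)"
  have zz: "zz \<in> V" "zz \<in> pts" "ap zz = zz"
    using P0 P_V V_pts blaschke_products_0[OF f] by (auto simp: zz_def ap_def)
  obtain p where p: "p \<in> S" "near zz (h p)" using rep[OF zz(1)] by blast
  define Bt where "Bt i j k \<longleftrightarrow> btw (h i) (h j) (h k)" for i j k
  interpret fb: finite_betweenness S Bt
  proof
    show "finite S" by (simp add: S_def)
    show "S \<noteq> {}" using p by auto
    show "Bt x x y" for x y by (simp add: Bt_def)
    show "Bt x y z \<Longrightarrow> Bt z y x" for x y z unfolding Bt_def by (rule btw_sym)
    show "Bt x y w \<and> Bt y z w" if "x \<in> S" "y \<in> S" "z \<in> S" "w \<in> S" "Bt x y z" "Bt x z w" for x y z w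
      using btw_trans[OF that(5,6)[unfolded Bt_def] hp hp hp hp] that(1-4) by (simp add: Bt_def)
    show "y = z" if "x \<in> S" "y \<in> S" "z \<in> S" "Bt x y z" "Bt x z y" for x y z
      using hinj[OF that(2,3) btw_antisym[OF that(4,5)[unfolded Bt_def] hp[OF that(2)] hp[OF that(3)]]] .
    show "Bt x y w \<or> Bt x w y" if "x \<in> S" "y \<in> S" "z \<in> S" "w \<in> S" "Bt x y z" "Bt x w z" for x y z w
      using btw_linear[OF that(5,6)[unfolded Bt_def] hp hp hp hp] that(1-4) by (simp add: Bt_def)
    show "Bt x y w" if "x \<in> S" "y \<in> S" "z \<in> S" "w \<in> S" "Bt x y z" "Bt y z w" "y \<noteq> z" for x y z w
      using btw_extend(1)[OF that(5,6)[unfolded Bt_def] _ hp hp hp hp] hinj that by (auto simp: Bt_def)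
    show "\<exists>m\<in>S. Bt x m y \<and> Bt y m z \<and> Bt x m z" if xyz: "x \<in> S" "y \<in> S" "z \<in> S" for x y z
    proof -
      note pt = hp[OF xyz(1)] hp[OF xyz(2)] hp[OF xyz(3)]
      obtain m where m: "med (h x) (h y) (h z) m" using med_exists[OF pt] by blast
      have mV: "m \<in> V" using med_V[OF hV[OF xyz(1)] hV[OF xyz(2)] hV[OF xyz(3)] m] .
      obtain i where i: "i \<in> S" "near m (h i)" using rep[OF mV] by blast
      have mp: "m \<in> pts" using mV V_pts by blast
      have "btw (h x) m (h y)" "btw (h y) m (h z)" "btw (h x) m (h z)" using m by (auto simp: med_def)
      hence "Bt x i y" "Bt y i z" "Bt x i z" unfolding Bt_def
        using btw_near[OF _ near_refl i(2) near_refl _ mp _ _ hp[OF i(1)]] pt by blast+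
      thus ?thesis using i(1) by blast
    qed
  qed
  have adjS: "i \<in> S" "j \<in> S" "i \<noteq> j" if "fb.adj i j" for i j using that by (auto simp: fb.adj_def)
  have adjB: "k = i \<or> k = j" if "fb.adj i j" "k \<in> S" "Bt i k j" for i j k using that by (auto simp: fb.adj_def)
  have gapV: "near u (h i) \<or> near u (h j)" if a: "fb.adj i j" and u: "u \<in> V" "btw (h i) u (h j)" for i j u
  proof -
    obtain k where k: "k \<in> S" "near u (h k)" using rep[OF u(1)] by blast
    have "u \<in> pts" using u V_pts by blast
    hence "Bt i k j" unfolding Bt_def
      using btw_near[OF u(2) near_refl k(2) near_refl] hp adjS[OF a] k(1) by blast
    thus ?thesis using adjB[OF a k(1)] k(2) by blast
  qed
  have iso: "bdd (\<lambda>n. dst (h i) (h j) n - dst (ap (h i)) (ap (h j)) n)" if a: "fb.adj i j" for i j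
    by (rule V_isometric) (use hV adjS[OF a] gapV[OF a] in auto)
  define F where "F i = (SOME j. j \<in> S \<and> near (ap (h i)) (h j))" for i
  have F: "F i \<in> S" "near (ap (h i)) (h (F i))" if i: "i \<in> S" for i
  proof -
    have "\<exists>j. j \<in> S \<and> near (ap (h i)) (h j)" using rep[OF ap_V[OF hV[OF i]]] by blast
    from someI_ex[OF this] show "F i \<in> S" "near (ap (h i)) (h (F i))" by (auto simp: F_def)
  qed
  have app: "ap (h i) \<in> pts" if "i \<in> S" for i using ap_pts hp[OF that] by blast
  \<comment> \<open>Isometry on the edge prevents a collapse, and \<open>V_image_gap\<close>
    prevents a vertex from lying inside the image.\<close>
  have Fadj: "fb.adj (F i) (F j)" if a: "fb.adj i j" for i j
    unfolding fb.adj_def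
  proof (intro conjI ballI impI)
    note S = adjS[OF a]
    show "F i \<in> S" "F j \<in> S" using F S by auto
    show "F i \<noteq> F j"
    proof
      assume e: "F i = F j"
      have "near (ap (h i)) (h (F j))" using F(2)[OF S(1)] e by simp
      hence "near (ap (h i)) (ap (h j))"
        using near_trans near_sym[OF F(2)[OF S(2)]] app S hp F(1) by blast
      hence "near (h i) (h j)" unfolding near_def
        by (rule bdd_le2[OF iso[OF a], of _ _ 0]) simp
      thus False using hinj S by blast
    qed
    fix w assume w: "w \<in> S" "Bt (F i) w (F j)"
    have "btw (ap (h i)) (h w) (ap (h j))"
      using btw_near[OF w(2)[unfolded Bt_def] near_sym[OF F(2)[OF S(1)]] near_refl near_sym[OF F(2)[OF S(2)]]]
        hp F(1) app S w(1) by blast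
    hence "near (h w) (ap (h i)) \<or> near (h w) (ap (h j))"
      by (intro V_image_gap) (use hV S w(1) gapV[OF a] in auto)
    thus "w = F i \<or> w = F j"
    proof
      assume "near (h w) (ap (h i))"
      hence "near (h w) (h (F i))" using near_trans F S app hp w(1) by blast
      thus ?thesis using hinj w(1) F(1) S by blast
    next
      assume "near (h w) (ap (h j))"
      hence "near (h w) (h (F j))" using near_trans F S app hp w(1) by blast
      thus ?thesis using hinj w(1) F(1) S by blast
    qed
  qed
  have Fp: "F p = p"
  proof -
    have "near (ap (h p)) zz" using ap_near[OF near_sym[OF p(2)] hp[OF p(1)] zz(2)] zz(3) by simp
    hence "near (ap (h p)) (h p)" using near_trans p(2) app[OF p(1)] zz(2) hp[OF p(1)] by blast
    hence "near (h (F p)) (h p)" using near_trans[OF near_sym[OF F(2)[OF p(1)]]] app hp F(1) p(1) by blast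
    thus ?thesis using hinj F(1) p(1) by blast
  qed

  \<comment> \<open>General position for almost all n: distinct vertices (\<open>G1\<close>), no
    vertex on a foreign edge (\<open>G2\<close>), edges meeting only in common ends
    (\<open>G3\<close>), distinct directions of the edges at a vertex (\<open>G4\<close>).\<close>
  have G1: "\<forall>\<^sub>F n in U. h i n \<noteq> h j n" if "i \<in> S" "j \<in> S" "i \<noteq> j" for i j
  proof -
    have "\<not> bdd (dst (h i) (h j))" using hinj that by (auto simp: near_def)
    from not_bddD[OF this, of 0] show ?thesis by eventually_elim auto
  qed
  have nonseg: "\<forall>\<^sub>F n in U. h k n \<notin> hseg (h i n) (h j n)" if "i \<in> S" "j \<in> S" "\<not> Bt i k j" for i j k
    using ultra[of "\<lambda>n. h k n \<in> hseg (h i n) (h j n)"] btw_of_hseg[OF hp[OF that(1)] hp[OF that(2)], of "h k"] that(3)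
    unfolding Bt_def by blast
  have G2: "\<forall>\<^sub>F n in U. h k n \<notin> hseg (h i n) (h j n)" if a: "fb.adj i j" and k: "k \<in> S" "k \<noteq> i" "k \<noteq> j" for i j k
    by (rule nonseg) (use adjS[OF a] adjB[OF a] k in auto)
  define D where "D i j n = mob (h i n) (h j n)" for i j n
  have dk: "cmod (h i n) < 1" if "i \<in> S" for i n using hp[OF that] by (simp add: pts_def)
  have D0: "D i j n \<noteq> 0" if "i \<in> S" "j \<in> S" "h i n \<noteq> h j n" for i j n
  proof
    assume "D i j n = 0"
    hence "h j n = mob (- h i n) 0" using mob_inverse(1)[OF dk[OF that(1)] dk[OF that(2)], of n n] unfolding D_def by (simp only:)
    thus False using that(3) by simp
  qed
  \<comment> \<open>Equal directions would put one neighbour of i on the segment from i to the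
    other, which adjacency excludes.\<close>
  have G4: "\<forall>\<^sub>F n in U. Arg2pi (D i j n) \<noteq> Arg2pi (D i k n)" if a: "fb.adj i j" "fb.adj i k" "j \<noteq> k" for i j k
  proof -
    note S = adjS[OF a(1)] adjS[OF a(2)]
    have nB: "\<not> Bt i k j" "\<not> Bt i j k" using adjB[OF a(1), of k] adjB[OF a(2), of j] S a(3) by auto
    show ?thesis
      using nonseg[OF S(1,2) nB(1)] nonseg[OF S(1,5) nB(2)] G1[OF S(1,2,3)] G1[OF S(1,5,6)]
    proof eventually_elim
      case (elim n)
      show ?case
      proof
        assume "Arg2pi (D i j n) = Arg2pi (D i k n)"
        hence "h j n \<in> hseg (h i n) (h k n) \<or> h k n \<in> hseg (h i n) (h j n)"
          using Arg2pi_mob_eq_hseg[OF dk[OF S(1)] dk[OF S(2)] dk[OF S(5)], of n n n] D0[OF S(1,2) elim(3)] D0[OF S(1,5) elim(4)]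
          unfolding D_def by blast
        thus False using elim by blast
      qed
    qed
  qed
  \<comment> \<open>The version of \<open>G3\<close> in the limit: a point on two different edges is
    near a common end.\<close>
  have common: "\<exists>m\<in>{i, j} \<inter> {k, l}. near z (h m)"
    if a: "fb.adj i j" "fb.adj k l" "{i, j} \<noteq> {k, l}" and z: "z \<in> pts" "btw (h i) z (h j)" "btw (h k) z (h l)" for i j k l z
  proof -
    note S = adjS[OF a(1)] adjS[OF a(2)]
    note pt = hp[OF S(1)] hp[OF S(2)] hp[OF S(4)] hp[OF S(5)]
    have m1: ?thesis if m: "m \<in> {i, j}" "near z (h m)" for m
    proof -
      have mS: "m \<in> S" using m S by auto
      have "Bt k m l" unfolding Bt_def using btw_near[OF z(3) near_refl m(2) near_refl] pt z(1) hp[OF mS] by blast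
      thus ?thesis using adjB[OF a(2) mS] m by blast
    qed
    have m2: ?thesis if m: "m \<in> {k, l}" "near z (h m)" for m
    proof -
      have mS: "m \<in> S" using m S by auto
      have "Bt i m j" unfolding Bt_def using btw_near[OF z(2) near_refl m(2) near_refl] pt z(1) hp[OF mS] by blast
      thus ?thesis using adjB[OF a(1) mS] m by blast
    qed
    show ?thesis
    proof (rule ccontr)
      assume "\<not> ?thesis"
      hence n: "\<not> near z (h i)" "\<not> near z (h j)" "\<not> near z (h k)" "\<not> near z (h l)"
        using m1[of i] m1[of j] m2[of k] m2[of l] by blast+
      \<comment> \<open>An edge separates the tree: q lies beyond i or beyond j, according to the
        end at which its median with the edge falls.\<close>
      have side: "Bt j i q \<or> Bt i j q" if q: "q \<in> S" for q
      proof -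
        obtain m where m: "m \<in> S" "Bt i m j" "Bt j m q" "Bt i m q" using fb.Bt_med[OF S(1,2) q] by blast
        have "m = i \<or> m = j" using adjB[OF a(1) m(1,2)] .
        thus ?thesis using m by blast
      qed
      \<comment> \<open>If k and l both lie beyond the end b, the segment between them cannot reach
        the point z, which lies on the other side of b.\<close>
      have same: False if "btw a b (h k)" "btw a b (h l)" "btw a z b" "a \<in> pts" "b \<in> pts" "\<not> near z b" for a b
      proof -
        have zk: "btw z b (h k)" using btw_trans(2)[OF that(3,1) that(4) z(1) that(5) pt(3)] .
        have zl: "btw z b (h l)" using btw_trans(2)[OF that(3,2) that(4) z(1) that(5) pt(4)] .
        from btw_split[OF z(3) pt(3) z(1) pt(4) that(5)] show False
        proof
          assume "btw (h k) z b"
          hence "near z b" using btw_antisym[OF _ btw_sym[OF zk] z(1) that(5)] by blast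
          thus False using that(6) by blast
        next
          assume "btw b z (h l)"
          hence "near z b" using btw_antisym[OF btw_sym btw_sym[OF zl] z(1) that(5)] by blast
          thus False using that(6) by blast
        qed
      qed
      \<comment> \<open>If k and l lie beyond different ends, then i and j lie on the edge between k
        and l, so the two edges are equal.\<close>
      have opp: False if "Bt j i q" "Bt i j r" "{q, r} = {k, l}" for q r
      proof -
        have qS: "q \<in> S" "r \<in> S" using that(3) S by (auto simp: doubleton_eq_iff)
        have aqr: "fb.adj q r" using a(2) that(3) fb.adj_sym by (auto simp: doubleton_eq_iff)
        have qij: "Bt q i j" using fb.Bt_sym[OF S(2,1) qS(1) that(1)] .
        have "Bt q i r" using fb.Bt_extend[OF qS(1) S(1,2) qS(2) qij that(2) S(3)] .
        moreover have "Bt r j i" using fb.Bt_sym[OF S(1,2) qS(2) that(2)] .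
        hence "Bt r j q" using fb.Bt_extend[OF qS(2) S(2,1) qS(1) _ that(1)] S(3) by blast
        hence "Bt q j r" using fb.Bt_sym[OF qS(2) S(2) qS(1)] by blast
        ultimately have "i = q \<or> i = r" "j = q \<or> j = r" using adjB[OF aqr] S by blast+
        hence "{i, j} = {q, r}" using S(3) by auto
        thus False using a(3) that(3) by simp
      qed
      have zi: "btw (h j) z (h i)" using btw_sym[OF z(2)] .
      show False using side[OF S(4)] side[OF S(5)]
      proof (elim disjE)
        assume "Bt j i k" "Bt j i l"
        thus False using same[of "h j" "h i"] zi pt n by (simp add: Bt_def)
      next
        assume "Bt i j k" "Bt i j l"
        thus False using same[of "h i" "h j"] z(2) pt n by (simp add: Bt_def)
      next
        assume "Bt j i k" "Bt i j l"
        thus False by (rule opp) simp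
      next
        assume "Bt i j k" "Bt j i l"
        thus False by (intro opp[of l k]) auto
      qed
    qed
  qed
  have G3: "\<forall>\<^sub>F n in U. \<forall>z. z \<in> hseg (h i n) (h j n) \<longrightarrow> z \<in> hseg (h k n) (h l n) \<longrightarrow> z \<in> (\<lambda>m. h m n) ` ({i, j} \<inter> {k, l})"
    if a: "fb.adj i j" "fb.adj k l" "{i, j} \<noteq> {k, l}" for i j k l
  proof (rule ccontr)
    assume "\<not> ?thesis"
    hence ev: "\<forall>\<^sub>F n in U. \<exists>z. z \<in> hseg (h i n) (h j n) \<and> z \<in> hseg (h k n) (h l n) \<and> z \<notin> (\<lambda>m. h m n) ` ({i, j} \<inter> {k, l})"
      using ultra[of "\<lambda>n. \<forall>z. z \<in> hseg (h i n) (h j n) \<longrightarrow> z \<in> hseg (h k n) (h l n) \<longrightarrow> z \<in> (\<lambda>m. h m n) ` ({i, j} \<inter> {k, l})"]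
      by (auto elim: eventually_mono)
    note S = adjS[OF a(1)] adjS[OF a(2)]
    define Q where "Q n z \<longleftrightarrow> z \<in> hseg (h i n) (h j n) \<and> z \<in> hseg (h k n) (h l n) \<and> z \<notin> (\<lambda>m. h m n) ` ({i, j} \<inter> {k, l})" for n z
    \<comment> \<open>A sequence of offending intersection points, filled with 0 where there is none
      so as to stay in the disk.\<close>
    define z where "z n = (if \<exists>y. Q n y then SOME y. Q n y else 0)" for n
    have zQ: "Q n (z n)" if "\<exists>y. Q n y" for n using someI_ex[OF that] that by (simp add: z_def)
    have ev2: "\<forall>\<^sub>F n in U. Q n (z n)" using ev by eventually_elim (use zQ in \<open>auto simp: Q_def\<close>)
    have zp: "z \<in> pts" unfolding pts_def
    proof (intro CollectI allI)
      fix n show "cmod (z n) < 1"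
      proof (cases "\<exists>y. Q n y")
        case True
        thus ?thesis using zQ[OF True] hseg_subset[OF dk[OF S(1)] dk[OF S(2)], of n n] by (auto simp: Q_def)
      qed (simp add: z_def)
    qed
    have "\<forall>\<^sub>F n in U. z n \<in> hseg (h i n) (h j n)" "\<forall>\<^sub>F n in U. z n \<in> hseg (h k n) (h l n)"
      using ev2 by (auto simp: Q_def elim: eventually_mono)
    hence b: "btw (h i) z (h j)" "btw (h k) z (h l)" using btw_of_hseg hp S by blast+
    \<comment> \<open>In the limit the intersection is near a common end m. An intersection point
      different from m itself would give the two edges the same direction at m, against
      \<open>G4\<close>.\<close>
    obtain m where m: "m \<in> {i, j} \<inter> {k, l}" "near z (h m)" using common[OF a zp b] by blast
    obtain x where x: "{i, j} = {m, x}" "fb.adj m x" using m(1) a(1) fb.adj_sym by (auto simp: insert_commute)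
    obtain y where y: "{k, l} = {m, y}" "fb.adj m y" using m(1) a(2) fb.adj_sym by (auto simp: insert_commute)
    have xy: "x \<noteq> y" using x y a(3) by auto
    have sx: "hseg (h i n) (h j n) = hseg (h m n) (h x n)" for n
      using x(1) hseg_commute[OF dk[OF S(1), of n] dk[OF S(2), of n]] by (auto simp: doubleton_eq_iff)
    have sy: "hseg (h k n) (h l n) = hseg (h m n) (h y n)" for n
      using y(1) hseg_commute[OF dk[OF S(4), of n] dk[OF S(5), of n]] by (auto simp: doubleton_eq_iff)
    have "\<forall>\<^sub>F n in U. False" using ev2 G4[OF x(2) y(2) xy]
    proof eventually_elim
      case (elim n)
      have "z n \<noteq> h m n" using elim(1) m(1) by (auto simp: Q_def)
      moreover have "z n \<in> hseg (h m n) (h x n)" "z n \<in> hseg (h m n) (h y n)" using elim(1) sx sy by (auto simp: Q_def)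
      ultimately have "Arg2pi (D m x n) = Arg2pi (D m y n)" unfolding D_def
        using hseg_same_direction dk adjS[OF x(2)] adjS[OF y(2)] by blast
      thus False using elim(2) by blast
    qed
    thus False by (rule ev_False)
  qed

  define nb where "nb i = {j. fb.adj i j}" for i
  have nbS: "nb i \<subseteq> S" for i using adjS by (auto simp: nb_def)
  have nbf: "finite (nb i)" for i using nbS finite_subset[OF nbS] by (simp add: S_def)
  define \<Phi> where "\<Phi> i g \<longleftrightarrow> (nb i \<noteq> {} \<longrightarrow> cyclic_on g (nb i) \<and> (\<forall>\<^sub>F n in U. \<forall>a\<in>nb i. \<forall>b\<in>nb i. a \<noteq> b \<longrightarrow>
       g a \<noteq> a \<and> Arg2pi (D i (g a) n / D i a n) \<le> Arg2pi (D i b n / D i a n)))" for i g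
  have "\<exists>g. \<Phi> i g" for i
  proof (cases "nb i = {}")
    case False
    define W where "W n g \<longleftrightarrow> cyclic_on g (nb i) \<and> (\<forall>a\<in>nb i. \<forall>b\<in>nb i. a \<noteq> b \<longrightarrow>
       g a \<noteq> a \<and> Arg2pi (D i (g a) n / D i a n) \<le> Arg2pi (D i b n / D i a n))" for n g
    define G where "G n = (SOME g. W n g)" for n
    have "\<forall>\<^sub>F n in U. \<forall>a\<in>nb i. h i n \<noteq> h a n"
      using G1 adjS by (intro eventually_ball_finite[OF nbf]) (auto simp: nb_def)
    moreover have "\<forall>\<^sub>F n in U. \<forall>a\<in>nb i. \<forall>b\<in>nb i. a \<noteq> b \<longrightarrow> Arg2pi (D i a n) \<noteq> Arg2pi (D i b n)"
    proof (intro eventually_ball_finite[OF nbf] ballI)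
      fix a b assume "a \<in> nb i" "b \<in> nb i"
      thus "\<forall>\<^sub>F n in U. a \<noteq> b \<longrightarrow> Arg2pi (D i a n) \<noteq> Arg2pi (D i b n)"
        using G4[of i a b] by (cases "a = b") (auto simp: nb_def)
    qed
    ultimately have evG: "\<forall>\<^sub>F n in U. W n (G n)"
    proof eventually_elim
      case (elim n)
      have "\<exists>g. W n g"
      proof (rule cyclic_successor_by_angle[OF nbf False, of "\<lambda>a. D i a n"])
        show "D i a n \<noteq> 0" if "a \<in> nb i" for a
          using D0[of i a n] elim(1) that adjS[of i a] by (auto simp: nb_def)
        show "Arg2pi (D i a n) \<noteq> Arg2pi (D i b n)" if "a \<in> nb i" "b \<in> nb i" "a \<noteq> b" for a b
          using elim(2) that by blast
      qed (auto simp: W_def)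
      thus ?case unfolding G_def by (rule someI_ex)
    qed
    \<comment> \<open>The successor of a neighbour takes values in a finite set and is therefore
      constant along \<open>U\<close>; this makes the ribbon structure independent of n.\<close>
    have "\<exists>b\<in>nb i. \<forall>\<^sub>F n in U. G n a = b" if a: "a \<in> nb i" for a
    proof (rule ev_ex_finite[OF nbf])
      show "\<forall>\<^sub>F n in U. \<exists>b\<in>nb i. G n a = b"
        using evG by eventually_elim (use a cyclic_on_inI in \<open>auto simp: W_def\<close>)
    qed
    then obtain g where g: "\<And>a. a \<in> nb i \<Longrightarrow> \<forall>\<^sub>F n in U. G n a = g a" by metis
    have evg: "\<forall>\<^sub>F n in U. \<forall>a\<in>nb i. G n a = g a" using g by (intro eventually_ball_finite[OF nbf]) auto
    have Wg: "\<forall>\<^sub>F n in U. W n g" using evG evg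
    proof eventually_elim
      case (elim n)
      have "cyclic_on g (nb i) = cyclic_on (G n) (nb i)" by (rule cyclic_cong) (use elim(2) in auto)
      thus ?case using elim unfolding W_def by auto
    qed
    have "cyclic_on g (nb i)" using eventually_happens'[OF proper Wg] by (auto simp: W_def)
    moreover have "\<forall>\<^sub>F n in U. \<forall>a\<in>nb i. \<forall>b\<in>nb i. a \<noteq> b \<longrightarrow>
       g a \<noteq> a \<and> Arg2pi (D i (g a) n / D i a n) \<le> Arg2pi (D i b n / D i a n)"
      using Wg unfolding W_def by (rule eventually_mono) (erule conjunct2)
    ultimately have "\<Phi> i g" unfolding \<Phi>_def by (intro impI conjI)
    thus ?thesis by blast
  qed (simp add: \<Phi>_def)
  hence "\<exists>\<gamma>. \<forall>i. \<Phi> i (\<gamma> i)" by (intro choice allI)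
  then obtain \<gamma> where "\<forall>i. \<Phi> i (\<gamma> i)" by blast
  hence \<gamma>: "\<And>i. nb i \<noteq> {} \<Longrightarrow> cyclic_on (\<gamma> i) (nb i)"
    "\<And>i. nb i \<noteq> {} \<Longrightarrow> \<forall>\<^sub>F n in U. \<forall>a\<in>nb i. \<forall>b\<in>nb i. a \<noteq> b \<longrightarrow>
       \<gamma> i a \<noteq> a \<and> Arg2pi (D i (\<gamma> i a) n / D i a n) \<le> Arg2pi (D i b n / D i a n)"
    unfolding \<Phi>_def by blast+

  define T :: "nat ribbon_graph" where
    "T = \<lparr>verts = S, edges = {{u, v} |u v. fb.adj u v}, nxt = (\<lambda>i e. {i, \<gamma> i (THE j. e = {i, j})})\<rparr>"
  have vT: "verts T = S" and eT: "edges T = {{u, v} |u v. fb.adj u v}" by (simp_all add: T_def)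
  have eA: "{i, j} \<in> edges T \<longleftrightarrow> fb.adj i j" for i j
    unfolding eT using fb.adj_sym by (auto simp: doubleton_eq_iff)
  have the: "(THE k. {i, j} = {i, k}) = j" for i j :: nat
    by (rule the_equality) (auto simp: doubleton_eq_iff)
  have nT: "nxt T i {i, j} = {i, \<gamma> i j}" for i j by (simp add: T_def the)
  have eat: "edges_at T i = (\<lambda>j. {i, j}) ` nb i" for i
  proof (intro equalityI subsetI)
    fix e assume "e \<in> edges_at T i"
    then obtain u v where "fb.adj u v" "e = {u, v}" "i \<in> e" by (auto simp: edges_at_def eT)
    thus "e \<in> (\<lambda>j. {i, j}) ` nb i" using fb.adj_sym by (auto simp: nb_def insert_commute)
  next
    fix e assume "e \<in> (\<lambda>j. {i, j}) ` nb i"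
    thus "e \<in> edges_at T i" using eA by (auto simp: edges_at_def nb_def)
  qed
  have ftree: "finite_tree T" by (rule fb.finite_tree_adj[OF vT eT])
  have prt: "pointed_ribbon_tree T p"
    unfolding pointed_ribbon_tree_def finite_ribbon_tree_def
  proof (intro conjI ballI impI ftree)
    show "p \<in> verts T" using p(1) vT by simp
    fix i assume i: "i \<in> verts T" "edges_at T i \<noteq> {}"
    have "nb i \<noteq> {}" using i(2) eat by auto
    thus "cyclic_on (nxt T i) (edges_at T i)" unfolding eat
      by (intro cyclic_on_image[OF \<gamma>(1)]) (simp_all add: nT)
  qed
  have psm: "pointed_simplicial_map T p F" unfolding pointed_simplicial_map_def
    using F(1) Fadj Fp by (fastforce simp: vT eT)
  have evinj: "\<forall>\<^sub>F n in U. inj_on (\<lambda>i. h i n) (verts T)"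
  proof -
    have "\<forall>\<^sub>F n in U. \<forall>i\<in>S. \<forall>j\<in>S. i \<noteq> j \<longrightarrow> h i n \<noteq> h j n"
    proof (intro eventually_ball_finite ballI)
      fix i j assume "i \<in> S" "j \<in> S"
      thus "\<forall>\<^sub>F n in U. i \<noteq> j \<longrightarrow> h i n \<noteq> h j n" using G1[of i j] by (cases "i = j") auto
    qed (simp_all add: S_def)
    thus ?thesis by eventually_elim (auto simp: inj_on_def vT)
  qed
  have evdisk: "\<forall>\<^sub>F n in U. pointed_ribbon_tree_in_disk (realize T (\<lambda>i. h i n)) (h p n)"
  proof -
    have fS: "finite S" by (simp add: S_def)
    have e2: "\<forall>\<^sub>F n in U. \<forall>i\<in>S. \<forall>j\<in>S. \<forall>k\<in>S. fb.adj i j \<longrightarrow> k \<noteq> i \<longrightarrow> k \<noteq> j \<longrightarrow> h k n \<notin> hseg (h i n) (h j n)"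
    proof (intro eventually_ball_finite[OF fS] ballI)
      fix i j k assume "i \<in> S" "j \<in> S" "k \<in> S"
      thus "\<forall>\<^sub>F n in U. fb.adj i j \<longrightarrow> k \<noteq> i \<longrightarrow> k \<noteq> j \<longrightarrow> h k n \<notin> hseg (h i n) (h j n)"
        using G2[of i j k] by (cases "fb.adj i j \<and> k \<noteq> i \<and> k \<noteq> j") auto
    qed
    have e3: "\<forall>\<^sub>F n in U. \<forall>i\<in>S. \<forall>j\<in>S. \<forall>k\<in>S. \<forall>l\<in>S. fb.adj i j \<longrightarrow> fb.adj k l \<longrightarrow> {i, j} \<noteq> {k, l} \<longrightarrow>
       (\<forall>z. z \<in> hseg (h i n) (h j n) \<longrightarrow> z \<in> hseg (h k n) (h l n) \<longrightarrow> z \<in> (\<lambda>m. h m n) ` ({i, j} \<inter> {k, l}))"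
    proof (intro eventually_ball_finite[OF fS] ballI)
      fix i j k l assume "i \<in> S" "j \<in> S" "k \<in> S" "l \<in> S"
      show "\<forall>\<^sub>F n in U. fb.adj i j \<longrightarrow> fb.adj k l \<longrightarrow> {i, j} \<noteq> {k, l} \<longrightarrow>
       (\<forall>z. z \<in> hseg (h i n) (h j n) \<longrightarrow> z \<in> hseg (h k n) (h l n) \<longrightarrow> z \<in> (\<lambda>m. h m n) ` ({i, j} \<inter> {k, l}))"
      proof (cases "fb.adj i j \<and> fb.adj k l \<and> {i, j} \<noteq> {k, l}")
        case True
        hence "fb.adj i j" "fb.adj k l" "{i, j} \<noteq> {k, l}" by auto
        from G3[OF this] show ?thesis by eventually_elim blast
      next
        case False
        thus ?thesis by (intro always_eventually) blast
      qed
    qed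
    have e4: "\<forall>\<^sub>F n in U. \<forall>i\<in>S. \<forall>j\<in>S. \<forall>k\<in>S. fb.adj i j \<longrightarrow> fb.adj i k \<longrightarrow> j \<noteq> k \<longrightarrow> Arg2pi (D i j n) \<noteq> Arg2pi (D i k n)"
    proof (intro eventually_ball_finite[OF fS] ballI)
      fix i j k assume "i \<in> S" "j \<in> S" "k \<in> S"
      thus "\<forall>\<^sub>F n in U. fb.adj i j \<longrightarrow> fb.adj i k \<longrightarrow> j \<noteq> k \<longrightarrow> Arg2pi (D i j n) \<noteq> Arg2pi (D i k n)"
        using G4[of i j k] by (cases "fb.adj i j \<and> fb.adj i k \<and> j \<noteq> k") auto
    qed
    have e5: "\<forall>\<^sub>F n in U. \<forall>i\<in>S. nb i \<noteq> {} \<longrightarrow> (\<forall>a\<in>nb i. \<forall>b\<in>nb i. a \<noteq> b \<longrightarrow>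
       \<gamma> i a \<noteq> a \<and> Arg2pi (D i (\<gamma> i a) n / D i a n) \<le> Arg2pi (D i b n / D i a n))"
    proof (intro eventually_ball_finite[OF fS] ballI)
      fix i assume "i \<in> S"
      show "\<forall>\<^sub>F n in U. nb i \<noteq> {} \<longrightarrow> (\<forall>a\<in>nb i. \<forall>b\<in>nb i. a \<noteq> b \<longrightarrow>
       \<gamma> i a \<noteq> a \<and> Arg2pi (D i (\<gamma> i a) n / D i a n) \<le> Arg2pi (D i b n / D i a n))"
        using \<gamma>(2)[of i] by (cases "nb i = {}") (auto elim: eventually_mono)
    qed
    show ?thesis using evinj e2 e3 e4 e5
    proof eventually_elim
      case (elim n)
      have hne: "h i n \<noteq> h j n" if "i \<in> S" "j \<in> S" "i \<noteq> j" for i j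
        using elim(1) that by (auto simp: vT dest: inj_onD)
      show ?case
      proof (rule pointed_ribbon_tree_in_disk_realize[OF prt elim(1)])
        show "cmod (h i n) < 1" if "i \<in> verts T" for i using dk that vT by simp
        show "k = i \<or> k = j" if "{i, j} \<in> edges T" "k \<in> verts T" "h k n \<in> hseg (h i n) (h j n)" for i j k
          using elim(2) that adjS[of i j] eA vT by blast
        show "z \<in> (\<lambda>i. h i n) ` ({i, j} \<inter> {k, l})"
          if "{i, j} \<in> edges T" "{k, l} \<in> edges T" "{i, j} \<noteq> {k, l}"
            "z \<in> hseg (h i n) (h j n)" "z \<in> hseg (h k n) (h l n)" for i j k l z
        proof -
          have a: "fb.adj i j" "fb.adj k l" using that(1,2) eA by auto
          show ?thesis using elim(3)[rule_format, OF adjS(1,2)[OF a(1)] adjS(1,2)[OF a(2)] a that(3-5)] .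
        qed
        fix i j k m
        assume e: "{i, j} \<in> edges T" "{i, k} \<in> edges T" "j \<noteq> k" "nxt T i {i, j} = {i, m}" "m \<noteq> k" "{i, m} \<in> edges T"
        have a: "fb.adj i j" "fb.adj i k" "fb.adj i m" using e eA by auto
        note Sj = adjS[OF a(1)] and Sk = adjS[OF a(2)] and Sm = adjS[OF a(3)]
        have "{i, \<gamma> i j} = {i, m}" using e(4) nT by simp
        hence m: "\<gamma> i j = m" using Sm(3) by (auto simp: doubleton_eq_iff)
        have nb: "j \<in> nb i" "k \<in> nb i" using a by (auto simp: nb_def)
        hence g: "m \<noteq> j" "Arg2pi (D i m n / D i j n) \<le> Arg2pi (D i k n / D i j n)"
          using elim(5) Sj(1) e(3) m by blast+
        have nz: "D i j n \<noteq> 0" "D i k n \<noteq> 0" "D i m n \<noteq> 0"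
          using D0 hne Sj Sk Sm by auto
        \<comment> \<open>Distinct directions turn the weak inequality of the angular successor into
          the strict ones that \<open>ord\<close> asks for.\<close>
        have "Arg2pi (D i m n) \<noteq> Arg2pi (D i j n)" "Arg2pi (D i m n) \<noteq> Arg2pi (D i k n)"
          using elim(4) a Sj Sk Sm g(1) e(5) by blast+
        hence "Arg2pi (D i m n / D i j n) \<noteq> Arg2pi (D i j n / D i j n)" "Arg2pi (D i m n / D i j n) \<noteq> Arg2pi (D i k n / D i j n)"
          using Arg2pi_divide_eq[OF nz(1,3,1)] Arg2pi_divide_eq[OF nz(1,3,2)] by blast+
        moreover have "Arg2pi (D i j n / D i j n) = 0" using nz(1) by (simp add: Arg2pi_eq_0)
        moreover have "Arg2pi (D i m n / D i j n) \<ge> 0" using Arg2pi by blast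
        ultimately have "0 < Arg2pi (D i m n / D i j n) \<and> Arg2pi (D i m n / D i j n) < Arg2pi (D i k n / D i j n)"
          using g(2) by linarith
        thus "0 < Arg2pi (mob (h i n) (h m n) / mob (h i n) (h j n)) \<and>
          Arg2pi (mob (h i n) (h m n) / mob (h i n) (h j n)) < Arg2pi (mob (h i n) (h k n) / mob (h i n) (h j n))"
          by (simp only: D_def)
      qed
    qed
  qed
  have FqS: "(F ^^ q) i \<in> S" if "i \<in> S" for q i using that F(1) by (induction q) auto
  have Fq: "near ((ap ^^ q) (h i)) (h ((F ^^ q) i))" if i: "i \<in> S" for q i
  proof (induction q)
    case (Suc q)
    note s = FqS[OF i, of q]
    have "near (ap ((ap ^^ q) (h i))) (ap (h ((F ^^ q) i)))"
      using ap_near[OF Suc] funpow_pts hp[OF i] hp[OF s] by blast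
    hence "near (ap ((ap ^^ q) (h i))) (h (F ((F ^^ q) i)))"
      using near_trans[OF _ F(2)[OF s]] ap_pts funpow_pts hp[OF i] hp[OF s] hp[OF F(1)[OF s]] by blast
    thus ?case by simp
  qed simp
  have Oq: "(ap ^^ q) zz = zz" for q using zz(3) by (induction q) auto
  have shrink: "bdd (\<lambda>n. dst zz (h ((F ^^ q) i)) n - dst zz (h i) n)" if i: "i \<in> S" for q i
  proof (rule bdd_le[of _ _ 0])
    show "bdd (dst ((ap ^^ q) (h i)) (h ((F ^^ q) i)))" using Fq[OF i] by (simp add: near_def)
    fix n show "dst zz (h ((F ^^ q) i)) n - dst zz (h i) n \<le> dst ((ap ^^ q) (h i)) (h ((F ^^ q) i)) n + 0"
      using funpow_contract[OF zz(2) hp[OF i], of q n] dst_triangle[OF zz(2) funpow_pts[OF hp[OF i], of q] hp[OF FqS[OF i]], of n q]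
      by (simp add: Oq)
  qed
  text \<open>An iterate cannot flip an edge, since it does not increase the distance to the fixed point \<open>0\<close>.\<close>
  have noflip: "(F ^^ q) i = i" if a: "fb.adj i j" and q: "(F ^^ q) ` {i, j} = {i, j}" for i j q
  proof (rule ccontr)
    note S = adjS[OF a]
    note pt = hp[OF S(1)] hp[OF S(2)]
    assume "(F ^^ q) i \<noteq> i"
    hence fl: "(F ^^ q) i = j" "(F ^^ q) j = i" using q by (auto simp: doubleton_eq_iff)
    have b: "bdd (\<lambda>n. dst zz (h j) n - dst zz (h i) n)" "bdd (\<lambda>n. dst zz (h i) n - dst zz (h j) n)"
      using shrink[OF S(1), of q] shrink[OF S(2), of q] fl by simp_all
    \<comment> \<open>The projection of 0 to the edge belongs to \<open>V\<close> and is thus one of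
      its ends. Since both ends are equally far from 0 up to a bounded error, they would be near
      each other.\<close>
    obtain m where m: "med zz (h i) (h j) m" using med_exists[OF zz(2) pt] by blast
    have mV: "m \<in> V" using med_V[OF zz(1) hV[OF S(1)] hV[OF S(2)] m] .
    have mb: "btw zz m (h i)" "btw zz m (h j)" "btw (h i) m (h j)" "m \<in> pts" using m by (auto simp: med_def)
    have "near (h i) (h j)"
      using gapV[OF a mV mb(3)]
    proof
      assume "near m (h i)"
      hence "btw zz (h i) (h j)" using btw_near[OF mb(2) near_refl _ near_refl] zz(2) mb(4) pt by blast
      thus ?thesis unfolding near_def btw_def by (rule bdd_le2[OF _ b(1), of _ _ 0]) simp
    next
      assume "near m (h j)"
      hence "btw zz (h j) (h i)" using btw_near[OF mb(1) near_refl _ near_refl] zz(2) mb(4) pt by blast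
      thus ?thesis unfolding near_def btw_def
        by (rule bdd_le2[OF _ b(2), of _ _ 0]) (simp add: dst_commute[of "h i" _ "h j"])
    qed
    thus False using hinj S by blast
  qed
  have per: "near ((ap ^^ q) (h i)) (h i)" if e: "e \<in> edges T" "(F ^^ q) ` e = e" "i \<in> e" for e i q
  proof -
    obtain u v where uv: "fb.adj u v" "e = {u, v}" using e(1) by (auto simp: eT)
    obtain j where j: "fb.adj i j" "e = {i, j}" using uv e(3) fb.adj_sym by (auto simp: insert_commute)
    have "(F ^^ q) i = i" using noflip[OF j(1)] e(2) j(2) by simp
    thus ?thesis using Fq[OF adjS(1)[OF j(1)], of q] by simp
  qed
  show thesis
  proof (rule that[OF prt psm _ evdisk evinj])
    show "h i \<in> pts" if "i \<in> verts T" for i using hp that vT by simp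
    show "\<not> near (h i) (h j)" if "i \<in> verts T" "j \<in> verts T" "i \<noteq> j" for i j using hinj that vT by auto
    show "\<exists>i\<in>verts T. near x (h i)" if "x \<in> P" for x using rep P_V that vT by auto
    show "near (ap (h i)) (h (F i))" if "i \<in> verts T" for i using F(2) that vT by simp
    show "bdd (\<lambda>n. dst (h i) (h j) n - dst (ap (h i)) (ap (h j)) n)" if "{i, j} \<in> edges T" for i j
      using iso that eA by simp
    show "near ((ap ^^ q) (h i)) (h i)" if "e \<in> edges T" "(F ^^ q) ` e = e" "i \<in> e" for e i q
      by (rule per[OF that])
  qed
qed

end

section \<open>From statements along the ultrafilter to uniform constants on a subsequence\<close>

lemma hyp_dist_near_segment_point:
  assumes D: "cmod x < 1" "cmod y < 1" "cmod v < 1" "cmod w < 1"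
    and seg: "hyp_dist v x + hyp_dist x w = hyp_dist v w"
    and le: "hyp_dist y v \<le> hyp_dist v x + C" "hyp_dist y w \<le> hyp_dist x w + C"
  shows "hyp_dist y x \<le> C + 6"
  using hyp_dist_four_point[OF D(2,1,3,4)] seg le
  by (simp add: hyp_dist_commute[of x v] max_def split: if_splits)

text \<open>The point y is placed on the segment at distance s from a, cut off at b. Up to the
  constants, z is no further from the ends than y is, so one four-point inequality bounds their
  distance.\<close>

lemma near_geodesic_image:
  assumes D: "cmod z < 1" "cmod a < 1" "cmod b < 1"
    and st: "0 \<le> s" "0 \<le> t" "hyp_dist z a \<le> s + C" "hyp_dist z b \<le> t + C"
    and C: "0 \<le> C" "0 \<le> C'" and L: "s + t \<le> hyp_dist a b + C'"
  shows "\<exists>y\<in>hseg a b. hyp_dist z y \<le> C + C' + 6"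
proof -
  define r where "r = min s (hyp_dist a b)"
  obtain y where y: "y \<in> hseg a b" "hyp_dist a y = r" "hyp_dist y b = hyp_dist a b - r"
    by (rule hseg_point_at[OF D(2,3), of r]) (use st(1) hyp_dist_nonneg[OF D(2,3)] in \<open>auto simp: r_def\<close>)
  have y1: "cmod y < 1" using y(1) hseg_subset[OF D(2,3)] by auto
  have "hyp_dist z y + hyp_dist a b \<le> max (hyp_dist z a + hyp_dist y b) (hyp_dist z b + hyp_dist y a) + 6"
    by (rule hyp_dist_four_point[OF D(1) y1 D(2,3)])
  also have "hyp_dist y a = r" using y(2) by (simp add: hyp_dist_commute)
  also have "max (hyp_dist z a + hyp_dist y b) (hyp_dist z b + r) \<le> hyp_dist a b + C + C'"
    unfolding y(3) using st C L by (auto simp: r_def min_def)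
  finally show ?thesis using y(1) by (intro bexI[of _ y]) auto
qed

lemma blaschke_funpow:
  assumes f: "f \<in> blaschke_products d" "d \<ge> 1" and z: "cmod z < 1" "cmod w < 1"
  shows "cmod ((f ^^ q) z) < 1" "hyp_dist ((f ^^ q) z) ((f ^^ q) w) \<le> hyp_dist z w"
proof -
  have D: "cmod ((f ^^ q) u) < 1" if "cmod u < 1" for q u
    using that by (induction q) (auto intro: blaschke_products_unit_disk[OF f])
  show "cmod ((f ^^ q) z) < 1" using D z by blast
  show "hyp_dist ((f ^^ q) z) ((f ^^ q) w) \<le> hyp_dist z w"
  proof (induction q)
    case (Suc q)
    thus ?case using blaschke_products_contract[OF f D[OF z(1), of q] D[OF z(2), of q]] by simp
  qed simp
qed

theorem theorem2p2:
  fixes d :: nat and f :: "nat \<Rightarrow> complex \<Rightarrow> complex"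
  assumes "d \<ge> 2"
    and "\<And>n. f n \<in> blaschke_products d"
    and "quasi_pcf d f"
  shows "\<exists>(s :: nat \<Rightarrow> nat) (K :: real) (T :: nat ribbon_graph) p (F :: nat \<Rightarrow> nat)
           (Tn :: nat \<Rightarrow> plane_ribbon_graph) (pn :: nat \<Rightarrow> complex) (\<phi> :: nat \<Rightarrow> nat \<Rightarrow> complex).
      strict_mono s \<and> K > 0 \<and>
      pointed_ribbon_tree T p \<and>
      pointed_simplicial_map T p F \<and>
      (\<forall>n. pointed_ribbon_tree_in_disk (Tn n) (pn n)) \<and>
      (\<forall>n. pointed_ribbon_iso T p (Tn n) (pn n) (\<phi> n)) \<and>
      \<comment> \<open>degenerating tree\<close>
      (\<forall>v1\<in>verts T. \<forall>v2\<in>verts T. v1 \<noteq> v2 \<longrightarrow>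
         filterlim (\<lambda>n. hyp_dist (\<phi> n v1) (\<phi> n v2)) at_top sequentially) \<and>
      \<comment> \<open>geodesic edge\<close>
      (\<forall>v1 v2. {v1, v2} \<in> edges T \<longrightarrow>
         (\<forall>n. hyp_geodesic_segment (edge_arc (Tn n) (\<phi> n ` {v1, v2})) (\<phi> n v1) (\<phi> n v2))) \<and>
      \<comment> \<open>critically approximating\<close>
      (\<forall>n. \<forall>c\<in>unit_disk. deriv (f (s n)) c = 0 \<longrightarrow>
         (\<exists>w\<in>\<phi> n ` verts T. hyp_dist c w \<le> K)) \<and>
      \<comment> \<open>quasi-invariance on vertices\<close>
      (\<forall>v\<in>verts T. \<forall>n. hyp_dist (f (s n) (\<phi> n v)) (\<phi> n (F v)) \<le> K) \<and>
      \<comment> \<open>quasi-invariance on edges\<close>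
      (\<forall>e\<in>edges T. \<forall>n. \<forall>x\<in>edge_arc (Tn n) (\<phi> n ` e).
         \<exists>y\<in>edge_arc (Tn n) (\<phi> n ` (F ` e)). hyp_dist (f (s n) x) y \<le> K) \<and>
      (\<forall>e\<in>edges T. \<forall>q. edge_has_period F e q \<longrightarrow>
         (\<forall>n. \<forall>x\<in>edge_arc (Tn n) (\<phi> n ` e). hyp_dist ((f (s n) ^^ q) x) x \<le> K))"
proof -
  note fB = assms(2)
  have d1: "d \<ge> 1" using assms(1) by simp
  obtain U :: "nat filter" where U: "U \<noteq> bot" "U \<le> sequentially"
    "\<forall>P. eventually P U \<or> eventually (\<lambda>n. \<not> P n) U"
    using exists_free_ultrafilter by metis
  interpret blaschke_sequence U d f by unfold_locales (use U fB d1 in auto)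
  obtain K0 c where c: "\<And>n. critical_labelling d (f n) (\<lambda>i. c i n)"
    and pre: "\<And>i. i \<in> {1..d-1} \<Longrightarrow> \<exists>l q. q \<ge> 1 \<and>
           (\<forall>n. hyp_dist ((f n ^^ l) (c i n)) ((f n ^^ (l + q)) (c i n)) \<le> K0)"
    using assms(3) unfolding quasi_pcf_def K_quasi_pcf_def by metis
  obtain l q where lq: "\<And>i. i \<in> {1..d-1} \<Longrightarrow> q i \<ge> (1::nat)"
    "\<And>i n. i \<in> {1..d-1} \<Longrightarrow> hyp_dist ((f n ^^ l i) (c i n)) ((f n ^^ (l i + q i)) (c i n)) \<le> K0"
    using pre by metis
  have cp: "c i \<in> pts" if "i \<in> {1..d-1}" for i
    using c that by (auto simp: critical_labelling_def pts_def)
  have apq: "(ap ^^ k) x n = (f n ^^ k) (x n)" for k x n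
    by (induction k) (auto simp: ap_def)
  have app: "(ap ^^ k) x \<in> pts" if "x \<in> pts" for k x
    using that by (induction k) (auto intro: ap_pts)
  \<comment> \<open>Each critical orbit is cut at time l + q, where it is back within bounded
    distance of its point at time l. This makes the set finite and invariant up to
    \<open>near\<close>.\<close>
  define P where "P = insert (\<lambda>_. 0) (\<Union>i\<in>{1..d-1}. (\<lambda>k. (ap ^^ k) (c i)) ` {..<l i + q i})"
  have Pc: "(ap ^^ k) (c i) \<in> P" if "i \<in> {1..d-1}" "k < l i + q i" for i k
    unfolding P_def using that by blast
  have crit: "\<exists>i\<in>{1..d-1}. c i n = x" if "cmod x < 1" "deriv (f n) x = 0" for n x
    by (rule critical_labelling_complete[OF fB d1 c that])
  interpret pcf_sequence U d f P
  proof
    show "finite P" by (simp add: P_def)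
    show "P \<subseteq> pts" using app cp by (auto simp: P_def pts_def)
    show "(\<lambda>_. 0) \<in> P" by (simp add: P_def)
    show "\<exists>y\<in>P. near (ap x) y" if xP: "x \<in> P" for x
    proof -
      consider "x = (\<lambda>_. 0)" | i k where "i \<in> {1..d-1}" "k < l i + q i" "x = (ap ^^ k) (c i)"
        using xP unfolding P_def by blast
      thus ?thesis
      proof cases
        case 1
        have "ap x = x" using 1 blaschke_products_0[OF fB] by (auto simp: ap_def)
        thus ?thesis using xP near_refl by metis
      next
        case 2
        show ?thesis
        proof (cases "Suc k < l i + q i")
          case True
          thus ?thesis using Pc[OF 2(1) True] 2(3) near_refl by (metis funpow.simps(2) comp_apply)
        next
          case False
          hence k: "Suc k = l i + q i" using 2(2) by simp
          have "ap x = (ap ^^ (l i + q i)) (c i)" using 2(3) k by (metis funpow.simps(2) comp_apply)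
          hence "near (ap x) ((ap ^^ l i) (c i))" unfolding near_def
            by (intro bdd_const[of _ K0]) (use lq(2)[OF 2(1)] in \<open>simp add: apq hyp_dist_commute[of _ "(f _ ^^ l i) _"]\<close>)
          moreover have "l i < l i + q i" using lq(1)[OF 2(1)] by simp
          ultimately show ?thesis using Pc[OF 2(1)] by blast
        qed
      qed
    qed
    show "noncrit m" if m: "m \<in> pts" "\<And>p. p \<in> P \<Longrightarrow> \<not> near m p" for m
      unfolding noncrit_def
    proof
      fix B
      have "\<forall>\<^sub>F n in U. \<forall>i\<in>{1..d-1}. B < hyp_dist (m n) (c i n)"
      proof (intro eventually_ball_finite ballI)
        fix i assume i: "i \<in> {1..d-1}"
        have "0 < l i + q i" using lq(1)[OF i] by simp
        hence "\<not> near m (c i)" using m(2)[OF Pc[OF i, of 0]] by simp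
        thus "\<forall>\<^sub>F n in U. B < hyp_dist (m n) (c i n)" unfolding near_def by (rule not_bddD)
      qed simp
      thus "\<forall>\<^sub>F n in U. \<forall>x. cmod x < 1 \<longrightarrow> deriv (f n) x = 0 \<longrightarrow> B < hyp_dist (m n) x"
        by eventually_elim (use crit in blast)
    qed
  qed
  show ?thesis
  proof (rule tree_model)
    fix T :: "nat ribbon_graph" and p F X
    assume T: "pointed_ribbon_tree T p" and F: "pointed_simplicial_map T p F"
      and X: "\<And>i. i \<in> verts T \<Longrightarrow> X i \<in> pts"
      and disk: "\<forall>\<^sub>F n in U. pointed_ribbon_tree_in_disk (realize T (\<lambda>i. X i n)) (X p n)"
      and inj: "\<forall>\<^sub>F n in U. inj_on (\<lambda>i. X i n) (verts T)"
      and far: "\<And>i j. i \<in> verts T \<Longrightarrow> j \<in> verts T \<Longrightarrow> i \<noteq> j \<Longrightarrow> \<not> near (X i) (X j)"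
      and PX: "\<And>x. x \<in> P \<Longrightarrow> \<exists>i\<in>verts T. near x (X i)"
      and inv: "\<And>i. i \<in> verts T \<Longrightarrow> near (ap (X i)) (X (F i))"
      and iso: "\<And>i j. {i, j} \<in> edges T \<Longrightarrow> bdd (\<lambda>n. dst (X i) (X j) n - dst (ap (X i)) (ap (X j)) n)"
      and per: "\<And>e i q. e \<in> edges T \<Longrightarrow> (F ^^ q) ` e = e \<Longrightarrow> i \<in> e \<Longrightarrow> near ((ap ^^ q) (X i)) (X i)"
    have finT: "finite (verts T)" and sub: "\<And>e. e \<in> edges T \<Longrightarrow> e \<subseteq> verts T \<and> card e = 2"
      using T by (auto simp: pointed_ribbon_tree_def finite_ribbon_tree_def finite_tree_def)
    have finE: "finite (edges T)" by (rule finite_subset[of _ "Pow (verts T)"]) (use sub finT in auto)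
    have FT: "F i \<in> verts T" if "i \<in> verts T" for i using F that by (auto simp: pointed_simplicial_map_def)
    obtain C1 where C1: "C1 \<ge> 0" "\<forall>\<^sub>F n in U. \<forall>i\<in>verts T. dst (ap (X i)) (X (F i)) n \<le> C1"
      by (rule common_bound[OF finT, of "\<lambda>i. dst (ap (X i)) (X (F i))"]) (use inv in \<open>auto simp: near_def\<close>)
    have fin2: "finite {(i, j). {i, j} \<in> edges T}"
      by (rule finite_subset[of _ "verts T \<times> verts T"]) (use sub finT in auto)
    obtain C2 where C2: "C2 \<ge> 0" "\<forall>\<^sub>F n in U. \<forall>ij\<in>{(i, j). {i, j} \<in> edges T}.
        dst (X (fst ij)) (X (snd ij)) n - dst (ap (X (fst ij))) (ap (X (snd ij))) n \<le> C2"
      by (rule common_bound[OF fin2, of "\<lambda>ij n. dst (X (fst ij)) (X (snd ij)) n - dst (ap (X (fst ij))) (ap (X (snd ij))) n"])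
        (use iso in auto)
    have "\<exists>j\<in>verts T. near (c i) (X j)" if i: "i \<in> {1..d-1}" for i
      using PX[OF Pc[OF i, of 0]] lq(1)[OF i] by simp
    then obtain jc where jc: "\<And>i. i \<in> {1..d-1} \<Longrightarrow> jc i \<in> verts T"
      "\<And>i. i \<in> {1..d-1} \<Longrightarrow> near (c i) (X (jc i))" by metis
    obtain C3 where C3: "C3 \<ge> 0" "\<forall>\<^sub>F n in U. \<forall>i\<in>{1..d-1}. dst (c i) (X (jc i)) n \<le> C3"
      by (rule common_bound[of "{1..d-1}" "\<lambda>i. dst (c i) (X (jc i))"]) (use jc in \<open>auto simp: near_def\<close>)
    \<comment> \<open>The least period of an edge is unique, so one exponent per edge and hence one
      constant suffices. For edges that are not periodic the default 0 stands for the identity, so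
      \<open>qq_fix\<close> holds for all edges.\<close>
    define qq where "qq e = (if \<exists>q. edge_has_period F e q then SOME q. edge_has_period F e q else 0)" for e
    have qq: "q = qq e" if "edge_has_period F e q" for e q
    proof -
      have "edge_has_period F e (qq e)" using someI[of "edge_has_period F e", OF that] that by (auto simp: qq_def)
      thus ?thesis using that unfolding edge_has_period_def by (metis linorder_neqE_nat)
    qed
    have qq_fix: "(F ^^ qq e) ` e = e" for e
    proof (cases "\<exists>q. edge_has_period F e q")
      case True
      then obtain q where q: "edge_has_period F e q" by blast
      thus ?thesis using qq[OF q] by (simp add: edge_has_period_def)
    qed (simp add: qq_def)
    have fin4: "finite {(e, i). e \<in> edges T \<and> i \<in> e}"
      by (rule finite_subset[of _ "edges T \<times> verts T"]) (use sub finE finT in auto)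
    obtain C4 where C4: "C4 \<ge> 0" "\<forall>\<^sub>F n in U. \<forall>ei\<in>{(e, i). e \<in> edges T \<and> i \<in> e}.
        dst ((ap ^^ qq (fst ei)) (X (snd ei))) (X (snd ei)) n \<le> C4"
      by (rule common_bound[OF fin4, of "\<lambda>ei. dst ((ap ^^ qq (fst ei)) (X (snd ei))) (X (snd ei))"])
        (use per qq_fix in \<open>auto simp: near_def\<close>)
    define C where "C = C1 + C2 + C3 + C4"
    have C: "C1 \<le> C" "C2 \<le> C" "C3 \<le> C" "C4 \<le> C" "0 \<le> C" using C1(1) C2(1) C3(1) C4(1) by (auto simp: C_def)
    define Good where "Good n \<longleftrightarrow> pointed_ribbon_tree_in_disk (realize T (\<lambda>i. X i n)) (X p n) \<and>
       inj_on (\<lambda>i. X i n) (verts T) \<and>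
       (\<forall>i\<in>verts T. dst (ap (X i)) (X (F i)) n \<le> C) \<and>
       (\<forall>i j. {i, j} \<in> edges T \<longrightarrow> dst (X i) (X j) n - dst (ap (X i)) (ap (X j)) n \<le> C) \<and>
       (\<forall>i\<in>{1..d-1}. dst (c i) (X (jc i)) n \<le> C) \<and>
       (\<forall>e i. e \<in> edges T \<longrightarrow> i \<in> e \<longrightarrow> dst ((ap ^^ qq e) (X i)) (X i) n \<le> C)" for n
    have good: "\<forall>\<^sub>F n in U. Good n"
      using disk inj C1(2) C2(2) C3(2) C4(2)
    proof eventually_elim
      case (elim n)
      show ?case unfolding Good_def
      proof (intro conjI allI ballI impI)
        fix i j assume "{i, j} \<in> edges T"
        thus "dst (X i) (X j) n - dst (ap (X i)) (ap (X j)) n \<le> C" using elim(4) C(2) by force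
      next
        fix e i assume "e \<in> edges T" "i \<in> e"
        thus "dst ((ap ^^ qq e) (X i)) (X i) n \<le> C" using elim(6) C(4) by force
      next
        fix i assume "i \<in> verts T"
        hence "dst (ap (X i)) (X (F i)) n \<le> C1" using elim(3) by blast
        thus "dst (ap (X i)) (X (F i)) n \<le> C" using C(1) by linarith
      next
        fix i assume "i \<in> {1..d-1}"
        hence "dst (c i) (X (jc i)) n \<le> C3" using elim(5) by blast
        thus "dst (c i) (X (jc i)) n \<le> C" using C(3) by linarith
      qed (rule elim(1), rule elim(2))
    qed
    have "\<forall>\<^sub>F n in U. \<forall>i\<in>verts T. \<forall>j\<in>verts T. i \<noteq> j \<longrightarrow> real k < dst (X i) (X j) n" for k
    proof (intro eventually_ball_finite[OF finT] ballI)
      fix i j assume ij: "i \<in> verts T" "j \<in> verts T"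
      show "\<forall>\<^sub>F n in U. i \<noteq> j \<longrightarrow> real k < dst (X i) (X j) n"
      proof (cases "i = j")
        case False
        have "\<forall>\<^sub>F n in U. real k < dst (X i) (X j) n"
          using not_bddD[of "dst (X i) (X j)" "real k"] far[OF ij False] by (simp add: near_def)
        thus ?thesis by eventually_elim simp
      qed simp
    qed
    \<comment> \<open>The bounds in \<open>Good\<close> are fixed, while the separation of the
      vertices grows with k; along the extracted subsequence the tree therefore degenerates.\<close>
    moreover define Q where "Q k n \<longleftrightarrow> Good n \<and> (\<forall>i\<in>verts T. \<forall>j\<in>verts T. i \<noteq> j \<longrightarrow> real k < dst (X i) (X j) n)" for k n
    ultimately have evQ: "\<forall>\<^sub>F n in U. Q k n" for k
      unfolding Q_def using good by (intro eventually_conj)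
    have "\<exists>s. strict_mono s \<and> (\<forall>k. Q k (s k))"
      by (rule extract_subsequence[where Q = Q, OF U(2) evQ]) blast
    then obtain s where s: "strict_mono s"
      "\<And>k. Good (s k) \<and> (\<forall>i\<in>verts T. \<forall>j\<in>verts T. i \<noteq> j \<longrightarrow> real k < dst (X i) (X j) (s k))"
      unfolding Q_def by blast
    have gs: "Good (s k)" for k using s(2) by blast
    define \<phi> where "\<phi> n i = X i (s n)" for n i
    define Tn where "Tn n = realize T (\<phi> n)" for n
    \<comment> \<open>The largest error is 4 * C + 6, from \<open>near_geodesic_image\<close> with
      constants C and 3 * C.\<close>
    define K where "K = 4 * C + 7"
    have phi1: "cmod (\<phi> n i) < 1" if "i \<in> verts T" for n i using X[OF that] by (simp add: \<phi>_def pts_def)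
    have \<phi>eq: "\<phi> n = (\<lambda>i. X i (s n))" for n by (rule ext) (simp add: \<phi>_def)
    have ends: "\<exists>i j. e = {i, j} \<and> i \<in> verts T \<and> j \<in> verts T" if "e \<in> edges T" for e
      using sub[OF that] by (auto simp: card_2_iff)
    have earc: "edge_arc (Tn n) (\<phi> n ` {i, j}) = hseg (\<phi> n i) (\<phi> n j)" if "i \<in> verts T" "j \<in> verts T" for n i j
      using edge_arc_realize[OF phi1[OF that(1)] phi1[OF that(2)]] by (simp add: Tn_def)
    have fD: "cmod (f n z) < 1" if "cmod z < 1" for n z using blaschke_products_unit_disk[OF fB d1 that] .
    show ?thesis
    proof (rule exI[of _ s], rule exI[of _ K], rule exI[of _ T], rule exI[of _ p], rule exI[of _ F],
        rule exI[of _ Tn], rule exI[of _ "\<lambda>n. \<phi> n p"], rule exI[of _ \<phi>], intro conjI)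
      show "strict_mono s" by (rule s(1))
      show "K > 0" using C by (simp add: K_def)
      show "pointed_ribbon_tree T p" by (rule T)
      show "pointed_simplicial_map T p F" by (rule F)
      show "\<forall>n. pointed_ribbon_tree_in_disk (Tn n) (\<phi> n p)"
        using gs by (simp add: Good_def Tn_def \<phi>eq)
      show "\<forall>n. pointed_ribbon_iso T p (Tn n) (\<phi> n p) (\<phi> n)"
      proof
        fix n
        have "inj_on (\<phi> n) (verts T)" using gs[of n] by (simp add: Good_def \<phi>eq)
        thus "pointed_ribbon_iso T p (Tn n) (\<phi> n p) (\<phi> n)" unfolding Tn_def
          by (rule pointed_ribbon_iso_realize) (use sub in blast)
      qed
      show "\<forall>v1\<in>verts T. \<forall>v2\<in>verts T. v1 \<noteq> v2 \<longrightarrow>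
           filterlim (\<lambda>n. hyp_dist (\<phi> n v1) (\<phi> n v2)) at_top sequentially"
      proof (intro ballI impI)
        fix i j assume ij: "i \<in> verts T" "j \<in> verts T" "i \<noteq> j"
        show "filterlim (\<lambda>n. hyp_dist (\<phi> n i) (\<phi> n j)) at_top sequentially"
        proof (rule filterlim_at_top_mono[OF filterlim_real_sequentially])
          show "\<forall>\<^sub>F n in sequentially. real n \<le> hyp_dist (\<phi> n i) (\<phi> n j)"
            using s(2) ij by (intro always_eventually allI) (auto simp: \<phi>_def intro: less_imp_le)
        qed
      qed
      show "\<forall>v1 v2. {v1, v2} \<in> edges T \<longrightarrow>
           (\<forall>n. hyp_geodesic_segment (edge_arc (Tn n) (\<phi> n ` {v1, v2})) (\<phi> n v1) (\<phi> n v2))"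
      proof (intro allI impI)
        fix i j n assume e: "{i, j} \<in> edges T"
        have v: "i \<in> verts T" "j \<in> verts T" using sub[OF e] by auto
        show "hyp_geodesic_segment (edge_arc (Tn n) (\<phi> n ` {i, j})) (\<phi> n i) (\<phi> n j)"
          unfolding earc[OF v] by (rule hyp_geodesic_segment_hseg[OF phi1[OF v(1)] phi1[OF v(2)]])
      qed
      show "\<forall>n. \<forall>x\<in>unit_disk. deriv (f (s n)) x = 0 \<longrightarrow> (\<exists>w\<in>\<phi> n ` verts T. hyp_dist x w \<le> K)"
      proof (intro allI ballI impI)
        fix n x assume x: "x \<in> unit_disk" "deriv (f (s n)) x = 0"
        obtain i where i: "i \<in> {1..d-1}" "c i (s n) = x" using crit[of x "s n"] x by auto
        have "hyp_dist x (\<phi> n (jc i)) \<le> C" using gs[of n] i by (auto simp: Good_def \<phi>_def)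
        hence "hyp_dist x (\<phi> n (jc i)) \<le> K" using C by (simp add: K_def)
        thus "\<exists>w\<in>\<phi> n ` verts T. hyp_dist x w \<le> K" using jc(1)[OF i(1)] by blast
      qed
      have vinv: "hyp_dist (f (s n) (\<phi> n i)) (\<phi> n (F i)) \<le> C" if "i \<in> verts T" for n i
        using gs[of n] that by (simp add: Good_def \<phi>_def ap_def)
      show "\<forall>v\<in>verts T. \<forall>n. hyp_dist (f (s n) (\<phi> n v)) (\<phi> n (F v)) \<le> K"
      proof (intro ballI allI)
        fix i n assume "i \<in> verts T"
        from vinv[OF this, of n] show "hyp_dist (f (s n) (\<phi> n i)) (\<phi> n (F i)) \<le> K" using C(5) by (simp add: K_def)
      qed
      show "\<forall>e\<in>edges T. \<forall>n. \<forall>x\<in>edge_arc (Tn n) (\<phi> n ` e).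
           \<exists>y\<in>edge_arc (Tn n) (\<phi> n ` (F ` e)). hyp_dist (f (s n) x) y \<le> K"
      proof (intro ballI allI)
        fix e n x assume e: "e \<in> edges T" and x: "x \<in> edge_arc (Tn n) (\<phi> n ` e)"
        obtain i j where ij: "e = {i, j}" "i \<in> verts T" "j \<in> verts T" using ends[OF e] by blast
        note D = phi1[OF ij(2), of n] phi1[OF ij(3), of n]
        note DF = phi1[OF FT[OF ij(2)], of n] phi1[OF FT[OF ij(3)], of n]
        have xs: "x \<in> hseg (\<phi> n i) (\<phi> n j)" using x earc[OF ij(2,3)] ij(1) by simp
        hence x1: "cmod x < 1" "hyp_dist (\<phi> n i) x + hyp_dist x (\<phi> n j) = hyp_dist (\<phi> n i) (\<phi> n j)"
          using mem_hseg_iff[OF D] by auto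
        have "hyp_dist (\<phi> n i) (\<phi> n j) - hyp_dist (f (s n) (\<phi> n i)) (f (s n) (\<phi> n j)) \<le> C"
          using gs[of n] e ij(1) by (simp add: Good_def \<phi>_def ap_def)
        moreover have "hyp_dist (f (s n) (\<phi> n i)) (f (s n) (\<phi> n j)) \<le> C + hyp_dist (\<phi> n (F i)) (\<phi> n (F j)) + C"
          using hyp_dist_triangle[OF fD[OF D(1), of "s n"] DF(1) fD[OF D(2), of "s n"]]
            hyp_dist_triangle[OF DF fD[OF D(2), of "s n"]] vinv[OF ij(2), of n] vinv[OF ij(3), of n]
          by (simp add: hyp_dist_commute[of "\<phi> n (F j)"])
        \<comment> \<open>One C for the loss of length on the edge, two for replacing the images of
          its ends by vertices.\<close>
        ultimately have L: "hyp_dist (\<phi> n i) x + hyp_dist x (\<phi> n j) \<le> hyp_dist (\<phi> n (F i)) (\<phi> n (F j)) + 3 * C"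
          using x1(2) by linarith
        have a: "hyp_dist (f (s n) x) (\<phi> n (F i)) \<le> hyp_dist (\<phi> n i) x + C"
          using hyp_dist_triangle[OF fD[OF x1(1), of "s n"] fD[OF D(1), of "s n"] DF(1)]
            blaschke_products_contract[OF fB d1 x1(1) D(1), of "s n"] vinv[OF ij(2), of n]
          by (simp add: hyp_dist_commute[of x])
        have b: "hyp_dist (f (s n) x) (\<phi> n (F j)) \<le> hyp_dist x (\<phi> n j) + C"
          using hyp_dist_triangle[OF fD[OF x1(1), of "s n"] fD[OF D(2), of "s n"] DF(2)]
            blaschke_products_contract[OF fB d1 x1(1) D(2), of "s n"] vinv[OF ij(3), of n] by simp
        have "\<exists>y\<in>hseg (\<phi> n (F i)) (\<phi> n (F j)). hyp_dist (f (s n) x) y \<le> C + 3 * C + 6"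
          by (rule near_geodesic_image[OF fD[OF x1(1)] DF hyp_dist_nonneg[OF D(1) x1(1)]
              hyp_dist_nonneg[OF x1(1) D(2)] a b C(5) _ L]) (use C(5) in simp)
        moreover have "edge_arc (Tn n) (\<phi> n ` (F ` e)) = hseg (\<phi> n (F i)) (\<phi> n (F j))"
          using earc[OF FT[OF ij(2)] FT[OF ij(3)]] ij(1) by simp
        ultimately show "\<exists>y\<in>edge_arc (Tn n) (\<phi> n ` (F ` e)). hyp_dist (f (s n) x) y \<le> K"
          by (force simp: K_def)
      qed
      show "\<forall>e\<in>edges T. \<forall>q. edge_has_period F e q \<longrightarrow>
           (\<forall>n. \<forall>x\<in>edge_arc (Tn n) (\<phi> n ` e). hyp_dist ((f (s n) ^^ q) x) x \<le> K)"
      proof (intro ballI allI impI)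
        fix e q n x assume e: "e \<in> edges T" and q: "edge_has_period F e q" and x: "x \<in> edge_arc (Tn n) (\<phi> n ` e)"
        obtain i j where ij: "e = {i, j}" "i \<in> verts T" "j \<in> verts T" using ends[OF e] by blast
        note D = phi1[OF ij(2), of n] phi1[OF ij(3), of n]
        have xs: "x \<in> hseg (\<phi> n i) (\<phi> n j)" using x earc[OF ij(2,3)] ij(1) by simp
        hence x1: "cmod x < 1" "hyp_dist (\<phi> n i) x + hyp_dist x (\<phi> n j) = hyp_dist (\<phi> n i) (\<phi> n j)"
          using mem_hseg_iff[OF D] by auto
        have qe: "q = qq e" by (rule qq[OF q])
        have fixq: "hyp_dist ((f (s n) ^^ q) (\<phi> n u)) (\<phi> n u) \<le> C" if "u \<in> e" for u
          using gs[of n] e that unfolding qe by (auto simp: Good_def \<phi>_def apq)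
        note fq = blaschke_funpow[OF fB d1, of _ _ q "s n"]
        have le: "hyp_dist ((f (s n) ^^ q) x) (\<phi> n u) \<le> hyp_dist x (\<phi> n u) + C" if "u \<in> e" for u
        proof -
          have u: "cmod (\<phi> n u) < 1" using that ij phi1 by auto
          show ?thesis
            using hyp_dist_triangle[OF fq(1)[OF x1(1) u] fq(1)[OF u x1(1)] u] fq(2)[OF x1(1) u] fixq[OF that] by linarith
        qed
        have "hyp_dist ((f (s n) ^^ q) x) x \<le> C + 6"
          by (rule hyp_dist_near_segment_point[OF x1(1) fq(1)[OF x1(1) x1(1)] D x1(2)])
            (use le[of i] le[of j] ij(1) in \<open>auto simp: hyp_dist_commute[of x "\<phi> n i"]\<close>)
        thus "hyp_dist ((f (s n) ^^ q) x) x \<le> K" using C(5) by (simp add: K_def)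
      qed
    qed
  qed
qed

end
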